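(* Let $M=(M_k)$ be a weakly log-convex weight sequence with moderate growth, let $p\in[1,\infty)$, and let $\ell,m,n$ be positive integers. Then, under the identification $f\leftrightarrow f^\vee$, $f^\vee(x)(y)=f(x,y)$ (that is, a mapping $f$ belongs to the left-hand side if and only if $f^\vee$ is a well-defined element of the right-hand side, and every element of the right-hand side is of this form), one has \begin{align*} W^{\infty,p}(\mathbb R^\ell\times\mathbb R^m,\mathbb R^n)&=W^{\infty,p}(\mathbb R^\ell,W^{\infty,p}(\mathbb R^m,\mathbb R^n)),\\ W^{[M],p}(\mathbb R^\ell\times\mathbb R^m,\mathbb R^n)&=W^{[M],p}(\mathbb R^\ell,W^{[M],p}(\mathbb R^m,\mathbb R^n)), \end{align*} where $[M]$ stands either for $(M)$ throughout or for $\{M\}$ throughout; the statement holds in both cases.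
   Context: A weight sequence is a sequence $M=(M_k)_{k\in\mathbb N}$, $\mathbb N=\{0,1,\dots\}$, of positive reals with $M_0=1\le M_1$. It is weakly log-convex if $(k!M_k)_k$ is log-convex, and has moderate growth if $\sup_{j,k\ge1}\big(\tfrac{M_{j+k}}{M_jM_k}\big)^{1/(j+k)}<\infty$. Scalar spaces: $W^{\infty,p}(\mathbb R^m)=\{f\in C^\infty(\mathbb R^m):\|f^{(\alpha)}\|_{L^p(\mathbb R^m)}<\infty\ \forall\alpha\in\mathbb N^m\}$ with its natural Fréchet topology. For $\rho>0$, $W^{M,p}_\rho(\mathbb R^m)$ is the Banach space of $f\in C^\infty(\mathbb R^m)$ with norm $\sup_{\alpha\in\mathbb N^m}\frac{\|f^{(\alpha)}\|_{L^p(\mathbb R^m)}}{\rho^{|\alpha|}|\alpha|!M_{|\alpha|}}<\infty$; $W^{(M),p}(\mathbb R^m):=\varprojlim_nW^{M,p}_{1/n}(\mathbb R^m)$ and $W^{\{M\},p}(\mathbb R^m):=\varinjlim_nW^{M,p}_n(\mathbb R^m)$ (locally convex limits, $n\ge1$). For values in $\mathbb R^n$ take $n$-fold products: $W^{\infty,p}(\mathbb R^m,\mathbb R^n)=(W^{\infty,p}(\mathbb R^m))^n$, $W^{[M],p}(\mathbb R^m,\mathbb R^n)=(W^{[M],p}(\mathbb R^m))^n$. Vector-valued spaces: for a locally convex space $F$, - $W^{\infty,p}(\mathbb R^\ell,F)$ is the set of $f\in C^\infty(\mathbb R^\ell,F)$ with $\|s\circ f^{(\alpha)}\|_{L^p(\mathbb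 R^\ell)}<\infty$ for all $\alpha\in\mathbb N^\ell$ and all continuous seminorms $s$ on $F$; - $W^{(M),p}(\mathbb R^\ell,F)$ (resp. $W^{\{M\},p}(\mathbb R^\ell,F)$) is the set of $f\in C^\infty(\mathbb R^\ell,F)$ such that for every continuous seminorm $s$ on $F$ and for all $\sigma>0$ (resp. there exists $\sigma>0$ such that) $\sup_{\alpha\in\mathbb N^\ell}\frac{\|s\circ f^{(\alpha)}\|_{L^p(\mathbb R^\ell)}}{\sigma^{|\alpha|}|\alpha|!M_{|\alpha|}}<\infty$. *)

theory Defs
  imports "HOL-Analysis.Analysis" "HOL-Library.Function_Algebras"
begin

section \<open>Weight sequences\<close>

definition weight_sequence :: "(nat \<Rightarrow> real) \<Rightarrow> bool" where
  "weight_sequence M \<longleftrightarrow> (\<forall>k. 0 < M k) \<and> M 0 = 1 \<and> 1 \<le> M 1"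

definition weakly_log_convex :: "(nat \<Rightarrow> real) \<Rightarrow> bool" where
  "weakly_log_convex M \<longleftrightarrow>
     (\<forall>k\<ge>1. (fact k * M k)\<^sup>2 \<le> (fact (k - 1) * M (k - 1)) * (fact (k + 1) * M (k + 1)))"

definition moderate_growth :: "(nat \<Rightarrow> real) \<Rightarrow> bool" where
  "moderate_growth M \<longleftrightarrow>
     bdd_above {(M (j + k) / (M j * M k)) powr (1 / real (j + k)) | j k. 1 \<le> j \<and> 1 \<le> k}"

section \<open>Locally convex spaces\<close>

text \<open>Function spaces are subspaces of the vector space of all functions, so the latter is
  made an instance of \<open>real_vector\<close> with the pointwise operations.\<close>

instantiation "fun" :: (type, real_vector) real_vector
begin

definition scaleR_fun :: "real \<Rightarrow> ('a \<Rightarrow> 'b) \<Rightarrow> 'a \<Rightarrow> 'b" where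
  "scaleR_fun c f = (\<lambda>x. c *\<^sub>R f x)"

instance
  by standard (simp_all add: scaleR_fun_def fun_eq_iff scaleR_add_right scaleR_add_left)

end

text \<open>A locally convex space is given by its topology, whose \<open>topspace\<close> is the
  underlying vector space (a linear subspace of an ambient type). Hausdorffness is not
  required.\<close>

definition locally_convex_space :: "'b::real_vector topology \<Rightarrow> bool" where
  "locally_convex_space T \<longleftrightarrow>
     subspace (topspace T) \<and>
     continuous_map (prod_topology T T) T (\<lambda>(x, y). x + y) \<and>
     continuous_map (prod_topology euclideanreal T) T (\<lambda>(c, x). c *\<^sub>R x) \<and>
     (\<forall>U. openin T U \<and> 0 \<in> U \<longrightarrow> (\<exists>V. openin T V \<and> 0 \<in> V \<and> convex V \<and> V \<subseteq> U))"

definition seminorm_on :: "'b::real_vector set \<Rightarrow> ('b \<Rightarrow> real) \<Rightarrow> bool" where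
  "seminorm_on V s \<longleftrightarrow>
     (\<forall>x\<in>V. 0 \<le> s x) \<and>
     (\<forall>x\<in>V. \<forall>y\<in>V. s (x + y) \<le> s x + s y) \<and>
     (\<forall>c. \<forall>x\<in>V. s (c *\<^sub>R x) = \<bar>c\<bar> * s x)"

definition continuous_seminorm :: "'b::real_vector topology \<Rightarrow> ('b \<Rightarrow> real) \<Rightarrow> bool" where
  "continuous_seminorm T s \<longleftrightarrow> seminorm_on (topspace T) s \<and> continuous_map T euclideanreal s"

definition seminorm_topology :: "'b::real_vector set \<Rightarrow> ('b \<Rightarrow> real) set \<Rightarrow> 'b topology" where
  "seminorm_topology V P =
     topology_generated_by
       (insert V {{y \<in> V. s (y - x) < e} | s x e. s \<in> P \<and> x \<in> V \<and> 0 < e})"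

text \<open>Projective limit of a decreasing sequence of spaces along the inclusions: the
  intersection with the initial topology, i.e. the diagonal of the product.\<close>

definition projective_limit :: "(nat \<Rightarrow> 'b topology) \<Rightarrow> 'b topology" where
  "projective_limit T = pullback_topology UNIV (\<lambda>x n. x) (product_topology T UNIV)"

text \<open>Locally convex inductive limit of an increasing sequence of spaces along the
  inclusions: the union with the finest locally convex topology making all inclusions
  continuous, obtained as the supremum of all such topologies.\<close>

definition inductive_limit :: "(nat \<Rightarrow> 'b::real_vector topology) \<Rightarrow> 'b topology" where
  "inductive_limit T =
     topology_generated_by
       {U. \<exists>S. locally_convex_space S \<and> topspace S = (\<Union>n. topspace (T n)) \<and>
               (\<forall>n. continuous_map (T n) S (\<lambda>x. x)) \<and> openin S U}"

text \<open>The product of \<open>CARD('n)\<close> copies of a space of scalar functions, with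
  \<open>(f\<^sub>i)\<^sub>i\<close> regarded as a single function with values in \<open>real ^ 'n\<close>.\<close>

definition power_space :: "('a \<Rightarrow> real) topology \<Rightarrow> ('a \<Rightarrow> real ^ 'n) topology" where
  "power_space T =
     pullback_topology UNIV (\<lambda>f i x. f x $ i) (product_topology (\<lambda>_. T) (UNIV :: 'n set))"

section \<open>Smooth maps into locally convex spaces\<close>

definition multi_indices :: "('a::euclidean_space \<Rightarrow> nat) set" where
  "multi_indices = {\<alpha>. \<forall>b. b \<notin> Basis \<longrightarrow> \<alpha> b = 0}"

definition mi_order :: "('a::euclidean_space \<Rightarrow> nat) \<Rightarrow> nat" where
  "mi_order \<alpha> = (\<Sum>b\<in>Basis. \<alpha> b)"

definition has_partial_derivative ::
    "'b::real_vector topology \<Rightarrow> ('a::euclidean_space \<Rightarrow> 'b) \<Rightarrow> 'a \<Rightarrow> ('a \<Rightarrow> 'b) \<Rightarrow> bool" where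
  "has_partial_derivative T f b g \<longleftrightarrow>
     (\<forall>x. limitin T (\<lambda>t. (1 / t) *\<^sub>R (f (x + t *\<^sub>R b) - f x)) (g x) (at (0::real)))"

text \<open>\<open>D\<close> lists the partial derivatives of all orders of \<open>f\<close>, all of them continuous into \<open>T\<close>.
  A single \<open>D \<alpha>\<close> for each multi-index suffices because continuous iterated partial
  derivatives commute.\<close>

definition derivative_family ::
    "'b::real_vector topology \<Rightarrow> ('a::euclidean_space \<Rightarrow> 'b) \<Rightarrow> (('a \<Rightarrow> nat) \<Rightarrow> 'a \<Rightarrow> 'b) \<Rightarrow> bool"
  where
  "derivative_family T f D \<longleftrightarrow>
     D (\<lambda>_. 0) = f \<and>
     (\<forall>\<alpha>\<in>multi_indices.
        continuous_map euclidean T (D \<alpha>) \<and>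
        (\<forall>b\<in>Basis. has_partial_derivative T (D \<alpha>) b (D (\<alpha>(b := Suc (\<alpha> b))))))"

definition smooth_into :: "'b::real_vector topology \<Rightarrow> ('a::euclidean_space \<Rightarrow> 'b) \<Rightarrow> bool" where
  "smooth_into T f \<longleftrightarrow> (\<exists>D. derivative_family T f D)"

text \<open>The derivative \<open>f\<^sup>(\<^sup>\<alpha>\<^sup>)\<close> of a smooth map. On \<open>multi_indices\<close> the family
  is uniquely determined if \<open>T\<close> is Hausdorff.\<close>

definition partial_deriv ::
    "'b::real_vector topology \<Rightarrow> ('a::euclidean_space \<Rightarrow> 'b) \<Rightarrow> ('a \<Rightarrow> nat) \<Rightarrow> 'a \<Rightarrow> 'b" where
  "partial_deriv T f = (SOME D. derivative_family T f D)"

section \<open>Scalar Sobolev and Denjoy-Carleman-Sobolev spaces\<close>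

definition Lp_norm :: "real \<Rightarrow> ('a::euclidean_space \<Rightarrow> real) \<Rightarrow> ennreal" where
  "Lp_norm p g =
     (if integrable lborel (\<lambda>x. \<bar>g x\<bar> powr p)
      then ennreal ((\<integral>x. \<bar>g x\<bar> powr p \<partial>lborel) powr (1 / p)) else \<infinity>)"

text \<open>The weighted supremum, for a family \<open>G\<close> in the role of the derivatives \<open>f\<^sup>(\<^sup>\<alpha>\<^sup>)\<close>.\<close>

definition weighted_sup ::
    "(nat \<Rightarrow> real) \<Rightarrow> real \<Rightarrow> real \<Rightarrow> (('a::euclidean_space \<Rightarrow> nat) \<Rightarrow> 'a \<Rightarrow> real) \<Rightarrow> ennreal" where
  "weighted_sup M p \<rho> G =
     (SUP \<alpha>\<in>multi_indices.
        Lp_norm p (G \<alpha>) / ennreal (\<rho> ^ mi_order \<alpha> * fact (mi_order \<alpha>) * M (mi_order \<alpha>)))"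

definition W_inf :: "real \<Rightarrow> ('a::euclidean_space \<Rightarrow> real) topology" where
  "W_inf p =
     seminorm_topology
       {f. smooth_into euclideanreal f \<and>
           (\<forall>\<alpha>\<in>multi_indices. Lp_norm p (partial_deriv euclideanreal f \<alpha>) < \<infinity>)}
       {\<lambda>f. enn2real (Lp_norm p (partial_deriv euclideanreal f \<alpha>)) | \<alpha>. \<alpha> \<in> multi_indices}"

definition W_step ::
    "(nat \<Rightarrow> real) \<Rightarrow> real \<Rightarrow> real \<Rightarrow> ('a::euclidean_space \<Rightarrow> real) topology" where
  "W_step M p \<rho> =
     seminorm_topology
       {f. smooth_into euclideanreal f \<and>
           weighted_sup M p \<rho> (partial_deriv euclideanreal f) < \<infinity>}
       {\<lambda>f. enn2real (weighted_sup M p \<rho> (partial_deriv euclideanreal f))}"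

definition W_Beurling ::
    "(nat \<Rightarrow> real) \<Rightarrow> real \<Rightarrow> ('a::euclidean_space \<Rightarrow> real) topology" where
  "W_Beurling M p = projective_limit (\<lambda>n. W_step M p (1 / real (Suc n)))"

definition W_Roumieu ::
    "(nat \<Rightarrow> real) \<Rightarrow> real \<Rightarrow> ('a::euclidean_space \<Rightarrow> real) topology" where
  "W_Roumieu M p = inductive_limit (\<lambda>n. W_step M p (real (Suc n)))"

section \<open>Vector-valued spaces\<close>

definition VW_inf ::
    "real \<Rightarrow> 'b::real_vector topology \<Rightarrow> ('a::euclidean_space \<Rightarrow> 'b) set" where
  "VW_inf p T =
     {f. smooth_into T f \<and>
         (\<forall>\<alpha>\<in>multi_indices. \<forall>s. continuous_seminorm T s \<longrightarrow>
            Lp_norm p (s \<circ> partial_deriv T f \<alpha>) < \<infinity>)}"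

definition VW_Beurling ::
    "(nat \<Rightarrow> real) \<Rightarrow> real \<Rightarrow> 'b::real_vector topology \<Rightarrow> ('a::euclidean_space \<Rightarrow> 'b) set" where
  "VW_Beurling M p T =
     {f. smooth_into T f \<and>
         (\<forall>s. continuous_seminorm T s \<longrightarrow>
            (\<forall>\<sigma>>0. weighted_sup M p \<sigma> (\<lambda>\<alpha>. s \<circ> partial_deriv T f \<alpha>) < \<infinity>))}"

definition VW_Roumieu ::
    "(nat \<Rightarrow> real) \<Rightarrow> real \<Rightarrow> 'b::real_vector topology \<Rightarrow> ('a::euclidean_space \<Rightarrow> 'b) set" where
  "VW_Roumieu M p T =
     {f. smooth_into T f \<and>
         (\<forall>s. continuous_seminorm T s \<longrightarrow>
            (\<exists>\<sigma>>0. weighted_sup M p \<sigma> (\<lambda>\<alpha>. s \<circ> partial_deriv T f \<alpha>) < \<infinity>))}"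

text \<open>The identification of \<open>A\<close> with \<open>B\<close> via \<open>f \<mapsto> f\<^sup>\<or>\<close>, \<open>f\<^sup>\<or> x y = f (x, y)\<close>.\<close>

definition exponential_law :: "('a \<times> 'b \<Rightarrow> 'c) set \<Rightarrow> ('a \<Rightarrow> 'b \<Rightarrow> 'c) set \<Rightarrow> bool" where
  "exponential_law A B \<longleftrightarrow>
     (\<forall>f. f \<in> A \<longleftrightarrow> curry f \<in> B) \<and> (\<forall>g\<in>B. \<exists>f\<in>A. g = curry f)"

end

theory Submission
  imports Defs
begin

text \<open>For \<open>f\<close> smooth on \<open>\<real>\<^sup>l \<times> \<real>\<^sup>m\<close>, iterating a one-dimensional estimate over the coordinates gives the
  Sobolev inequality \<open>\<bar>f x\<bar>\<^sup>p \<le> C (\<Sum>\<delta>\<in>\<Delta>. \<integral> \<bar>f\<^sup>(\<^sup>\<delta>\<^sup>)\<bar>\<^sup>p)\<close>. Applied in the first variable only, it bounds the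
  \<open>L\<^sup>p\<close> norms of all derivatives of the slices \<open>f (x, \<cdot>)\<close> uniformly in \<open>x\<close>, and Jensen's inequality
  turns these bounds into Lipschitz estimates for \<open>x \<mapsto> f (x, \<cdot>)\<close> and its difference quotients; hence
  \<open>f\<^sup>\<or>\<close> is smooth. Conversely, by the same inequality point evaluations are continuous on the function
  spaces, so smoothness of \<open>f\<^sup>\<or>\<close> gives smoothness of \<open>f\<close>.
  By Tonelli the \<open>L\<^sup>p\<close> norm of the \<open>(\<alpha>, \<beta>)\<close>-th derivative of \<open>f\<close> is the \<open>L\<^sup>p\<close> norm in \<open>x\<close> of the \<open>L\<^sup>p\<close> norm
  of the \<open>\<beta>\<close>-th derivative of \<open>(f\<^sup>\<or>)\<^sup>(\<^sup>\<alpha>\<^sup>)(x)\<close>; moderate growth splits the weight of \<open>\<bar>\<alpha>\<bar> + \<bar>\<beta>\<bar>\<close>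
  into weights of \<open>\<bar>\<alpha>\<bar>\<close> and \<open>\<bar>\<beta>\<bar>\<close>, and weak log-convexity recombines them.\<close>

section \<open>The \<open>L\<^sup>p\<close> norm\<close>

text \<open>A weighted norm is a supremum over \<open>\<beta>\<close>, and suprema do not commute
  with the integral over the outer variable, so Tonelli alone serves only one \<open>\<beta>\<close>
  at a time. The passage from joint to iterated bounds pays for this with radius: splitting the
  weight costs a factor \<open>2 * H\<close>, and a further factor 2 turns the sum over all
  \<open>\<beta>\<close> into a geometric series; hence the recurring \<open>4 * H\<close>.
  Recombining the weights costs no radius, but in the Roumieu case the radius granted to a seminorm
  may depend on it, so the bounds for single \<open>\<beta>\<close> cannot simply be collected. The
  open sets of the inductive limit have no explicit description; two facts stand in for one: each
  step maps into it continuously, and a seminorm bounded on each step by a multiple of the step norm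
  is continuous on it. As \<open>partial_deriv\<close> is a \<open>SOME\<close> choice,
  vector-valued maps are treated through explicit families of derivatives, identified with the
  choice at the very end by uniqueness of limits. Values in \<open>real ^ 'n\<close> are reduced to
  scalar ones by components.\<close>

definition Lp_integral :: "real \<Rightarrow> ('a::euclidean_space \<Rightarrow> real) \<Rightarrow> ennreal" where
  "Lp_integral p u = (\<integral>\<^sup>+x. ennreal (\<bar>u x\<bar> powr p) \<partial>lborel)"

text \<open>\<open>Lp_norm\<close> is built from the Bochner integral with a separate infinite case,
  whereas Tonelli and monotonicity are available without side conditions for the nonnegative
  integral. Estimates are therefore made for \<open>Lp_integral\<close> and carried over by this
  case distinction.\<close>

lemma Lp_norm_cases:
  assumes "u \<in> borel_measurable borel"
  obtains (inf) "Lp_integral p u = \<infinity>" "Lp_norm p u = \<infinity>"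
  | (fin) r where "0 \<le> r" "Lp_integral p u = ennreal r" "Lp_norm p u = ennreal (r powr (1 / p))"
proof (cases "integrable lborel (\<lambda>x. \<bar>u x\<bar> powr p)")
  case True
  let ?r = "\<integral>x. \<bar>u x\<bar> powr p \<partial>lborel"
  have "Lp_integral p u = ennreal ?r"
    unfolding Lp_integral_def using True by (intro nn_integral_eq_integral) auto
  moreover have "0 \<le> ?r" by (intro integral_nonneg_AE) auto
  moreover have "Lp_norm p u = ennreal (?r powr (1 / p))"
    using True by (simp add: Lp_norm_def)
  ultimately show ?thesis using fin by blast
next
  case False
  have "(\<lambda>x. \<bar>u x\<bar> powr p) \<in> borel_measurable lborel" using assms by simp
  then have "Lp_integral p u = \<infinity>"
    using False by (auto simp: integrable_iff_bounded Lp_integral_def less_top[symmetric])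
  then show ?thesis using False by (intro inf) (auto simp: Lp_norm_def)
qed

lemma powr_inverse_le_iff:
  fixes r c p :: real
  assumes "1 \<le> p" "0 \<le> r" "0 \<le> c"
  shows "r powr (1 / p) \<le> c \<longleftrightarrow> r \<le> c powr p"
proof
  assume "r powr (1 / p) \<le> c"
  then have "(r powr (1 / p)) powr p \<le> c powr p" using assms by (intro powr_mono2) auto
  then show "r \<le> c powr p" using assms by (simp add: powr_powr)
next
  assume "r \<le> c powr p"
  then have "r powr (1 / p) \<le> (c powr p) powr (1 / p)" using assms by (intro powr_mono2) auto
  then show "r powr (1 / p) \<le> c" using assms by (simp add: powr_powr)
qed

lemma Lp_norm_le_iff:
  assumes "1 \<le> p" "u \<in> borel_measurable borel" "0 \<le> c"
  shows "Lp_norm p u \<le> ennreal c \<longleftrightarrow> Lp_integral p u \<le> ennreal (c powr p)"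
  by (rule Lp_norm_cases[OF assms(2), of p])
    (use assms in \<open>auto simp: powr_inverse_le_iff top_unique ennreal_le_iff\<close>)


lemma Lp_integral_of_Lp_norm:
  assumes "1 \<le> p" "u \<in> borel_measurable borel" "Lp_norm p u < \<infinity>"
  shows "Lp_integral p u = ennreal (enn2real (Lp_norm p u) powr p)"
  by (rule Lp_norm_cases[OF assms(2), of p])
    (use assms in \<open>auto simp: powr_powr\<close>)

lemma Lp_norm_mono:
  assumes "1 \<le> p" "u \<in> borel_measurable borel" "v \<in> borel_measurable borel"
    "\<And>x. \<bar>u x\<bar> \<le> \<bar>v x\<bar>"
  shows "Lp_norm p u \<le> Lp_norm p v"
proof -
  have le: "Lp_integral p u \<le> Lp_integral p v"
    unfolding Lp_integral_def using assms by (intro nn_integral_mono ennreal_leI powr_mono2) auto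
  show ?thesis
  proof (rule Lp_norm_cases[OF assms(3), of p])
    fix r assume r: "0 \<le> r" "Lp_integral p v = ennreal r" "Lp_norm p v = ennreal (r powr (1 / p))"
    show ?thesis
      unfolding r(3) using le r assms by (subst Lp_norm_le_iff) (auto simp: powr_powr)
  qed auto
qed

lemma Lp_norm_zero: "0 < p \<Longrightarrow> Lp_norm p (\<lambda>x. 0) = 0"
  by (simp add: Lp_norm_def)

lemma Lp_norm_scale:
  assumes "1 \<le> p"
  shows "Lp_norm p (\<lambda>x. c * u x) = ennreal \<bar>c\<bar> * Lp_norm p u"
proof (cases "c = 0")
  case True
  then show ?thesis using assms by (simp add: Lp_norm_zero)
next
  case False
  have eq: "(\<lambda>x. \<bar>c * u x\<bar> powr p) = (\<lambda>x. \<bar>c\<bar> powr p * \<bar>u x\<bar> powr p)"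
    by (simp add: abs_mult powr_mult)
  have ii: "integrable lborel (\<lambda>x. \<bar>c * u x\<bar> powr p) \<longleftrightarrow> integrable lborel (\<lambda>x. \<bar>u x\<bar> powr p)"
    unfolding eq using False by (simp add: integrable_mult_left_iff)
  have "(\<integral>x. \<bar>c * u x\<bar> powr p \<partial>lborel) powr (1 / p) = \<bar>c\<bar> * (\<integral>x. \<bar>u x\<bar> powr p \<partial>lborel) powr (1 / p)"
    unfolding eq using assms by (simp add: powr_mult powr_powr integral_nonneg_AE)
  then show ?thesis
    using False ii by (auto simp: Lp_norm_def ennreal_mult ennreal_mult_top)
qed

text \<open>Convexity of powers in tangent form; it is the source of both Minkowski's and Jensen's
  inequality below. The convexity argument runs on the open half-line, so \<open>a = 0\<close> is
  separate: there the left side is \<open>(1 - p) * c powr p\<close>.\<close>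

lemma powr_above_tangent:
  fixes a c p :: real
  assumes "1 \<le> p" "0 < c" "0 \<le> a"
  shows "c powr p + p * c powr (p - 1) * (a - c) \<le> a powr p"
proof (cases "a = 0")
  case True
  have "c powr (p - 1) * c = c powr p" using assms by (simp add: powr_diff)
  then have "p * c powr (p - 1) * c = p * c powr p" by simp
  moreover have "c powr p \<le> p * c powr p" using assms by (simp add: mult_le_cancel_right1)
  ultimately show ?thesis using True assms by (simp add: algebra_simps)
next
  case False
  have "a powr p - c powr p \<ge> p * c powr (p - 1) * (a - c)"
  proof (rule convex_on_imp_above_tangent[where A = "{0<..}"])
    show "convex_on {0<..} (\<lambda>x. x powr p)" using assms by (rule_tac powr_convex)
    show "((\<lambda>x. x powr p) has_real_derivative p * c powr (p - 1)) (at c within {0<..})"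
      by (rule has_field_derivative_at_within[OF has_real_derivative_powr[OF assms(2)]])
  qed (use assms False in \<open>auto simp: interior_open\<close>)
  then show ?thesis by simp
qed

text \<open>Weighted sum of the two tangent inequalities at the point \<open>l * x + m * y\<close>,
  where the linear terms cancel.\<close>

lemma powr_convex_combination:
  fixes x y l m p :: real
  assumes "1 \<le> p" "0 \<le> x" "0 \<le> y" "0 \<le> l" "0 \<le> m" "l + m = 1"
  shows "(l * x + m * y) powr p \<le> l * x powr p + m * y powr p"
proof (cases "l * x + m * y = 0")
  case True
  then show ?thesis using assms by simp
next
  case False
  let ?c = "l * x + m * y"
  have c: "0 < ?c" using False assms by (smt (verit) mult_nonneg_nonneg)
  let ?d = "p * ?c powr (p - 1)"
  have "l * (?c powr p + ?d * (x - ?c)) + m * (?c powr p + ?d * (y - ?c))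
      \<le> l * x powr p + m * y powr p"
    using assms c by (intro add_mono mult_left_mono powr_above_tangent) auto
  moreover have "l * (?c powr p + ?d * (x - ?c)) + m * (?c powr p + ?d * (y - ?c))
      = (l + m) * ?c powr p + ?d * (?c - (l + m) * ?c)"
    by (simp add: algebra_simps)
  ultimately show ?thesis using assms by simp
qed

text \<open>Minkowski's inequality by normalisation: |u| + |v| is \<open>a + b\<close> times a
  convex combination, with weights \<open>?l\<close> and \<open>?m\<close>, of |u| / a and |v| / b,
  and the p-th powers of these normalised functions have integral at most 1.\<close>

lemma Lp_integral_add_le:
  assumes p: "1 \<le> p" and [measurable]: "u \<in> borel_measurable borel" "v \<in> borel_measurable borel"
    and a: "0 < a" "0 < b" and u: "Lp_integral p u \<le> ennreal (a powr p)"
        and v: "Lp_integral p v \<le> ennreal (b powr p)"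
  shows "Lp_integral p (\<lambda>x. u x + v x) \<le> ennreal ((a + b) powr p)"
proof -
  let ?l = "a / (a + b)" and ?m = "b / (a + b)"
  let ?A = "(a + b) powr p * ?l / a powr p" and ?B = "(a + b) powr p * ?m / b powr p"
  have lm: "?l + ?m = 1" using a by (simp add: add_divide_distrib[symmetric])
  have le: "\<bar>u x + v x\<bar> powr p \<le> ?A * \<bar>u x\<bar> powr p + ?B * \<bar>v x\<bar> powr p" for x
  proof -
    have "\<bar>u x + v x\<bar> powr p \<le> ((a + b) * (?l * (\<bar>u x\<bar> / a) + ?m * (\<bar>v x\<bar> / b))) powr p"
    proof (rule powr_mono2)
      have "(a + b) * (?l * (\<bar>u x\<bar> / a) + ?m * (\<bar>v x\<bar> / b)) = \<bar>u x\<bar> + \<bar>v x\<bar>"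
        using a by (simp add: distrib_left)
      then show "\<bar>u x + v x\<bar> \<le> (a + b) * (?l * (\<bar>u x\<bar> / a) + ?m * (\<bar>v x\<bar> / b))"
        by linarith
    qed (use p in auto)
    also have "\<dots> = (a + b) powr p * (?l * (\<bar>u x\<bar> / a) + ?m * (\<bar>v x\<bar> / b)) powr p"
      by (rule powr_mult)
    also have "\<dots> \<le> (a + b) powr p * (?l * (\<bar>u x\<bar> / a) powr p + ?m * (\<bar>v x\<bar> / b) powr p)"
      using a p lm by (intro mult_left_mono powr_convex_combination) auto
    also have "\<dots> = ?A * \<bar>u x\<bar> powr p + ?B * \<bar>v x\<bar> powr p"
      using a by (simp add: powr_divide algebra_simps)
    finally show ?thesis .
  qed
  have "Lp_integral p (\<lambda>x. u x + v x) \<le> (\<integral>\<^sup>+x. ennreal ?A * ennreal (\<bar>u x\<bar> powr p) + ennreal ?B *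
      ennreal (\<bar>v x\<bar> powr p) \<partial>lborel)"
    unfolding Lp_integral_def
    using le a by (intro nn_integral_mono) (simp add: ennreal_mult'[symmetric]
        ennreal_plus[symmetric] del: ennreal_plus)
  also have "\<dots> = ennreal ?A * Lp_integral p u + ennreal ?B * Lp_integral p v"
    unfolding Lp_integral_def by (subst nn_integral_add) (auto simp: nn_integral_cmult)
  also have "\<dots> \<le> ennreal ?A * ennreal (a powr p) + ennreal ?B * ennreal (b powr p)"
    by (intro add_mono mult_left_mono u v) auto
  also have "\<dots> = ennreal (?A * a powr p + ?B * b powr p)"
    using a by (simp add: ennreal_mult'[symmetric] ennreal_plus[symmetric] del: ennreal_plus)
  also have "?A * a powr p + ?B * b powr p = (a + b) powr p * (?l + ?m)"
    using a by (simp add: distrib_left)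
  also note lm
  finally show ?thesis by simp
qed

lemma Lp_norm_add:
  assumes p: "1 \<le> p" and [measurable]: "u \<in> borel_measurable borel" "v \<in> borel_measurable borel"
  shows "Lp_norm p (\<lambda>x. u x + v x) \<le> Lp_norm p u + Lp_norm p v"
proof (cases "Lp_norm p u < \<infinity> \<and> Lp_norm p v < \<infinity>")
  case True
  let ?a = "enn2real (Lp_norm p u)" and ?b = "enn2real (Lp_norm p v)"
  \<comment> \<open>The integral form needs strictly positive bounds while the norms may vanish;
    both are raised by \<open>e / 2\<close>, and \<open>e\<close> is then removed.\<close>
  have "Lp_norm p (\<lambda>x. u x + v x) \<le> ennreal (?a + ?b) + ennreal e" if e: "0 < e" for e
  proof -
    have "Lp_integral p (\<lambda>x. u x + v x) \<le> ennreal (((?a + e / 2) + (?b + e / 2)) powr p)"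
      using True p e
      by (intro Lp_integral_add_le) (auto simp: Lp_integral_of_Lp_norm intro!: add_nonneg_pos
          powr_mono2)
    then have "Lp_norm p (\<lambda>x. u x + v x) \<le> ennreal ((?a + e / 2) + (?b + e / 2))"
      using p e by (subst Lp_norm_le_iff) auto
    also have "(?a + e / 2) + (?b + e / 2) = (?a + ?b) + e" by simp
    finally show ?thesis using e by simp
  qed
  then have "Lp_norm p (\<lambda>x. u x + v x) \<le> ennreal (?a + ?b)"
    by (rule ennreal_le_epsilon) auto
  also have "\<dots> = Lp_norm p u + Lp_norm p v" using True by simp
  finally show ?thesis .
next
  case False
  then show ?thesis by (auto simp: not_less top_unique)
qed

lemma Lp_norm_sum:
  assumes p: "1 \<le> p" and "finite I" "\<And>i. i \<in> I \<Longrightarrow> v i \<in> borel_measurable borel"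
  shows "Lp_norm p (\<lambda>x. \<Sum>i\<in>I. v i x) \<le> (\<Sum>i\<in>I. Lp_norm p (v i))"
  using assms(2,3)
proof (induction I rule: finite_induct)
  case empty
  then show ?case using p by (simp add: Lp_norm_zero)
next
  case (insert i I)
  have "Lp_norm p (\<lambda>x. v i x + (\<Sum>i\<in>I. v i x)) \<le> Lp_norm p (v i) + Lp_norm p (\<lambda>x. \<Sum>i\<in>I. v i x)"
    using insert by (intro Lp_norm_add p) auto
  also have "\<dots> \<le> Lp_norm p (v i) + (\<Sum>i\<in>I. Lp_norm p (v i))"
    using insert by (intro add_left_mono) auto
  finally show ?case using insert by simp
qed

lemma Lp_norm_le_sum:
  assumes p: "1 \<le> p" and "finite I" "u \<in> borel_measurable borel"
    "\<And>i. i \<in> I \<Longrightarrow> v i \<in> borel_measurable borel"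
    and "\<And>x. \<bar>u x\<bar> \<le> (\<Sum>i\<in>I. \<bar>v i x\<bar>)"
  shows "Lp_norm p u \<le> (\<Sum>i\<in>I. Lp_norm p (v i))"
proof -
  have "Lp_norm p u \<le> Lp_norm p (\<lambda>x. \<Sum>i\<in>I. \<bar>v i x\<bar>)"
    using assms by (intro Lp_norm_mono) (auto intro!: borel_measurable_sum)
  also have "\<dots> \<le> (\<Sum>i\<in>I. Lp_norm p (\<lambda>x. \<bar>v i x\<bar>))"
    using assms by (intro Lp_norm_sum) auto
  also have "\<dots> = (\<Sum>i\<in>I. Lp_norm p (v i))" by (simp add: Lp_norm_def cong: if_cong)
  finally show ?thesis .
qed

lemma powr_add_le:
  fixes a b p :: real
  assumes "1 \<le> p" "0 \<le> a" "0 \<le> b"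
  shows "(a + b) powr p \<le> 2 powr p * (a powr p + b powr p)"
proof -
  have "(a + b) powr p \<le> (2 * max a b) powr p" using assms by (intro powr_mono2) auto
  also have "\<dots> = 2 powr p * max a b powr p" using assms by (simp add: powr_mult)
  also have "\<dots> \<le> 2 powr p * (a powr p + b powr p)" by (auto simp: max_def)
  finally show ?thesis .
qed

text \<open>Jensen's inequality: integrate the tangent line of \<open>x\<^sup>p\<close> at the mean of \<open>\<bar>h'\<bar>\<close>.\<close>

lemma increment_powr_le:
  fixes h h' :: "real \<Rightarrow> real"
  assumes p: "1 \<le> p" and ab: "a < b"
    and der: "\<And>t. (h has_real_derivative h' t) (at t)" and cont: "continuous_on UNIV h'"
  shows "ennreal (\<bar>h b - h a\<bar> powr p)
    \<le> ennreal ((b - a) powr (p - 1)) * (\<integral>\<^sup>+s. ennreal (\<bar>h' s\<bar> powr p) * indicator {a..b} s \<partial>lborel)"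
proof -
  have c1: "continuous_on {a..b} (\<lambda>t. \<bar>h' t\<bar>)"
    by (intro continuous_intros continuous_on_subset[OF cont]) auto
  have c2: "continuous_on {a..b} (\<lambda>t. \<bar>h' t\<bar> powr p)"
    using p by (intro continuous_on_powr' c1 continuous_intros) auto
  define A where "A = integral {a..b} (\<lambda>t. \<bar>h' t\<bar>)"
  define B where "B = integral {a..b} (\<lambda>t. \<bar>h' t\<bar> powr p)"
  have "(h' has_integral (h b - h a)) {a..b}"
    using ab by (intro fundamental_theorem_of_calculus)
      (simp_all add: has_real_derivative_iff_has_vector_derivative[symmetric]
          has_field_derivative_at_within[OF der])
  then have "\<bar>h b - h a\<bar> \<le> A"
    unfolding A_def using integral_norm_bound_integral[of h' "{a..b}" "\<lambda>t. \<bar>h' t\<bar>"]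
      integrable_continuous_interval[OF c1] by (auto simp: has_integral_iff)
  moreover have "A powr p \<le> (b - a) powr (p - 1) * B" if A: "0 < A"
  proof -
    define c where "c = A / (b - a)"
    have c: "0 < c" using A ab by (simp add: c_def)
    have "integral {a..b} (\<lambda>t. c powr p + p * c powr (p - 1) * (\<bar>h' t\<bar> - c)) \<le> B"
      unfolding B_def using p c
      by (intro integral_le powr_above_tangent integrable_continuous_interval c2 continuous_intros
          c1) auto
    also have "integral {a..b} (\<lambda>t. c powr p + p * c powr (p - 1) * (\<bar>h' t\<bar> - c))
       = (b - a) * c powr p + p * c powr (p - 1) * (A - (b - a) * c)"
    proof (rule integral_unique)
      have const: "((\<lambda>t. k) has_integral (b - a) * k) {a..b}" for k :: real
        using has_integral_const_real[of k a b] ab by simp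
      show "((\<lambda>t. c powr p + p * c powr (p - 1) * (\<bar>h' t\<bar> - c)) has_integral
          (b - a) * c powr p + p * c powr (p - 1) * (A - (b - a) * c)) {a..b}"
        unfolding A_def
        by (intro has_integral_add has_integral_mult_right has_integral_diff const
            integrable_integral integrable_continuous_interval c1)
    qed
    \<comment> \<open>Because \<open>c\<close> is the mean, the linear term of the tangent
      integrates to zero.\<close>
    also have "(b - a) * c = A" using ab by (simp add: c_def)
    finally have "(b - a) * c powr p \<le> B" by simp
    then have "(b - a) powr (p - 1) * ((b - a) * c powr p) \<le> (b - a) powr (p - 1) * B"
      by (intro mult_left_mono) auto
    moreover have "(b - a) powr (p - 1) * ((b - a) * c powr p) = A powr p"
      using ab A by (simp add: c_def powr_divide powr_diff)
    ultimately show ?thesis by simp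
  qed
  moreover have "0 \<le> B" unfolding B_def
      by (intro integral_nonneg integrable_continuous_interval c2) auto
  moreover have "\<bar>h b - h a\<bar> powr p \<le> A powr p"
    using calculation(1) p by (intro powr_mono2) auto
  ultimately have "\<bar>h b - h a\<bar> powr p \<le> (b - a) powr (p - 1) * B"
  proof (cases "0 < A")
    case False
    then have "h b - h a = 0" using \<open>\<bar>h b - h a\<bar> \<le> A\<close> by linarith
    then show ?thesis using \<open>0 \<le> B\<close> by simp
  qed (meson order_trans)
  moreover have "(\<integral>\<^sup>+s. ennreal (\<bar>h' s\<bar> powr p) * indicator {a..b} s \<partial>lborel) = ennreal B"
    unfolding B_def
    by (intro nn_integral_has_integral_lebesgue' integrable_integral
        integrable_continuous_interval c2)
      auto
  ultimately show ?thesis using \<open>0 \<le> B\<close>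
    by (simp add: ennreal_mult[symmetric])
qed

section \<open>Families of partial derivatives\<close>

lemma multi_indices_zero: "0 \<in> multi_indices" "(\<lambda>_. 0) \<in> multi_indices"
  by (auto simp: multi_indices_def)

lemma multi_indices_add: "\<alpha> \<in> multi_indices \<Longrightarrow> \<beta> \<in> multi_indices \<Longrightarrow> \<alpha> + \<beta> \<in> multi_indices"
  by (auto simp: multi_indices_def)

lemma multi_indices_upd: "\<alpha> \<in> multi_indices \<Longrightarrow> b \<in> Basis \<Longrightarrow> \<alpha>(b := k) \<in> multi_indices"
  by (auto simp: multi_indices_def)


lemma le_mi_order: "b \<in> Basis \<Longrightarrow> \<alpha> b \<le> mi_order \<alpha>"
  unfolding mi_order_def by (rule member_le_sum) auto

lemma finite_multi_indices_bounded: "finite {\<alpha> \<in> multi_indices. \<forall>b. \<alpha> b \<le> N}"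
proof (rule finite_subset)
  show "finite {f. \<forall>b. (b \<in> Basis \<longrightarrow> f b \<in> {..N}) \<and> (b \<notin> Basis \<longrightarrow> f b = 0)}"
    by (intro finite_set_of_finite_funs) auto
qed (auto simp: multi_indices_def)

lemma multi_indices_bounded: "\<alpha> \<in> multi_indices \<Longrightarrow> \<alpha> b \<le> mi_order \<alpha>"
  by (cases "b \<in> Basis") (auto simp: multi_indices_def le_mi_order)

lemma countable_multi_indices: "countable (multi_indices :: ('a::euclidean_space \<Rightarrow> nat) set)"
proof (rule countable_subset)
  show "countable (\<Union>N. {\<alpha> \<in> multi_indices :: ('a \<Rightarrow> nat) set. \<forall>b. \<alpha> b \<le> N})"
    by (rule countable_UN) (auto intro: countable_finite finite_multi_indices_bounded)
qed (use multi_indices_bounded in blast)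

text \<open>A family of derivatives is constrained only through raising one entry at a time, so
  facts about all orders are proved along this induction. A nonzero index arises from one of order
  one less by raising any of its nonzero entries.\<close>

lemma multi_indices_induct [consumes 1, case_names zero Suc]:
  assumes "\<alpha> \<in> multi_indices" "P (\<lambda>_. 0)"
    and "\<And>\<beta> b. \<beta> \<in> multi_indices \<Longrightarrow> b \<in> Basis \<Longrightarrow> P \<beta> \<Longrightarrow> P (\<beta>(b := Suc (\<beta> b)))"
  shows "P \<alpha>"
  using assms(1)
proof (induction "mi_order \<alpha>" arbitrary: \<alpha>)
  case 0
  have "\<alpha> b = 0" for b using multi_indices_bounded[of \<alpha> b] 0 by simp
  then have "\<alpha> = (\<lambda>_. 0)" by auto
  then show ?case using assms by simp
next
  case (Suc n)
  then have "mi_order \<alpha> \<noteq> 0" by simp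
  then obtain b where b: "b \<in> Basis" "\<alpha> b \<noteq> 0"
    by (auto simp: mi_order_def)
  define \<beta> where "\<beta> = \<alpha>(b := \<alpha> b - 1)"
  have \<beta>: "\<beta> \<in> multi_indices" unfolding \<beta>_def using Suc b by (intro multi_indices_upd) auto
  have eq: "\<alpha> = \<beta>(b := Suc (\<beta> b))" using b by (auto simp: \<beta>_def)
  have "mi_order \<alpha> = \<alpha> b + sum \<alpha> (Basis - {b})" "mi_order \<beta> = \<beta> b + sum \<beta> (Basis - {b})"
    unfolding mi_order_def using b by (auto intro: sum.remove)
  moreover have "sum \<beta> (Basis - {b}) = sum \<alpha> (Basis - {b})" by (rule sum.cong) (auto simp: \<beta>_def)
  ultimately have "mi_order \<beta> = n" using Suc b by (simp add: \<beta>_def)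
  then show ?case using Suc(1)[of \<beta>] assms(3)[of \<beta> b] \<beta> b eq by metis
qed

lemma derivative_familyD:
  assumes "derivative_family T f D"
  shows "D (\<lambda>_. 0) = f" "\<And>\<alpha>. \<alpha> \<in> multi_indices \<Longrightarrow> continuous_map euclidean T (D \<alpha>)"
    "\<And>\<alpha> b. \<alpha> \<in> multi_indices \<Longrightarrow> b \<in> Basis \<Longrightarrow> has_partial_derivative T (D \<alpha>) b (D (\<alpha>(b := Suc (\<alpha> b))))"
    "\<And>\<alpha> x. \<alpha> \<in> multi_indices \<Longrightarrow> D \<alpha> x \<in> topspace T"
  using assms by (simp_all add: derivative_family_def continuous_map_def Pi_iff)

text \<open>\<open>partial_deriv\<close> is a \<open>SOME\<close> choice, so what is known of an
  explicit family reaches it only through uniqueness. Uniqueness of limits is assumed directly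
  because it can be checked component by component, without separating open sets.\<close>

lemma derivative_family_unique:
  assumes "\<And>F (u :: real \<Rightarrow> 'b::real_vector) l l'. F \<noteq> bot \<Longrightarrow> limitin T u l F \<Longrightarrow> limitin T u l' F \<Longrightarrow>
      l = l'"
    and "derivative_family T f D" "derivative_family T f E" "\<alpha> \<in> multi_indices"
  shows "D \<alpha> = E \<alpha>"
  using assms(4)
proof (induction rule: multi_indices_induct)
  case zero
  then show ?case using assms by (simp add: derivative_family_def)
next
  case (Suc \<beta> b)
  have "has_partial_derivative T (D \<beta>) b (D (\<beta>(b := Suc (\<beta> b))))"
    "has_partial_derivative T (D \<beta>) b (E (\<beta>(b := Suc (\<beta> b))))"
    using derivative_familyD(3)[OF assms(2) Suc(1,2)] derivative_familyD(3)[OF assms(3) Suc(1,2)]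
        Suc.IH by auto
  then show ?case
    unfolding has_partial_derivative_def fun_eq_iff
    using assms(1)[OF at_neq_bot] by blast
qed


lemma derivative_family_partial_deriv:
  "smooth_into T f \<Longrightarrow> derivative_family T f (partial_deriv T f)"
  unfolding smooth_into_def partial_deriv_def by (rule someI_ex[of "derivative_family T f"])

section \<open>Scalar smooth functions and the norms of their derivatives\<close>

abbreviation smooth :: "('a::euclidean_space \<Rightarrow> real) \<Rightarrow> bool" where
  "smooth \<equiv> smooth_into euclideanreal"

abbreviation pd :: "('a::euclidean_space \<Rightarrow> real) \<Rightarrow> ('a \<Rightarrow> nat) \<Rightarrow> 'a \<Rightarrow> real" where
  "pd \<equiv> partial_deriv euclideanreal"

abbreviation scalar_family :: "('a::euclidean_space \<Rightarrow> real) \<Rightarrow> (('a \<Rightarrow> nat) \<Rightarrow> 'a \<Rightarrow> real) \<Rightarrow> bool" where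
  "scalar_family \<equiv> derivative_family euclideanreal"

lemmas pd_family = derivative_family_partial_deriv[of euclideanreal]

text \<open>Gives access to one-variable calculus: since \<open>x + t *\<^sub>R b\<close> is again a
  base point, difference quotients converging at every base point amount to differentiability at
  every parameter of every line in direction \<open>b\<close>.\<close>

lemma has_partial_derivative_real:
  "has_partial_derivative euclideanreal f b g \<longleftrightarrow>
    (\<forall>x t. ((\<lambda>t. f (x + t *\<^sub>R b)) has_real_derivative g (x + t *\<^sub>R b)) (at t))"
proof -
  have "((\<lambda>t. f (x + t *\<^sub>R b)) has_real_derivative g (x + t *\<^sub>R b)) (at t) \<longleftrightarrow>
     ((\<lambda>h. (1 / h) *\<^sub>R (f ((x + t *\<^sub>R b) + h *\<^sub>R b) - f (x + t *\<^sub>R b))) \<longlongrightarrow> g (x + t *\<^sub>R b)) (at 0)"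
         for x t
    unfolding DERIV_def by (simp add: scaleR_left_distrib add.assoc)
  then have "(\<forall>x t. ((\<lambda>t. f (x + t *\<^sub>R b)) has_real_derivative g (x + t *\<^sub>R b)) (at t)) \<longleftrightarrow>
     (\<forall>x t. ((\<lambda>h. (1 / h) *\<^sub>R (f ((x + t *\<^sub>R b) + h *\<^sub>R b) - f (x + t *\<^sub>R b))) \<longlongrightarrow> g (x + t *\<^sub>R b))
         (at 0))"
    (is "_ \<longleftrightarrow> (\<forall>x t. ?P (x + t *\<^sub>R b))") by blast
  also have "\<dots> \<longleftrightarrow> (\<forall>x. ?P x)"
  proof (intro iffI allI)
    fix x assume "\<forall>x t. ?P (x + t *\<^sub>R b)"
    from this[rule_format, of x 0] show "?P x" by simp
  qed blast
  finally show ?thesis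
    unfolding has_partial_derivative_def limitin_canonical_iff by simp
qed

lemma scalar_family_iff:
  "scalar_family f D \<longleftrightarrow> D (\<lambda>_. 0) = f \<and> (\<forall>\<alpha>\<in>multi_indices. continuous_on UNIV (D \<alpha>) \<and>
    (\<forall>b\<in>Basis. \<forall>x t. ((\<lambda>t. D \<alpha> (x + t *\<^sub>R b)) has_real_derivative
      D (\<alpha>(b := Suc (\<alpha> b))) (x + t *\<^sub>R b)) (at t)))"
  unfolding derivative_family_def has_partial_derivative_real
      by (simp add: continuous_map_iff_continuous2)

lemma scalar_family_D:
  assumes "scalar_family f D" "\<alpha> \<in> multi_indices"
  shows "continuous_on UNIV (D \<alpha>)" "D \<alpha> \<in> borel_measurable borel"
    "b \<in> Basis \<Longrightarrow> ((\<lambda>t. D \<alpha> (x + t *\<^sub>R b)) has_real_derivative D (\<alpha>(b := Suc (\<alpha> b))) (x + t *\<^sub>R b))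
      (at t)"
  using assms by (auto simp: scalar_family_iff intro: borel_measurable_continuous_onI)

lemma scalar_family_smooth: "scalar_family f D \<Longrightarrow> smooth f"
  by (auto simp: smooth_into_def)

text \<open>The way concrete derivatives are computed: exhibit a family, and uniqueness of real
  limits identifies it with the chosen \<open>pd\<close>.\<close>

lemma scalar_family_pd:
  assumes "scalar_family f D" "\<alpha> \<in> multi_indices"
  shows "pd f \<alpha> = D \<alpha>"
proof (rule derivative_family_unique[where T = euclideanreal])
  show "scalar_family f (pd f)" by (rule pd_family[OF scalar_family_smooth[OF assms(1)]])
qed (use assms tendsto_unique in auto)

lemma pd_zero: "smooth f \<Longrightarrow> pd f (\<lambda>_. 0) = f"
  by (rule derivative_familyD(1)[OF pd_family])


lemma pd_measurable: "smooth f \<Longrightarrow> \<alpha> \<in> multi_indices \<Longrightarrow> pd f \<alpha> \<in> borel_measurable borel"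
  by (rule scalar_family_D(2)[OF pd_family])

lemma pd_continuous: "smooth f \<Longrightarrow> \<alpha> \<in> multi_indices \<Longrightarrow> continuous_on UNIV (pd f \<alpha>)"
  by (rule scalar_family_D(1)[OF pd_family])

lemma scalar_family_add:
  assumes "scalar_family f D" "scalar_family g E"
  shows "scalar_family (f + g) (\<lambda>\<alpha>. D \<alpha> + E \<alpha>)"
  using assms unfolding scalar_family_iff plus_fun_def
  by (auto intro!: continuous_on_add DERIV_add)

lemma scalar_family_scale:
  assumes "scalar_family f D"
  shows "scalar_family (c *\<^sub>R f) (\<lambda>\<alpha>. c *\<^sub>R D \<alpha>)"
  using assms unfolding scalar_family_iff scaleR_fun_def
  by (auto intro!: continuous_intros DERIV_cmult)

lemma scalar_family_zero: "scalar_family 0 (\<lambda>_. 0)"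
  unfolding scalar_family_iff by (auto simp: zero_fun_def)

lemma smooth_add: "smooth f \<Longrightarrow> smooth g \<Longrightarrow> smooth (f + g)"
  and smooth_scale: "smooth f \<Longrightarrow> smooth (c *\<^sub>R f)"
  and smooth_zero: "smooth 0"
  by (meson scalar_family_add scalar_family_scale scalar_family_zero smooth_into_def)+

lemma pd_add: "smooth f \<Longrightarrow> smooth g \<Longrightarrow> \<alpha> \<in> multi_indices \<Longrightarrow> pd (f + g) \<alpha> = pd f \<alpha> + pd g \<alpha>"
  by (rule scalar_family_pd[OF scalar_family_add[OF pd_family pd_family]])

lemma pd_scale: "smooth f \<Longrightarrow> \<alpha> \<in> multi_indices \<Longrightarrow> pd (c *\<^sub>R f) \<alpha> = c *\<^sub>R pd f \<alpha>"
  by (rule scalar_family_pd[OF scalar_family_scale[OF pd_family]])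

lemma pd_of_zero: "\<alpha> \<in> multi_indices \<Longrightarrow> pd 0 \<alpha> = 0"
  by (simp add: scalar_family_pd[OF scalar_family_zero])

lemma smooth_diff: "smooth f \<Longrightarrow> smooth g \<Longrightarrow> smooth (f - g)"
  using smooth_add[OF _ smooth_scale[of g "-1"], of f] by (simp add: scaleR_minus_left)

lemma pd_diff: "smooth f \<Longrightarrow> smooth g \<Longrightarrow> \<alpha> \<in> multi_indices \<Longrightarrow> pd (f - g) \<alpha> = pd f \<alpha> - pd g \<alpha>"
  using pd_add[of f "-1 *\<^sub>R g" \<alpha>] pd_scale[of g \<alpha> "-1"] smooth_scale[of g "-1"] by simp

definition pd_norm :: "real \<Rightarrow> ('a::euclidean_space \<Rightarrow> nat) \<Rightarrow> ('a \<Rightarrow> real) \<Rightarrow> ennreal" where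
  "pd_norm p \<alpha> f = Lp_norm p (pd f \<alpha>)"

lemma pd_norm_add:
  "1 \<le> p \<Longrightarrow> smooth f \<Longrightarrow> smooth g \<Longrightarrow> \<alpha> \<in> multi_indices \<Longrightarrow>
    pd_norm p \<alpha> (f + g) \<le> pd_norm p \<alpha> f + pd_norm p \<alpha> g"
  unfolding pd_norm_def using Lp_norm_add[of p "pd f \<alpha>" "pd g \<alpha>"]
  by (simp add: pd_add plus_fun_def[of "pd f \<alpha>"] pd_measurable)

lemma pd_norm_scale:
  "1 \<le> p \<Longrightarrow> smooth f \<Longrightarrow> \<alpha> \<in> multi_indices \<Longrightarrow> pd_norm p \<alpha> (c *\<^sub>R f) = ennreal \<bar>c\<bar> * pd_norm p \<alpha> f"
  unfolding pd_norm_def by (simp add: pd_scale scaleR_fun_def[of c "pd f \<alpha>"] Lp_norm_scale)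

lemma pd_norm_zero: "1 \<le> p \<Longrightarrow> \<alpha> \<in> multi_indices \<Longrightarrow> pd_norm p \<alpha> 0 = 0"
  unfolding pd_norm_def using Lp_norm_zero[of p] by (simp add: pd_of_zero) (simp add: zero_fun_def)

lemma pd_norm_power:
  assumes "1 \<le> p" "smooth f" "\<alpha> \<in> multi_indices" "pd_norm p \<alpha> f < \<infinity>"
  shows "Lp_integral p (pd f \<alpha>) = ennreal (enn2real (pd_norm p \<alpha> f) powr p)"
  using assms unfolding pd_norm_def by (intro Lp_integral_of_Lp_norm pd_measurable)

section \<open>A Sobolev inequality\<close>

lemma ennreal_powr_add_le:
  fixes a b p :: real
  assumes "1 \<le> p" "0 \<le> a" "0 \<le> b"
  shows "ennreal ((a + b) powr p) \<le> ennreal (2 powr p) * (ennreal (a powr p) + ennreal (b powr p))"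
  using powr_add_le[OF assms] by (simp add: ennreal_plus[symmetric] ennreal_mult'[symmetric]
      del: ennreal_plus)

text \<open>The minimum of |h| on [0, 1] is controlled by the integral of the p-th power there, as
  the interval has length 1. The way from the minimiser \<open>t\<close> back to 0 is controlled by
  \<open>increment_powr_le\<close>, whose factor \<open>t powr (p - 1)\<close> is at most 1.\<close>

lemma sobolev_line:
  fixes h h' :: "real \<Rightarrow> real"
  assumes p: "1 \<le> p"
    and der: "\<And>t. (h has_real_derivative h' t) (at t)" and cont: "continuous_on UNIV h'"
  shows "ennreal (\<bar>h 0\<bar> powr p) \<le> ennreal (2 powr p) * (Lp_integral p h + Lp_integral p h')"
proof -
  have ch: "continuous_on UNIV h"
    using der DERIV_isCont by (auto intro!: continuous_at_imp_continuous_on)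
  have "\<exists>t\<in>{0..1}. \<forall>s\<in>{0..1}. \<bar>h t\<bar> \<le> \<bar>h s\<bar>"
    by (rule continuous_attains_inf) (auto intro!: continuous_intros continuous_on_subset[OF ch])
  then obtain t where t: "0 \<le> t" "t \<le> 1" and min: "\<And>s. s \<in> {0..1} \<Longrightarrow> \<bar>h t\<bar> \<le> \<bar>h s\<bar>" by auto
  have "ennreal (\<bar>h t\<bar> powr p) = (\<integral>\<^sup>+s. ennreal (\<bar>h t\<bar> powr p) * indicator {0..1::real} s \<partial>lborel)"
    by (subst nn_integral_cmult_indicator) auto
  also have "\<dots> \<le> Lp_integral p h"
    unfolding Lp_integral_def using p min
    by (intro nn_integral_mono) (auto simp: indicator_def intro!: ennreal_leI powr_mono2)
  finally have 1: "ennreal (\<bar>h t\<bar> powr p) \<le> Lp_integral p h" .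
  have 2: "ennreal (\<bar>h t - h 0\<bar> powr p) \<le> Lp_integral p h'"
  proof (cases "t = 0")
    case True
    then show ?thesis using p by simp
  next
    case False
    have "ennreal (\<bar>h t - h 0\<bar> powr p)
      \<le> ennreal ((t - 0) powr (p - 1)) * (\<integral>\<^sup>+s. ennreal (\<bar>h' s\<bar> powr p) * indicator {0..t} s
          \<partial>lborel)"
      using t False by (intro increment_powr_le p der cont) auto
    also have "\<dots> \<le> 1 * Lp_integral p h'"
    proof (rule mult_mono)
      have "t powr (p - 1) \<le> 1 powr (p - 1)" using t p by (intro powr_mono2) auto
      then show "ennreal ((t - 0) powr (p - 1)) \<le> 1" by simp
      show "(\<integral>\<^sup>+s. ennreal (\<bar>h' s\<bar> powr p) * indicator {0..t} s \<partial>lborel) \<le> Lp_integral p h'"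
        unfolding Lp_integral_def by (intro nn_integral_mono) (auto simp: indicator_def)
    qed auto
    finally show ?thesis by simp
  qed
  have "ennreal (\<bar>h 0\<bar> powr p) \<le> ennreal ((\<bar>h t\<bar> + \<bar>h t - h 0\<bar>) powr p)"
    using p by (intro ennreal_leI powr_mono2) auto
  also have "\<dots> \<le> ennreal (2 powr p) * (ennreal (\<bar>h t\<bar> powr p) + ennreal (\<bar>h t - h 0\<bar> powr p))"
    using p by (intro ennreal_powr_add_le) auto
  also have "\<dots> \<le> ennreal (2 powr p) * (Lp_integral p h + Lp_integral p h')"
    by (intro mult_left_mono add_mono 1 2) auto
  finally show ?thesis .
qed

text \<open>Iterates the one-dimensional estimate over the directions in \<open>J\<close>; each
  direction adjoins the indices raised in that direction. \<open>\<Delta>\<close> and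
  \<open>C\<close> are fixed before the function and the order \<open>\<alpha>\<close>, which later
  makes the bounds uniform over slices and over \<open>\<beta>\<close>.\<close>

lemma sobolev_partial:
  assumes p: "1 \<le> p" and J: "finite J" "J \<subseteq> (Basis :: 'a::euclidean_space set)"
  shows "\<exists>\<Delta> C. finite \<Delta> \<and> \<Delta> \<subseteq> multi_indices \<and> 0 \<le> C \<and>
    (\<forall>(f :: 'a \<Rightarrow> real) D \<alpha> x. scalar_family f D \<longrightarrow> \<alpha> \<in> multi_indices \<longrightarrow>
      ennreal (\<bar>D \<alpha> x\<bar> powr p) \<le> ennreal C * (\<Sum>\<delta>\<in>\<Delta>.
        \<integral>\<^sup>+t. ennreal (\<bar>D (\<alpha> + \<delta>) (x + (\<Sum>b\<in>J. t b *\<^sub>R b))\<bar> powr p) \<partial>(\<Pi>\<^sub>M b\<in>J. lborel)))"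
  using J
proof (induction J rule: finite_induct)
  case empty
  have [simp]: "\<alpha> + 0 = \<alpha>" for \<alpha> :: "'a \<Rightarrow> nat" by auto
  have "(\<integral>\<^sup>+t. c \<partial>(\<Pi>\<^sub>M b\<in>{}::'a set. (lborel :: real measure))) = c" for c
    by (simp add: PiM_empty nn_integral_count_space_finite)
  then show ?case
    by (intro exI[of _ "{0}"] exI[of _ 1]) (auto simp: multi_indices_zero simp del:
        nn_integral_const)
next
  case (insert b J)
  interpret product_sigma_finite "\<lambda>_::'a. lborel :: real measure" by standard
  obtain \<Delta> C where H: "finite \<Delta> \<and> \<Delta> \<subseteq> multi_indices \<and> 0 \<le> C \<and>
    (\<forall>(f :: 'a \<Rightarrow> real) D \<alpha> x. scalar_family f D \<longrightarrow> \<alpha> \<in> multi_indices \<longrightarrow>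
      ennreal (\<bar>D \<alpha> x\<bar> powr p) \<le> ennreal C * (\<Sum>\<delta>\<in>\<Delta>.
        \<integral>\<^sup>+t. ennreal (\<bar>D (\<alpha> + \<delta>) (x + (\<Sum>b\<in>J. t b *\<^sub>R b))\<bar> powr p) \<partial>(\<Pi>\<^sub>M b\<in>J. lborel)))"
    using insert.IH[OF subset_trans[OF subset_insertI insert.prems]] by (elim exE) (rule that)
  then have \<Delta>: "finite \<Delta>" "\<Delta> \<subseteq> multi_indices" and C: "0 \<le> C" by auto
  note IH = H[THEN conjunct2, THEN conjunct2, THEN conjunct2, rule_format]
  have b: "b \<in> Basis" using insert by auto
  let ?g = "\<lambda>\<delta>::'a \<Rightarrow> nat. \<delta>(b := Suc (\<delta> b))"
  define \<Delta>' where "\<Delta>' = \<Delta> \<union> ?g ` \<Delta>"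
  have "ennreal (\<bar>D \<alpha> x\<bar> powr p) \<le> ennreal (C * 2 powr p * 2) * (\<Sum>\<delta>\<in>\<Delta>'.
        \<integral>\<^sup>+t. ennreal (\<bar>D (\<alpha> + \<delta>) (x + (\<Sum>b\<in>insert b J. t b *\<^sub>R b))\<bar> powr p) \<partial>(\<Pi>\<^sub>M b\<in>insert b J.
            lborel))"
    if D: "scalar_family f D" and \<alpha>: "\<alpha> \<in> multi_indices" for f :: "'a \<Rightarrow> real" and D \<alpha> x
  proof -
    define G where "G \<delta> = (\<integral>\<^sup>+t. ennreal (\<bar>D (\<alpha> + \<delta>) (x + (\<Sum>b\<in>insert b J. t b *\<^sub>R b))\<bar> powr p)
        \<partial>(\<Pi>\<^sub>M b\<in>insert b J. lborel))" for \<delta>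
    have step: "(\<integral>\<^sup>+t. ennreal (\<bar>D (\<alpha> + \<delta>) (x + (\<Sum>b\<in>J. t b *\<^sub>R b))\<bar> powr p) \<partial>(\<Pi>\<^sub>M b\<in>J. lborel))
      \<le> ennreal (2 powr p) * (G \<delta> + G (?g \<delta>))" if \<delta>: "\<delta> \<in> \<Delta>" for \<delta>
    proof -
      have \<delta>': "\<alpha> + \<delta> \<in> multi_indices" "\<alpha> + ?g \<delta> \<in> multi_indices"
        using \<alpha> \<delta> \<Delta> b by (auto intro!: multi_indices_add multi_indices_upd)
      have [measurable]: "D (\<alpha> + \<delta>) \<in> borel_measurable borel"
          "D (\<alpha> + ?g \<delta>) \<in> borel_measurable borel"
        by (rule scalar_family_D(2)[OF D], rule \<delta>')+
      have G: "G \<epsilon> = (\<integral>\<^sup>+t. \<integral>\<^sup>+s. ennreal (\<bar>D (\<alpha> + \<epsilon>) ((x + (\<Sum>b\<in>J. t b *\<^sub>R b)) + s *\<^sub>R b)\<bar> powr p)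
          \<partial>lborel \<partial>(\<Pi>\<^sub>M b\<in>J. lborel))"
        if [measurable]: "D (\<alpha> + \<epsilon>) \<in> borel_measurable borel" for \<epsilon>
      proof -
        have "(\<Sum>c\<in>insert b J. (t(b := s)) c *\<^sub>R c) = (\<Sum>c\<in>J. t c *\<^sub>R c) + s *\<^sub>R b"
            for t :: "'a \<Rightarrow> real" and s
          using insert by (auto simp: add.commute intro!: sum.cong)
        then show ?thesis
          unfolding G_def using insert
              by (subst product_nn_integral_insert) (simp_all add: ac_simps)
      qed
      have "(\<integral>\<^sup>+t. ennreal (\<bar>D (\<alpha> + \<delta>) (x + (\<Sum>b\<in>J. t b *\<^sub>R b))\<bar> powr p) \<partial>(\<Pi>\<^sub>M b\<in>J. lborel))
        \<le> (\<integral>\<^sup>+t. ennreal (2 powr p) *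
          ((\<integral>\<^sup>+s. ennreal (\<bar>D (\<alpha> + \<delta>) ((x + (\<Sum>b\<in>J. t b *\<^sub>R b)) + s *\<^sub>R b)\<bar> powr p) \<partial>lborel) +
           (\<integral>\<^sup>+s. ennreal (\<bar>D (\<alpha> + ?g \<delta>) ((x + (\<Sum>b\<in>J. t b *\<^sub>R b)) + s *\<^sub>R b)\<bar> powr p) \<partial>lborel))
               \<partial>(\<Pi>\<^sub>M b\<in>J. lborel))"
      proof (rule nn_integral_mono)
        fix t :: "'a \<Rightarrow> real"
        let ?z = "x + (\<Sum>b\<in>J. t b *\<^sub>R b)"
        have eq: "(\<alpha> + \<delta>)(b := Suc ((\<alpha> + \<delta>) b)) = \<alpha> + ?g \<delta>" by auto
        have "ennreal (\<bar>D (\<alpha> + \<delta>) (?z + 0 *\<^sub>R b)\<bar> powr p) \<le> ennreal (2 powr p) *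
          (Lp_integral p (\<lambda>s. D (\<alpha> + \<delta>) (?z + s *\<^sub>R b)) + Lp_integral p
              (\<lambda>s. D (\<alpha> + ?g \<delta>) (?z + s *\<^sub>R b)))"
        proof (rule sobolev_line[OF p])
          show "((\<lambda>s. D (\<alpha> + \<delta>) (?z + s *\<^sub>R b)) has_real_derivative D (\<alpha> + ?g \<delta>) (?z + s *\<^sub>R b))
              (at s)" for s
            using scalar_family_D(3)[OF D \<delta>'(1) b] unfolding eq .
          show "continuous_on UNIV (\<lambda>s. D (\<alpha> + ?g \<delta>) (?z + s *\<^sub>R b))"
            by (rule continuous_on_compose2[OF scalar_family_D(1)[OF D \<delta>'(2)]])
                (auto intro!: continuous_intros)
        qed
        then show "ennreal (\<bar>D (\<alpha> + \<delta>) ?z\<bar> powr p) \<le> ennreal (2 powr p) *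
          ((\<integral>\<^sup>+s. ennreal (\<bar>D (\<alpha> + \<delta>) (?z + s *\<^sub>R b)\<bar> powr p) \<partial>lborel) +
           (\<integral>\<^sup>+s. ennreal (\<bar>D (\<alpha> + ?g \<delta>) (?z + s *\<^sub>R b)\<bar> powr p) \<partial>lborel))"
          unfolding Lp_integral_def by simp
      qed
      also have "\<dots> = ennreal (2 powr p) * (G \<delta> + G (?g \<delta>))"
        by (subst nn_integral_cmult, measurable) (subst nn_integral_add, measurable, simp add: G)
      finally show ?thesis .
    qed
    have "ennreal (\<bar>D \<alpha> x\<bar> powr p) \<le> ennreal C * (\<Sum>\<delta>\<in>\<Delta>. ennreal (2 powr p) * (G \<delta> + G (?g \<delta>)))"
      by (rule order_trans[OF IH[OF D \<alpha>]]) (intro mult_left_mono sum_mono step, auto)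
    also have "\<dots> = ennreal (C * 2 powr p) * ((\<Sum>\<delta>\<in>\<Delta>. G \<delta>) + (\<Sum>\<delta>\<in>\<Delta>. G (?g \<delta>)))"
      using C by (simp add: sum_distrib_left[symmetric] sum.distrib ennreal_mult mult.assoc)
    also have "(\<Sum>\<delta>\<in>\<Delta>. G (?g \<delta>)) = (\<Sum>\<delta>\<in>?g ` \<Delta>. G \<delta>)"
    proof -
      have "inj_on ?g \<Delta>"
        by (rule inj_onI) (metis Suc_inject fun_upd_same fun_upd_triv fun_upd_upd)
      then show ?thesis by (simp add: sum.reindex)
    qed
    \<comment> \<open>Nothing is known about an overlap of \<open>\<Delta>\<close> with its shifted
      copy, so each sum is enlarged to \<open>\<Delta>'\<close> separately; this is the last factor
      2 of the constant.\<close>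
    also have "(\<Sum>\<delta>\<in>\<Delta>. G \<delta>) + (\<Sum>\<delta>\<in>?g ` \<Delta>. G \<delta>) \<le> (\<Sum>\<delta>\<in>\<Delta>'. G \<delta>) + (\<Sum>\<delta>\<in>\<Delta>'. G \<delta>)"
      using \<Delta> by (intro add_mono sum_mono2) (auto simp: \<Delta>'_def)
    also have "\<dots> = 2 * (\<Sum>\<delta>\<in>\<Delta>'. G \<delta>)" by (rule mult_2[symmetric])
    finally show ?thesis unfolding G_def[symmetric]
      using C by (simp add: mult_left_mono ennreal_mult mult.assoc)
  qed
  moreover have "finite \<Delta>'" "\<Delta>' \<subseteq> multi_indices" using \<Delta> b
      by (auto simp: \<Delta>'_def intro: multi_indices_upd)
  moreover have "0 \<le> C * 2 powr p * 2" using C by simp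
  ultimately show ?case by blast
qed

lemma nn_integral_lborel_translate:
  fixes g :: "'a::euclidean_space \<Rightarrow> ennreal"
  assumes [measurable]: "g \<in> borel_measurable borel"
  shows "(\<integral>\<^sup>+z. g (x + z) \<partial>lborel) = (\<integral>\<^sup>+z. g z \<partial>lborel)"
proof -
  have "(\<integral>\<^sup>+z. g z \<partial>lborel) = (\<integral>\<^sup>+z. g z \<partial>distr lborel borel ((+) x))"
    by (simp add: lborel_distr_plus)
  also have "\<dots> = (\<integral>\<^sup>+z. g (x + z) \<partial>lborel)" by (subst nn_integral_distr) auto
  finally show ?thesis by simp
qed

text \<open>For \<open>J = Basis\<close> the product measure is Lebesgue measure in coordinates, and
  translation invariance removes the base point \<open>x\<close> from the integrals.\<close>

lemma sobolev:
  assumes p: "1 \<le> p"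
  obtains \<Delta> C where "finite \<Delta>" "\<Delta> \<subseteq> multi_indices" "0 \<le> C"
    "\<And>(f :: 'a::euclidean_space \<Rightarrow> real) D \<alpha> x. scalar_family f D \<Longrightarrow> \<alpha> \<in> multi_indices \<Longrightarrow>
      ennreal (\<bar>D \<alpha> x\<bar> powr p) \<le> ennreal C * (\<Sum>\<delta>\<in>\<Delta>. Lp_integral p (D (\<alpha> + \<delta>)))"
proof -
  obtain \<Delta> C where H: "finite \<Delta> \<and> \<Delta> \<subseteq> multi_indices \<and> 0 \<le> C \<and>
    (\<forall>(f :: 'a \<Rightarrow> real) D \<alpha> x. scalar_family f D \<longrightarrow> \<alpha> \<in> multi_indices \<longrightarrow>
      ennreal (\<bar>D \<alpha> x\<bar> powr p) \<le> ennreal C * (\<Sum>\<delta>\<in>\<Delta>.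
        \<integral>\<^sup>+t. ennreal (\<bar>D (\<alpha> + \<delta>) (x + (\<Sum>b\<in>Basis. t b *\<^sub>R b))\<bar> powr p) \<partial>(\<Pi>\<^sub>M b\<in>Basis. lborel)))"
    using sobolev_partial[OF p finite_Basis order_refl] by (elim exE) (rule that)
  then have \<Delta>: "finite \<Delta>" "\<Delta> \<subseteq> multi_indices" and C: "0 \<le> C" by auto
  note * = H[THEN conjunct2, THEN conjunct2, THEN conjunct2, rule_format]
  have "ennreal (\<bar>D \<alpha> x\<bar> powr p) \<le> ennreal C * (\<Sum>\<delta>\<in>\<Delta>. Lp_integral p (D (\<alpha> + \<delta>)))"
    if D: "scalar_family f D" and \<alpha>: "\<alpha> \<in> multi_indices" for f :: "'a \<Rightarrow> real" and D \<alpha> x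
  proof -
    have "(\<integral>\<^sup>+t. ennreal (\<bar>D (\<alpha> + \<delta>) (x + (\<Sum>b\<in>Basis. t b *\<^sub>R b))\<bar> powr p) \<partial>(\<Pi>\<^sub>M b\<in>Basis. lborel))
        = Lp_integral p (D (\<alpha> + \<delta>))"
      if \<delta>: "\<delta> \<in> \<Delta>" for \<delta>
    proof -
      have [measurable]: "D (\<alpha> + \<delta>) \<in> borel_measurable borel"
        by (rule scalar_family_D(2)[OF D]) (use \<alpha> \<delta> \<Delta> multi_indices_add in auto)
      have "Lp_integral p (D (\<alpha> + \<delta>)) = (\<integral>\<^sup>+z. ennreal (\<bar>D (\<alpha> + \<delta>) (x + z)\<bar> powr p) \<partial>lborel)"
        unfolding Lp_integral_def by (rule nn_integral_lborel_translate[symmetric]) measurable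
      also have "\<dots> = (\<integral>\<^sup>+t. ennreal (\<bar>D (\<alpha> + \<delta>) (x + (\<Sum>b\<in>Basis. t b *\<^sub>R b))\<bar> powr p) \<partial>(\<Pi>\<^sub>M
          b\<in>Basis. lborel))"
        by (subst lborel_eq) (subst nn_integral_distr, measurable)
      finally show ?thesis by simp
    qed
    then show ?thesis using *[OF D \<alpha>, of x] by simp
  qed
  with \<Delta> C show ?thesis by (rule that)
qed

section \<open>Topologies generated by seminorms\<close>

text \<open>Seminorm topologies are given by a subbasis only. Eventual membership is stable under
  finite intersections and under unions, so testing the subbasis suffices.\<close>

lemma limitin_topology_generated_by:
  "limitin (topology_generated_by S) f l F \<longleftrightarrow>
    l \<in> \<Union>S \<and> (\<forall>U\<in>S. l \<in> U \<longrightarrow> (\<forall>\<^sub>F x in F. f x \<in> U))"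
proof
  assume "limitin (topology_generated_by S) f l F"
  then show "l \<in> \<Union>S \<and> (\<forall>U\<in>S. l \<in> U \<longrightarrow> (\<forall>\<^sub>F x in F. f x \<in> U))"
    by (auto simp: limitin_def topology_generated_by_Basis)
next
  assume R: "l \<in> \<Union>S \<and> (\<forall>U\<in>S. l \<in> U \<longrightarrow> (\<forall>\<^sub>F x in F. f x \<in> U))"
  have "\<forall>\<^sub>F x in F. f x \<in> U" if "generate_topology_on S U" "l \<in> U" for U
    using that
  proof (induction rule: generate_topology_on.induct)
    case (UN K)
    then obtain k where "k \<in> K" "l \<in> k" by auto
    then have "\<forall>\<^sub>F x in F. f x \<in> k" by (rule UN)
    then show ?case by eventually_elim (use \<open>k \<in> K\<close> in auto)
  next
    case (Int a b)
    then show ?case by (simp add: eventually_conj_iff)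
  next
    case (Basis s)
    then show ?case using R by blast
  qed simp
  then show "limitin (topology_generated_by S) f l F"
    using R by (auto simp: limitin_def openin_topology_generated_by_iff)
qed

lemma seminorm_onD:
  assumes "seminorm_on V s" "subspace V"
  shows "x \<in> V \<Longrightarrow> 0 \<le> s x" "x \<in> V \<Longrightarrow> y \<in> V \<Longrightarrow> s (x + y) \<le> s x + s y"
    "x \<in> V \<Longrightarrow> s (c *\<^sub>R x) = \<bar>c\<bar> * s x" "s 0 = 0"
    "x \<in> V \<Longrightarrow> y \<in> V \<Longrightarrow> z \<in> V \<Longrightarrow> s (x - z) \<le> s (x - y) + s (y - z)"
    "x \<in> V \<Longrightarrow> y \<in> V \<Longrightarrow> \<bar>s x - s y\<bar> \<le> s (x - y)"
proof -
  show add: "s (x + y) \<le> s x + s y" if "x \<in> V" "y \<in> V" for x y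
    using assms that by (auto simp: seminorm_on_def)
  show scale: "s (c *\<^sub>R x) = \<bar>c\<bar> * s x" if "x \<in> V" for c x
    using assms that by (auto simp: seminorm_on_def)
  show "x \<in> V \<Longrightarrow> 0 \<le> s x" using assms by (auto simp: seminorm_on_def)
  show "s 0 = 0" using scale[of 0 0] subspace_0[OF assms(2)] by simp
  show "s (x - z) \<le> s (x - y) + s (y - z)" if "x \<in> V" "y \<in> V" "z \<in> V"
    using add[of "x - y" "y - z"] that subspace_diff[OF assms(2)] by simp
  show "\<bar>s x - s y\<bar> \<le> s (x - y)" if "x \<in> V" "y \<in> V"
    using add[of "x - y" y] add[of "y - x" x] scale[of "x - y"
        "-1"] that subspace_diff[OF assms(2)] by auto
qed

lemma topspace_seminorm_topology [simp]: "topspace (seminorm_topology V P) = V"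
  by (auto simp: seminorm_topology_def)

lemma limitin_seminorm_topology:
  assumes V: "subspace V" and P: "\<And>s. s \<in> P \<Longrightarrow> seminorm_on V s"
  shows "limitin (seminorm_topology V P) f l F \<longleftrightarrow>
    l \<in> V \<and> (\<forall>\<^sub>F x in F. f x \<in> V) \<and> (\<forall>s\<in>P. ((\<lambda>x. s (f x - l)) \<longlongrightarrow> 0) F)"
    (is "?L \<longleftrightarrow> ?R")
proof
  assume L: ?L
  then have l: "l \<in> V" using limitin_topspace by fastforce
  have ev: "\<forall>\<^sub>F x in F. f x \<in> V"
    using L l by (auto simp: seminorm_topology_def limitin_topology_generated_by)
  have "((\<lambda>x. s (f x - l)) \<longlongrightarrow> 0) F" if s: "s \<in> P" for s
  proof (rule order_tendstoI)
    fix e :: real assume "0 < e"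
    then have "{y \<in> V. s (y - l) < e} \<in> insert V {{y \<in> V. s (y - x) < e} | s x e. s \<in> P \<and> x \<in> V \<and>
        0 < e}"
      "l \<in> {y \<in> V. s (y - l) < e}"
      using s l seminorm_onD(4)[OF P[OF s] V] by auto
    then have "\<forall>\<^sub>F x in F. f x \<in> {y \<in> V. s (y - l) < e}"
      using L unfolding seminorm_topology_def limitin_topology_generated_by by blast
    then show "\<forall>\<^sub>F x in F. s (f x - l) < e" by (auto elim: eventually_mono)
  next
    fix e :: real assume "e < 0"
    then show "\<forall>\<^sub>F x in F. e < s (f x - l)"
      using ev seminorm_onD(1)[OF P[OF s] V subspace_diff[OF V _ l]]
      by (auto elim!: eventually_mono intro: less_le_trans)
  qed
  with l ev show ?R by auto
next
  assume R: ?R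
  show ?L
    unfolding seminorm_topology_def limitin_topology_generated_by
  proof (intro conjI ballI impI)
    fix U assume U: "U \<in> insert V {{y \<in> V. s (y - x) < e} | s x e. s \<in> P \<and> x \<in> V \<and> 0 < e}" "l \<in> U"
    show "\<forall>\<^sub>F x in F. f x \<in> U"
    proof (cases "U = V")
      case False
      with U obtain s x e where s: "U = {y \<in> V. s (y - x) < e}" "s \<in> P" "x \<in> V" by auto
      \<comment> \<open>The subbasic ball is centred at \<open>x\<close>, not at \<open>l\<close>;
        by the triangle inequality it contains the ball of radius \<open>e - s (l - x)\<close> about
        \<open>l\<close>.\<close>
      have "\<forall>\<^sub>F t in F. s (f t - l) < e - s (l - x)"
        using R s U by (intro order_tendstoD(2)[of _ 0]) auto
      moreover have "\<forall>\<^sub>F t in F. f t \<in> V" using R by simp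
      ultimately show ?thesis
      proof eventually_elim
        case (elim t)
        then show ?case using seminorm_onD(5)[OF P[OF s(2)] V, of "f t" l x] s R by auto
      qed
    qed (use R in auto)
  qed (use R in auto)
qed

lemma limitin_seminorm_topology_single:
  assumes "subspace V" "seminorm_on V s"
  shows "limitin (seminorm_topology V {s}) f l F \<longleftrightarrow>
    l \<in> V \<and> (\<forall>\<^sub>F x in F. f x \<in> V) \<and> ((\<lambda>x. s (f x - l)) \<longlongrightarrow> 0) F"
  using assms by (subst limitin_seminorm_topology) auto

lemma limitin_id: "x \<in> topspace T \<Longrightarrow> limitin T (\<lambda>x. x) x (atin T x)"
  using continuous_map_atin[of T T "\<lambda>x. x"] by auto

lemma continuous_map_atinI:
  assumes "\<And>x. x \<in> topspace X \<Longrightarrow> limitin Y f (f x) (atin X x)"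
  shows "continuous_map X Y f"
  using assms by (simp add: continuous_map_atin)

lemma continuous_map_limitinD:
  "continuous_map X Y f \<Longrightarrow> limitin X u l F \<Longrightarrow> limitin Y (\<lambda>x. f (u x)) (f l) F"
  using continuous_map_limit[of X Y f u l F] by (simp add: o_def)

lemma limitin_eventually_topspace: "limitin T u l F \<Longrightarrow> \<forall>\<^sub>F x in F. u x \<in> topspace T"
  by (auto simp: limitin_def)

text \<open>The reverse triangle inequality reduces continuity of \<open>s\<close> to that of
  \<open>s (y - x)\<close> at \<open>x\<close>.\<close>

lemma continuous_seminormI:
  assumes V: "subspace (topspace T)" and s: "seminorm_on (topspace T) s"
    and lim: "\<And>x. x \<in> topspace T \<Longrightarrow> ((\<lambda>y. s (y - x)) \<longlongrightarrow> 0) (atin T x)"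
  shows "continuous_seminorm T s"
  unfolding continuous_seminorm_def
proof (intro conjI s continuous_map_atinI)
  fix x assume x: "x \<in> topspace T"
  let ?F = "atin T x"
  have "((\<lambda>y. s y - s x) \<longlongrightarrow> 0) ?F"
  proof (rule Lim_null_comparison[OF _ lim[OF x]])
    show "\<forall>\<^sub>F y in ?F. norm (s y - s x) \<le> s (y - x)"
      using limitin_eventually_topspace[OF limitin_id[OF x]]
      by eventually_elim (use seminorm_onD(6)[OF s V] x in auto)
  qed
  then show "limitin euclideanreal s (s x) ?F" by (simp add: LIM_zero_iff)
qed

text \<open>Makes the topology of a single seminorm eligible among the locally convex topologies
  whose supremum is the inductive limit.\<close>

lemma locally_convex_seminorm_topology:
  assumes V: "subspace V" and s: "seminorm_on V s"
  shows "locally_convex_space (seminorm_topology V {s})" (is "locally_convex_space ?T")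
  unfolding locally_convex_space_def
proof (intro conjI allI impI)
  note lim = limitin_seminorm_topology_single[OF V s]
  show "subspace (topspace ?T)" using V by simp
  show "continuous_map (prod_topology ?T ?T) ?T (\<lambda>(x, y). x + y)"
  proof (rule continuous_map_atinI)
    fix z assume z: "z \<in> topspace (prod_topology ?T ?T)"
    let ?F = "atin (prod_topology ?T ?T) z"
    have 1: "limitin ?T fst (fst z) ?F" and 2: "limitin ?T snd (snd z) ?F"
      using z continuous_map_fst[of ?T ?T] continuous_map_snd[of ?T ?T]
          by (simp_all add: continuous_map_atin del: topspace_prod_topology)
    have zz: "fst z \<in> V" "snd z \<in> V" using z by auto
    have ev: "\<forall>\<^sub>F x in ?F. fst x \<in> V \<and> snd x \<in> V"
      using 1 2 s by (auto simp: lim eventually_conj_iff)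
    have "limitin ?T (\<lambda>x. fst x + snd x) (fst z + snd z) ?F"
      unfolding lim
    proof (intro conjI)
      show "fst z + snd z \<in> V" using zz V by (auto intro: subspace_add)
      show "\<forall>\<^sub>F x in ?F. fst x + snd x \<in> V" using ev by eventually_elim (auto intro: subspace_add V)
      have "((\<lambda>x. s (fst x - fst z) + s (snd x - snd z)) \<longlongrightarrow> 0 + 0) ?F"
        using 1 2 s by (intro tendsto_add) (auto simp: lim)
      then have c: "((\<lambda>x. s (fst x - fst z) + s (snd x - snd z)) \<longlongrightarrow> 0) ?F" by simp
      show "((\<lambda>x. s (fst x + snd x - (fst z + snd z))) \<longlongrightarrow> 0) ?F"
      proof (rule Lim_null_comparison[OF _ c])
        show "\<forall>\<^sub>F x in ?F. norm (s (fst x + snd x - (fst z + snd z)))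
            \<le> s (fst x - fst z) + s (snd x - snd z)"
          using ev
        proof eventually_elim
          case (elim x)
          have "fst x - fst z \<in> V" "snd x - snd z \<in> V" using elim zz subspace_diff[OF V] by auto
          moreover have eq: "fst x + snd x - (fst z + snd z) = (fst x - fst z) + (snd x - snd z)"
              by simp
          ultimately show ?case
            unfolding eq using seminorm_onD(1)[OF s V, of "(fst x - fst z) + (snd x - snd z)"]
              seminorm_onD(2)[OF s V, of "fst x - fst z" "snd x - snd z"]
              subspace_add[OF V, of "fst x - fst z" "snd x - snd z"]
            by simp
        qed
      qed
    qed
    then show "limitin ?T (\<lambda>(x, y). x + y) ((\<lambda>(x, y). x + y) z) ?F" by (simp add: case_prod_unfold)
  qed
  show "continuous_map (prod_topology euclideanreal ?T) ?T (\<lambda>(c, x). c *\<^sub>R x)"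
  proof (rule continuous_map_atinI)
    fix z assume z: "z \<in> topspace (prod_topology euclideanreal ?T)"
    let ?F = "atin (prod_topology euclideanreal ?T) z"
    have 1: "limitin euclideanreal fst (fst z) ?F" and 2: "limitin ?T snd (snd z) ?F"
      using z continuous_map_fst[of euclideanreal ?T] continuous_map_snd[of euclideanreal ?T]
      by (simp_all add: continuous_map_atin del: topspace_prod_topology limitin_canonical_iff)
    have zz: "snd z \<in> V" using z by auto
    have ev: "\<forall>\<^sub>F x in ?F. snd x \<in> V" using 2 s by (auto simp: lim)
    have "limitin ?T (\<lambda>x. fst x *\<^sub>R snd x) (fst z *\<^sub>R snd z) ?F"
      unfolding lim
    proof (intro conjI)
      show "fst z *\<^sub>R snd z \<in> V" using zz V by (auto intro: subspace_scale)
      show "\<forall>\<^sub>F x in ?F. fst x *\<^sub>R snd x \<in> V" using ev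
          by eventually_elim (auto intro: subspace_scale V)
      have "((\<lambda>x. \<bar>fst x\<bar> * s (snd x - snd z) + \<bar>fst x - fst z\<bar> * s (snd z)) \<longlongrightarrow> \<bar>fst z\<bar> * 0 + \<bar>fst
          z - fst z\<bar> * s (snd z)) ?F"
        using 1 2 s by (intro tendsto_intros) (auto simp: lim)
      then have c: "((\<lambda>x. \<bar>fst x\<bar> * s (snd x - snd z) + \<bar>fst x - fst z\<bar> * s (snd z)) \<longlongrightarrow> 0) ?F"
          by simp
      show "((\<lambda>x. s (fst x *\<^sub>R snd x - fst z *\<^sub>R snd z)) \<longlongrightarrow> 0) ?F"
      proof (rule Lim_null_comparison[OF _ c])
        show "\<forall>\<^sub>F x in ?F. norm (s (fst x *\<^sub>R snd x - fst z *\<^sub>R snd z))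
          \<le> \<bar>fst x\<bar> * s (snd x - snd z) + \<bar>fst x - fst z\<bar> * s (snd z)"
          using ev
        proof eventually_elim
          case (elim x)
          have d: "snd x - snd z \<in> V" using elim zz subspace_diff[OF V] by auto
          have eq: "fst x *\<^sub>R snd x - fst z *\<^sub>R snd z = fst x *\<^sub>R (snd x - snd z) + (fst x - fst
              z) *\<^sub>R snd z"
            by (simp add: algebra_simps)
          show ?case
            unfolding eq
            using seminorm_onD(1)[OF s V, of "fst x *\<^sub>R (snd x - snd z) + (fst x - fst z) *\<^sub>R snd
                z"]
              seminorm_onD(2)[OF s V, of "fst x *\<^sub>R (snd x - snd z)" "(fst x - fst z) *\<^sub>R snd z"]
              subspace_add[OF V] subspace_scale[OF V d] subspace_scale[OF V zz]
              seminorm_onD(3)[OF s V d] seminorm_onD(3)[OF s V zz]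
            by auto
        qed
      qed
    qed
    then show "limitin ?T (\<lambda>(c, x). c *\<^sub>R x) ((\<lambda>(c, x). c *\<^sub>R x) z) ?F"
        by (simp add: case_prod_unfold)
  qed
  fix U assume U: "openin ?T U \<and> 0 \<in> U"
  \<comment> \<open>A ball inside \<open>U\<close> is found through limits: otherwise there are
    points outside \<open>U\<close> of seminorm below \<open>1 / (n + 1)\<close>, and these converge
    to 0.\<close>
  have "\<exists>e>0. {y \<in> V. s (y - 0) < e} \<subseteq> U"
  proof (rule ccontr)
    assume "\<not> (\<exists>e>0. {y \<in> V. s (y - 0) < e} \<subseteq> U)"
    then have "\<forall>n. \<exists>y. y \<in> V \<and> s y < 1 / real (Suc n) \<and> y \<notin> U"
      by (auto simp: subset_iff)
    then obtain y where y: "\<And>n. y n \<in> V" "\<And>n. s (y n) < 1 / real (Suc n)" "\<And>n. y n \<notin> U" by metis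
    have "limitin ?T y 0 sequentially"
      unfolding lim
    proof (intro conjI)
      show "0 \<in> V" by (rule subspace_0[OF V])
      show "(\<lambda>x. s (y x - 0)) \<longlonglongrightarrow> 0"
      proof (rule Lim_null_comparison)
        show "\<forall>\<^sub>F n in sequentially. norm (s (y n - 0)) \<le> 1 / real (Suc n)"
          using y(1,2) seminorm_onD(1)[OF s V] by (auto intro!: always_eventually less_imp_le)
        show "(\<lambda>n. 1 / real (Suc n)) \<longlonglongrightarrow> 0" by (rule LIMSEQ_Suc[OF lim_1_over_n])
      qed
    qed (use y in auto)
    then have "\<forall>\<^sub>F n in sequentially. y n \<in> U" using U by (auto simp: limitin_def)
    with y(3) show False by auto
  qed
  then obtain e where e: "0 < e" "{y \<in> V. s (y - 0) < e} \<subseteq> U" by auto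
  have "openin ?T {y \<in> V. s (y - 0) < e}"
    unfolding seminorm_topology_def using e subspace_0[OF V]
        by (intro topology_generated_by_Basis) auto
  moreover have "convex {y \<in> V. s (y - 0) < e}"
  proof (rule convexI)
    fix x y and u v :: real
    assume *: "x \<in> {y \<in> V. s (y - 0) < e}" "y \<in> {y \<in> V. s (y - 0) < e}" "0 \<le> u" "0 \<le> v" "u + v = 1"
    have "s (u *\<^sub>R x + v *\<^sub>R y) \<le> u * s x + v * s y"
      using seminorm_onD(2)[OF s V, of "u *\<^sub>R x" "v *\<^sub>R y"] * subspace_scale[OF V]
        seminorm_onD(3)[OF s V] by auto
    also have "\<dots> < e" using * by (intro convex_bound_lt) auto
    finally show "u *\<^sub>R x + v *\<^sub>R y \<in> {y \<in> V. s (y - 0) < e}"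
      using * subspace_scale[OF V] subspace_add[OF V] by auto
  qed
  ultimately show "\<exists>W. openin ?T W \<and> 0 \<in> W \<and> convex W \<and> W \<subseteq> U"
    using e subspace_0[OF V] seminorm_onD(4)[OF s V]
        by (intro exI[of _ "{y \<in> V. s (y - 0) < e}"]) auto
qed

text \<open>Otherwise there are \<open>x\<^sub>n\<close> with \<open>s x\<^sub>n > n q\<^sub>n x\<^sub>n\<close>, and \<open>x\<^sub>n / s x\<^sub>n\<close> tends to \<open>0\<close>.\<close>

lemma continuous_seminorm_bound:
  fixes T :: "'b::real_vector topology" and q :: "nat \<Rightarrow> 'b \<Rightarrow> real"
  assumes V: "subspace (topspace T)" and s: "continuous_seminorm T s"
    and q: "\<And>n. seminorm_on (topspace T) (q n)"
    and mono: "\<And>m n x. m \<le> n \<Longrightarrow> x \<in> topspace T \<Longrightarrow> q m x \<le> q n x"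
    and lim: "\<And>u. (\<And>k. u k \<in> topspace T) \<Longrightarrow> (\<And>n. (\<lambda>k. q n (u k)) \<longlonglongrightarrow> 0) \<Longrightarrow> limitin T u 0 sequentially"
  obtains n C where "0 \<le> C" "\<And>x. x \<in> topspace T \<Longrightarrow> s x \<le> C * q n x"
proof -
  have sn: "seminorm_on (topspace T) s" using s by (simp add: continuous_seminorm_def)
  have "\<exists>n. \<forall>x\<in>topspace T. s x \<le> real n * q n x"
  proof (rule ccontr)
    assume "\<not> (\<exists>n. \<forall>x\<in>topspace T. s x \<le> real n * q n x)"
    then obtain x where x: "\<And>n. x n \<in> topspace T" "\<And>n. real n * q n (x n) < s (x n)"
      by (metis not_le)
    have pos: "0 < s (x n)" for n
      using seminorm_onD(1)[OF q V x(1), of n n] x(2)[of n]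
          by (smt (verit) mult_nonneg_nonneg of_nat_0_le_iff)
    define u where "u n = (1 / s (x n)) *\<^sub>R x n" for n
    have u: "u n \<in> topspace T" for n unfolding u_def using x(1) by (intro subspace_scale V)
    have qu: "q m (u n) = q m (x n) / s (x n)" for m n
      unfolding u_def using seminorm_onD(3)[OF q V x(1)] pos[of n] by simp
    have "(\<lambda>n. q m (u n)) \<longlonglongrightarrow> 0" for m
    proof (rule Lim_null_comparison)
      show "\<forall>\<^sub>F n in sequentially. norm (q m (u n)) \<le> 1 / real n"
        using eventually_ge_at_top[of "max 1 m"]
      proof eventually_elim
        case (elim n)
        have "real n * q m (x n) \<le> real n * q n (x n)" using mono[of m n "x n"] x(1) elim
            by (intro mult_left_mono) auto
        then have "real n * q m (x n) \<le> s (x n)" using x(2)[of n] by simp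
        then have "q m (u n) \<le> 1 / real n" unfolding qu using pos[of n] elim
            by (simp add: field_simps)
        then show ?case using seminorm_onD(1)[OF q V u] by simp
      qed
    qed (rule lim_1_over_n)
    then have "limitin T u 0 sequentially" by (rule lim[OF u])
    then have "limitin euclideanreal (\<lambda>n. s (u n)) (s 0) sequentially"
      using continuous_map_limitinD[of T euclideanreal s u 0 sequentially] s
      by (simp add: continuous_seminorm_def)
    moreover have "s (u n) = 1" for n
      unfolding u_def using seminorm_onD(3)[OF sn V x(1)] pos[of n] by simp
    ultimately have "(\<lambda>n::nat. 1) \<longlonglongrightarrow> (0::real)" using seminorm_onD(4)[OF sn V] by simp
    then show False by (simp add: LIMSEQ_const_iff)
  qed
  then obtain n where "\<forall>x\<in>topspace T. s x \<le> real n * q n x" ..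
  then have "\<And>x. x \<in> topspace T \<Longrightarrow> s x \<le> real n * q n x" by blast
  then show ?thesis by (rule that[OF of_nat_0_le_iff])
qed

section \<open>Projective limits, finite powers and inductive limits of topologies\<close>

lemma limitin_pullback_topology:
  "limitin (pullback_topology UNIV \<phi> X) f l F \<longleftrightarrow> limitin X (\<lambda>x. \<phi> (f x)) (\<phi> l) F"
  by (auto simp: limitin_def topspace_pullback_topology openin_pullback_topology)

lemma topspace_projective_limit: "topspace (projective_limit T) = (\<Inter>n. topspace (T n))"
  by (auto simp: projective_limit_def topspace_pullback_topology PiE_iff)

lemma limitin_projective_limit:
  "limitin (projective_limit T) f l F \<longleftrightarrow>
    (\<forall>\<^sub>F x in F. f x \<in> topspace (projective_limit T)) \<and> (\<forall>n. limitin (T n) f l F)"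
  by (auto simp: projective_limit_def limitin_pullback_topology limitin_componentwise
      topspace_pullback_topology)

lemma topspace_power_space: "f \<in> topspace (power_space T) \<longleftrightarrow> (\<forall>i. (\<lambda>x. f x $ i) \<in> topspace T)"
  by (auto simp: power_space_def topspace_pullback_topology PiE_iff)

lemma limitin_power_space:
  "limitin (power_space T) f l F \<longleftrightarrow> (\<forall>i. limitin T (\<lambda>t x. f t x $ i) (\<lambda>x. l x $ i) F)"
proof -
  have "\<forall>\<^sub>F t in F. \<forall>i. (\<lambda>x. f t x $ i) \<in> topspace T"
    if "\<forall>i. limitin T (\<lambda>t x. f t x $ i) (\<lambda>x. l x $ i) F"
    by (rule eventually_all_finite) (rule limitin_eventually_topspace[OF that[rule_format]])
  then show ?thesis
    unfolding power_space_def limitin_pullback_topology limitin_componentwise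
    by (simp add: PiE_iff) blast
qed

text \<open>The topology of the zero seminorm is indiscrete, yet locally convex, because
  Hausdorffness is not demanded, and it makes all inclusions continuous. Hence the whole union is
  among the generating sets.\<close>

lemma topspace_inductive_limit:
  fixes T :: "nat \<Rightarrow> 'b::real_vector topology"
  assumes V: "subspace (\<Union>n. topspace (T n))"
  shows "topspace (inductive_limit T) = (\<Union>n. topspace (T n))" (is "_ = ?V")
proof
  show "topspace (inductive_limit T) \<subseteq> ?V"
    unfolding inductive_limit_def using openin_subset by fastforce
  have z: "seminorm_on ?V (\<lambda>_. 0)" by (auto simp: seminorm_on_def)
  let ?S = "seminorm_topology ?V {\<lambda>_. 0}"
  have "continuous_map (T n) ?S (\<lambda>x. x)" for n
  proof (rule continuous_map_atinI)
    fix x assume "x \<in> topspace (T n)"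
    then show "limitin ?S (\<lambda>x. x) x (atin (T n) x)"
      using z limitin_eventually_topspace[OF limitin_id[of x "T n"]]
      by (subst limitin_seminorm_topology_single[OF V]) (auto elim: eventually_mono)
  qed
  moreover have "openin ?S ?V" using openin_topspace[of ?S] by simp
  moreover have "topspace ?S = ?V" by simp
  ultimately have "\<exists>S. locally_convex_space S \<and> topspace S = ?V \<and> (\<forall>n. continuous_map (T n) S
      (\<lambda>x. x)) \<and> openin S ?V"
    using locally_convex_seminorm_topology[OF V z] by blast
  then show "?V \<subseteq> topspace (inductive_limit T)"
    unfolding inductive_limit_def by auto
qed

lemma continuous_map_into_inductive_limit:
  fixes T :: "nat \<Rightarrow> 'b::real_vector topology"
  assumes V: "subspace (\<Union>n. topspace (T n))"
  shows "continuous_map (T n) (inductive_limit T) (\<lambda>x. x)"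
  unfolding inductive_limit_def
proof (rule continuous_on_generated_topo)
  fix U assume "U \<in> {U. \<exists>S. locally_convex_space S \<and> topspace S = (\<Union>n. topspace (T n)) \<and>
               (\<forall>n. continuous_map (T n) S (\<lambda>x. x)) \<and> openin S U}"
  then obtain S where "continuous_map (T n) S (\<lambda>x. x)" "openin S U" by auto
  then show "openin (T n) ((\<lambda>x. x) -` U \<inter> topspace (T n))"
    using openin_continuous_map_preimage[of "T n" S "\<lambda>x. x" U]
    by (simp add: vimage_def Int_def conj_commute)
next
  show "(\<lambda>x. x) ` topspace (T n) \<subseteq> \<Union> {U. \<exists>S. locally_convex_space S \<and>
      topspace S = (\<Union>n. topspace (T n)) \<and>
               (\<forall>n. continuous_map (T n) S (\<lambda>x. x)) \<and> openin S U}"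
    using topspace_inductive_limit[OF V] unfolding inductive_limit_def by auto
qed

text \<open>The universal property for one seminorm: if \<open>s\<close> is continuous along every
  step, its topology takes part in the supremum that defines the limit, so the identity into that
  topology is continuous.\<close>

lemma limitin_inductive_limit_seminorm:
  fixes T :: "nat \<Rightarrow> 'b::real_vector topology"
  assumes V: "subspace (\<Union>n. topspace (T n))" and s: "seminorm_on (\<Union>n. topspace (T n)) s"
    and lim: "\<And>n x. x \<in> topspace (T n) \<Longrightarrow> ((\<lambda>y. s (y - x)) \<longlongrightarrow> 0) (atin (T n) x)"
    and u: "limitin (inductive_limit T) u l F"
  shows "((\<lambda>x. s (u x - l)) \<longlongrightarrow> 0) F"
proof -
  let ?V = "\<Union>n. topspace (T n)" and ?S = "seminorm_topology (\<Union>n. topspace (T n)) {s}"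
  have cont: "continuous_map (T n) ?S (\<lambda>x. x)" for n
  proof (rule continuous_map_atinI)
    fix x assume x: "x \<in> topspace (T n)"
    then show "limitin ?S (\<lambda>x. x) x (atin (T n) x)"
      using s limitin_eventually_topspace[OF limitin_id[OF x]] lim[OF x]
      by (subst limitin_seminorm_topology_single[OF V]) (auto elim: eventually_mono)
  qed
  have lc: "locally_convex_space ?S" by (rule locally_convex_seminorm_topology[OF V s])
  have "continuous_map (inductive_limit T) ?S (\<lambda>x. x)"
    unfolding continuous_map
  proof (intro conjI allI impI)
    show "(\<lambda>x. x) ` topspace (inductive_limit T) \<subseteq> topspace ?S"
      by (simp add: topspace_inductive_limit[OF V])
    fix U assume U: "openin ?S U"
    have "\<exists>S. locally_convex_space S \<and> topspace S = ?V \<and> (\<forall>n. continuous_map (T n) S (\<lambda>x. x)) \<and>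
        openin S U"
      using lc cont U by (intro exI[of _ ?S]) simp
    then have "openin (inductive_limit T) U"
      unfolding inductive_limit_def by (intro topology_generated_by_Basis) simp
    moreover have "{x \<in> topspace (inductive_limit T). x \<in> U} = U"
      using openin_subset[OF U] by (auto simp: topspace_inductive_limit[OF V])
    ultimately show "openin (inductive_limit T) {x \<in> topspace (inductive_limit T). x \<in> U}" by simp
  qed
  from continuous_map_limitinD[OF this u] show ?thesis
    by (simp add: limitin_seminorm_topology_single[OF V s])
qed

section \<open>The scalar spaces\<close>

text \<open>Seminorms are real-valued here, and \<open>enn2real\<close> sends infinity to 0. The
  value is therefore meaningful only where \<open>pd_norm\<close> is finite, in particular on
  \<open>W_inf\<close>.\<close>

definition pd_seminorm :: "real \<Rightarrow> ('a::euclidean_space \<Rightarrow> nat) \<Rightarrow> ('a \<Rightarrow> real) \<Rightarrow> real" where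
  "pd_seminorm p \<alpha> f = enn2real (pd_norm p \<alpha> f)"

definition weight :: "(nat \<Rightarrow> real) \<Rightarrow> real \<Rightarrow> nat \<Rightarrow> real" where
  "weight M \<rho> k = \<rho> ^ k * fact k * M k"

lemma weight_pos: "weight_sequence M \<Longrightarrow> 0 < \<rho> \<Longrightarrow> 0 < weight M \<rho> k"
  by (simp add: weight_def weight_sequence_def)

lemma weight_mono: "weight_sequence M \<Longrightarrow> 0 \<le> \<rho> \<Longrightarrow> \<rho> \<le> \<sigma> \<Longrightarrow> weight M \<rho> k \<le> weight M \<sigma> k"
  by (auto simp: weight_def weight_sequence_def intro!: mult_right_mono power_mono intro:
      less_imp_le)

lemma weight_nonneg: "weight_sequence M \<Longrightarrow> 0 \<le> \<rho> \<Longrightarrow> 0 \<le> weight M \<rho> k"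
  by (simp add: weight_def weight_sequence_def less_imp_le)

lemma ennreal_divide_le_iff:
  assumes "0 < w" "0 \<le> c"
  shows "a / ennreal w \<le> ennreal c \<longleftrightarrow> a \<le> ennreal (c * w)"
proof (cases a)
  case (real r)
  then show ?thesis using assms by (auto simp: divide_ennreal ennreal_le_iff field_simps)
next
  case top
  then show ?thesis using assms by (simp add: ennreal_top_divide top_unique)
qed

lemma weighted_sup_le_iff:
  assumes "weight_sequence M" "0 < \<rho>" "0 \<le> c"
  shows "weighted_sup M p \<rho> G \<le> ennreal c \<longleftrightarrow>
    (\<forall>\<alpha>\<in>multi_indices. Lp_norm p (G \<alpha>) \<le> ennreal (c * weight M \<rho> (mi_order \<alpha>)))"
  unfolding weighted_sup_def SUP_le_iff
  using assms weight_pos[OF assms(1,2)] by (simp add: ennreal_divide_le_iff weight_def[symmetric])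

lemma weighted_sup_finite_iff:
  assumes "weight_sequence M" "0 < \<rho>"
  shows "weighted_sup M p \<rho> G < \<infinity> \<longleftrightarrow>
    (\<exists>c\<ge>0. \<forall>\<alpha>\<in>multi_indices. Lp_norm p (G \<alpha>) \<le> ennreal (c * weight M \<rho> (mi_order \<alpha>)))"
proof
  assume "weighted_sup M p \<rho> G < \<infinity>"
  then have "weighted_sup M p \<rho> G \<le> ennreal (enn2real (weighted_sup M p \<rho> G))" by simp
  then show "\<exists>c\<ge>0. \<forall>\<alpha>\<in>multi_indices. Lp_norm p (G \<alpha>) \<le> ennreal (c * weight M \<rho> (mi_order \<alpha>))"
    unfolding weighted_sup_le_iff[OF assms enn2real_nonneg]
        by (intro exI[of _ "enn2real (weighted_sup M p \<rho> G)"]) simp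
next
  assume "\<exists>c\<ge>0. \<forall>\<alpha>\<in>multi_indices. Lp_norm p (G \<alpha>) \<le> ennreal (c * weight M \<rho> (mi_order \<alpha>))"
  then obtain c where c: "0 \<le> c"
      "\<forall>\<alpha>\<in>multi_indices. Lp_norm p (G \<alpha>) \<le> ennreal (c * weight M \<rho> (mi_order \<alpha>))" by auto
  then have "weighted_sup M p \<rho> G \<le> ennreal c" by (simp add: weighted_sup_le_iff[OF assms c(1)])
  also have "\<dots> < \<infinity>" by simp
  finally show "weighted_sup M p \<rho> G < \<infinity>" .
qed

lemma pd_norm_finite_add:
  assumes "1 \<le> p" "smooth f" "smooth g" "\<alpha> \<in> multi_indices" "pd_norm p \<alpha> f < \<infinity>" "pd_norm p \<alpha> g < \<infinity>"
  shows "pd_norm p \<alpha> (f + g) < \<infinity>"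
  using pd_norm_add[OF assms(1-4)] assms(5,6) by (auto intro: le_less_trans)

lemma pd_norm_finite_scale:
  assumes "1 \<le> p" "smooth f" "\<alpha> \<in> multi_indices" "pd_norm p \<alpha> f < \<infinity>"
  shows "pd_norm p \<alpha> (c *\<^sub>R f) < \<infinity>"
  using pd_norm_scale[OF assms(1-3)] assms(4) by (simp add: ennreal_mult_less_top)

lemma pd_seminorm_le_iff:
  assumes "pd_norm p \<alpha> f < \<infinity>" "0 \<le> c"
  shows "pd_seminorm p \<alpha> f \<le> c \<longleftrightarrow> pd_norm p \<alpha> f \<le> ennreal c"
  unfolding pd_seminorm_def using assms by (cases "pd_norm p \<alpha> f") (auto simp: ennreal_le_iff)

lemma pd_norm_eq_pd_seminorm: "pd_norm p \<alpha> f < \<infinity> \<Longrightarrow> pd_norm p \<alpha> f = ennreal (pd_seminorm p \<alpha> f)"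
  by (simp add: pd_seminorm_def)

lemma topspace_W_inf:
  "topspace (W_inf p) = {f. smooth f \<and> (\<forall>\<alpha>\<in>multi_indices. pd_norm p \<alpha> f < \<infinity>)}"
  unfolding W_inf_def pd_norm_def by simp

lemma W_inf_eq:
  "(W_inf p :: ('a::euclidean_space \<Rightarrow> real) topology) = seminorm_topology (topspace (W_inf p))
    (pd_seminorm p ` multi_indices)"
proof -
  have "pd_seminorm p ` (multi_indices :: ('a \<Rightarrow> nat) set) = {\<lambda>f. enn2real (Lp_norm p (pd f \<alpha>)) |
      \<alpha>. \<alpha> \<in> multi_indices}"
    by (auto simp: pd_seminorm_def[abs_def] pd_norm_def)
  then show ?thesis unfolding topspace_W_inf unfolding W_inf_def pd_norm_def by simp
qed

lemma subspace_W_inf: "1 \<le> p \<Longrightarrow> subspace (topspace (W_inf p))"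
  unfolding topspace_W_inf
  by (rule subspaceI)
    (auto simp: smooth_zero smooth_add smooth_scale pd_norm_zero
      intro: pd_norm_finite_add[unfolded infinity_ennreal_def] pd_norm_finite_scale[unfolded
          infinity_ennreal_def])

lemma pd_seminorm_seminorm:
  assumes "1 \<le> p" "\<alpha> \<in> multi_indices" "V \<subseteq> topspace (W_inf p)"
  shows "seminorm_on V (pd_seminorm p \<alpha>)"
  unfolding seminorm_on_def
proof (intro conjI ballI allI)
  fix f g and c :: real assume fg: "f \<in> V" "g \<in> V"
  then have *: "smooth f" "smooth g" "pd_norm p \<alpha> f < \<infinity>" "pd_norm p \<alpha> g < \<infinity>"
    using assms by (auto simp: topspace_W_inf)
  have "pd_norm p \<alpha> (f + g) \<le> ennreal (pd_seminorm p \<alpha> f + pd_seminorm p \<alpha> g)"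
    using pd_norm_add[OF assms(1) *(1,2) assms(2)] * by (simp add: pd_seminorm_def)
  then show "pd_seminorm p \<alpha> (f + g) \<le> pd_seminorm p \<alpha> f + pd_seminorm p \<alpha> g"
    using pd_norm_finite_add[OF assms(1) *(1,2) assms(2) *(3,4)]
        by (subst pd_seminorm_le_iff) (auto simp: pd_seminorm_def)
next
  fix c f assume "f \<in> V"
  then have "smooth f" using assms by (auto simp: topspace_W_inf)
  then show "pd_seminorm p \<alpha> (c *\<^sub>R f) = \<bar>c\<bar> * pd_seminorm p \<alpha> f"
    using assms by (simp add: pd_seminorm_def pd_norm_scale enn2real_mult)
qed (simp add: pd_seminorm_def)

lemma limitin_W_inf:
  assumes "1 \<le> p"
  shows "limitin (W_inf p) f l F \<longleftrightarrow> l \<in> topspace (W_inf p) \<and> (\<forall>\<^sub>F x in F. f x \<in> topspace (W_inf p)) \<and>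
    (\<forall>\<alpha>\<in>multi_indices. ((\<lambda>x. pd_seminorm p \<alpha> (f x - l)) \<longlongrightarrow> 0) F)"
  by (subst (1) W_inf_eq, subst limitin_seminorm_topology[OF subspace_W_inf[OF assms]])
    (use pd_seminorm_seminorm[OF assms] in auto)

section \<open>The normed steps of the weighted spaces\<close>

definition W_seminorm :: "(nat \<Rightarrow> real) \<Rightarrow> real \<Rightarrow> real \<Rightarrow> ('a::euclidean_space \<Rightarrow> real) \<Rightarrow> real" where
  "W_seminorm M p \<rho> f = enn2real (weighted_sup M p \<rho> (pd f))"

lemma topspace_W_step:
  assumes "weight_sequence M" "0 < \<rho>"
  shows "f \<in> topspace (W_step M p \<rho>) \<longleftrightarrow> smooth f \<and>
     (\<exists>c\<ge>0. \<forall>\<alpha>\<in>multi_indices. pd_norm p \<alpha> f \<le> ennreal (c * weight M \<rho> (mi_order \<alpha>)))"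
  unfolding W_step_def topspace_seminorm_topology mem_Collect_eq weighted_sup_finite_iff[OF assms]
      pd_norm_def ..

lemma topspace_W_step_D:
  assumes "f \<in> topspace (W_step M p \<rho>)"
  shows "smooth f" "weighted_sup M p \<rho> (pd f) < \<infinity>"
  using assms by (auto simp: W_step_def)

lemma W_step_eq: "W_step M p \<rho> = seminorm_topology (topspace (W_step M p \<rho>)) {W_seminorm M p \<rho>}"
  unfolding W_step_def W_seminorm_def[abs_def] by simp

lemma W_seminorm_le_iff:
  assumes "weight_sequence M" "0 < \<rho>" "0 \<le> c" "f \<in> topspace (W_step M p \<rho>)"
  shows "W_seminorm M p \<rho> f \<le> c \<longleftrightarrow> (\<forall>\<alpha>\<in>multi_indices. pd_norm p \<alpha> f
      \<le> ennreal (c * weight M \<rho> (mi_order \<alpha>)))"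
proof -
  have "W_seminorm M p \<rho> f \<le> c \<longleftrightarrow> weighted_sup M p \<rho> (pd f) \<le> ennreal c"
    unfolding W_seminorm_def using topspace_W_step_D[OF assms(4)] assms(3)
    by (cases "weighted_sup M p \<rho> (pd f)") (auto simp: ennreal_le_iff)
  then show ?thesis using weighted_sup_le_iff[OF assms(1-3)] by (simp add: pd_norm_def)
qed

lemma W_seminorm_nonneg [simp]: "0 \<le> W_seminorm M p \<rho> f"
  by (simp add: W_seminorm_def)

lemma pd_norm_le_W_seminorm:
  assumes "weight_sequence M" "0 < \<rho>" "f \<in> topspace (W_step M p \<rho>)" "\<alpha> \<in> multi_indices"
  shows "pd_norm p \<alpha> f \<le> ennreal (W_seminorm M p \<rho> f * weight M \<rho> (mi_order \<alpha>))"
  using W_seminorm_le_iff[OF assms(1,2) W_seminorm_nonneg[of M p \<rho> f] assms(3)] assms(4) by auto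

lemma W_step_subset_W_inf:
  assumes "weight_sequence M" "0 < \<rho>"
  shows "topspace (W_step M p \<rho>) \<subseteq> topspace (W_inf p)"
proof
  fix f assume "f \<in> topspace (W_step M p \<rho>)"
  then obtain c where "smooth f" and c: "\<And>\<alpha>. \<alpha> \<in> multi_indices \<Longrightarrow>
      pd_norm p \<alpha> f \<le> ennreal (c * weight M \<rho> (mi_order \<alpha>))"
    unfolding topspace_W_step[OF assms] by blast
  then show "f \<in> topspace (W_inf p)"
    unfolding topspace_W_inf using le_less_trans[OF c ennreal_less_top] by simp
qed

lemma W_step_add_scale:
  assumes M: "weight_sequence M" "0 < \<rho>" "1 \<le> p" and fg: "f \<in> topspace (W_step M p \<rho>)"
      "g \<in> topspace (W_step M p \<rho>)"
  shows "f + g \<in> topspace (W_step M p \<rho>)" "c *\<^sub>R f \<in> topspace (W_step M p \<rho>)"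
    "W_seminorm M p \<rho> (f + g) \<le> W_seminorm M p \<rho> f + W_seminorm M p \<rho> g"
    "W_seminorm M p \<rho> (c *\<^sub>R f) \<le> \<bar>c\<bar> * W_seminorm M p \<rho> f"
proof -
  have sm: "smooth f" "smooth g" using fg topspace_W_step_D by auto
  have "pd_norm p \<alpha> (f + g) \<le> ennreal ((W_seminorm M p \<rho> f + W_seminorm M p \<rho> g) * weight M \<rho>
      (mi_order \<alpha>))"
    if \<alpha>: "\<alpha> \<in> multi_indices" for \<alpha>
  proof -
    have "pd_norm p \<alpha> (f + g) \<le> pd_norm p \<alpha> f + pd_norm p \<alpha> g" using pd_norm_add M sm \<alpha> by auto
    also have "\<dots> \<le> ennreal (W_seminorm M p \<rho> f * weight M \<rho> (mi_order \<alpha>)) + ennreal (W_seminorm M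
        p \<rho> g * weight M \<rho> (mi_order \<alpha>))"
      by (intro add_mono pd_norm_le_W_seminorm M fg \<alpha>)
    also have "\<dots> = ennreal ((W_seminorm M p \<rho> f + W_seminorm M p \<rho> g) * weight M \<rho> (mi_order \<alpha>))"
      using weight_nonneg[OF M(1) less_imp_le[OF M(2)]]
      by (subst ennreal_plus[symmetric]) (auto simp: algebra_simps W_seminorm_nonneg)
    finally show ?thesis .
  qed
  note * = this
  then show 1: "f + g \<in> topspace (W_step M p \<rho>)"
    unfolding topspace_W_step[OF M(1,2)] using smooth_add[OF sm] W_seminorm_nonneg
    by (intro conjI exI[of _ "W_seminorm M p \<rho> f + W_seminorm M p \<rho> g"]) auto
  show "W_seminorm M p \<rho> (f + g) \<le> W_seminorm M p \<rho> f + W_seminorm M p \<rho> g"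
    using * W_seminorm_nonneg by (subst W_seminorm_le_iff[OF M(1,2) _ 1]) auto
  have **: "pd_norm p \<alpha> (c *\<^sub>R f) \<le> ennreal ((\<bar>c\<bar> * W_seminorm M p \<rho> f) * weight M \<rho> (mi_order \<alpha>))"
    if \<alpha>: "\<alpha> \<in> multi_indices" for \<alpha>
  proof -
    have "pd_norm p \<alpha> (c *\<^sub>R f) = ennreal \<bar>c\<bar> * pd_norm p \<alpha> f" using pd_norm_scale M sm \<alpha> by auto
    also have "\<dots> \<le> ennreal \<bar>c\<bar> * ennreal (W_seminorm M p \<rho> f * weight M \<rho> (mi_order \<alpha>))"
      by (intro mult_left_mono pd_norm_le_W_seminorm M fg \<alpha>) simp
    finally show ?thesis by (simp add: ennreal_mult'[symmetric] mult.assoc)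
  qed
  then show 2: "c *\<^sub>R f \<in> topspace (W_step M p \<rho>)"
    unfolding topspace_W_step[OF M(1,2)] using smooth_scale[OF sm(1)] W_seminorm_nonneg
    by (intro conjI exI[of _ "\<bar>c\<bar> * W_seminorm M p \<rho> f"]) auto
  show "W_seminorm M p \<rho> (c *\<^sub>R f) \<le> \<bar>c\<bar> * W_seminorm M p \<rho> f"
    using ** W_seminorm_nonneg by (subst W_seminorm_le_iff[OF M(1,2) _ 2]) auto
qed

lemma zero_in_W_step: "weight_sequence M \<Longrightarrow> 0 < \<rho> \<Longrightarrow> 1 \<le> p \<Longrightarrow> 0 \<in> topspace (W_step M p \<rho>)"
  by (auto simp: topspace_W_step smooth_zero pd_norm_zero)

lemma subspace_W_step: "weight_sequence M \<Longrightarrow> 0 < \<rho> \<Longrightarrow> 1 \<le> p \<Longrightarrow> subspace (topspace (W_step M p \<rho>))"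
  by (intro subspaceI zero_in_W_step W_step_add_scale)

text \<open>Homogeneity: the inequality for scalar multiples, used once with \<open>c\<close> and
  once with \<open>1 / c\<close>, becomes an equality.\<close>

lemma W_seminorm_seminorm:
  assumes M: "weight_sequence M" "0 < \<rho>" "1 \<le> p"
  shows "seminorm_on (topspace (W_step M p \<rho>)) (W_seminorm M p \<rho>)"
  unfolding seminorm_on_def
proof (intro conjI ballI allI)
  fix c f assume f: "f \<in> topspace (W_step M p \<rho>)"
  have cf: "W_seminorm M p \<rho> (c *\<^sub>R f) \<le> \<bar>c\<bar> * W_seminorm M p \<rho> f"
      if "f \<in> topspace (W_step M p \<rho>)" for c f
    using W_step_add_scale(4)[OF M that that] .
  show "W_seminorm M p \<rho> (c *\<^sub>R f) = \<bar>c\<bar> * W_seminorm M p \<rho> f"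
  proof (cases "c = 0")
    case True
    then show ?thesis using cf[OF f, of c] by (intro antisym) simp_all
  next
    case False
    have "W_seminorm M p \<rho> f \<le> \<bar>1 / c\<bar> * W_seminorm M p \<rho> (c *\<^sub>R f)"
      using cf[OF W_step_add_scale(2)[OF M f f, of c], of "1 / c"] False by simp
    then show ?thesis using False cf[OF f, of c] by (simp add: field_simps)
  qed
qed (auto simp: W_step_add_scale(3)[OF M])

lemma limitin_W_step:
  assumes "weight_sequence M" "0 < \<rho>" "1 \<le> p"
  shows "limitin (W_step M p \<rho>) f l F \<longleftrightarrow> l \<in> topspace (W_step M p \<rho>) \<and>
    (\<forall>\<^sub>F x in F. f x \<in> topspace (W_step M p \<rho>)) \<and> ((\<lambda>x. W_seminorm M p \<rho> (f x - l)) \<longlongrightarrow> 0) F"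
  by (subst (1) W_step_eq, subst limitin_seminorm_topology_single[OF subspace_W_step[OF assms]
      W_seminorm_seminorm[OF assms]]) simp

lemma pd_seminorm_le_W_seminorm:
  assumes "weight_sequence M" "0 < \<rho>" "f \<in> topspace (W_step M p \<rho>)" "\<alpha> \<in> multi_indices"
  shows "pd_seminorm p \<alpha> f \<le> W_seminorm M p \<rho> f * weight M \<rho> (mi_order \<alpha>)"
  using pd_norm_le_W_seminorm[OF assms] W_step_subset_W_inf[OF assms(1,2), of p]
      assms(3,4) weight_nonneg[OF assms(1) less_imp_le[OF assms(2)]] W_seminorm_nonneg[of M p \<rho> f]
  by (subst pd_seminorm_le_iff) (auto simp: topspace_W_inf)

text \<open>\<open>W_inf\<close> is the common coarser space: evaluations of derivatives at points
  are continuous on it, so the passage from curried to joint smoothness is proved there once and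
  reaches the weighted spaces through inclusions like this one.\<close>

lemma continuous_map_W_step_W_inf:
  assumes "weight_sequence M" "0 < \<rho>" "1 \<le> p"
  shows "continuous_map (W_step M p \<rho> :: ('a::euclidean_space \<Rightarrow> real) topology) (W_inf p) (\<lambda>x. x)"
proof (rule continuous_map_atinI)
  fix l :: "'a \<Rightarrow> real" assume l: "l \<in> topspace (W_step M p \<rho>)"
  let ?F = "atin (W_step M p \<rho>) l"
  have lim: "\<forall>\<^sub>F x in ?F. x \<in> topspace (W_step M p \<rho>)" "((\<lambda>x. W_seminorm M p \<rho> (x - l)) \<longlongrightarrow> 0) ?F"
    using limitin_id[OF l] unfolding limitin_W_step[OF assms] by auto
  show "limitin (W_inf p) (\<lambda>x. x) l ?F"
    unfolding limitin_W_inf[OF assms(3)]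
  proof (intro conjI ballI)
    show "l \<in> topspace (W_inf p)" using l W_step_subset_W_inf[OF assms(1,2)] by auto
    show "\<forall>\<^sub>F x in ?F. x \<in> topspace (W_inf p)"
      using lim(1) by eventually_elim (use W_step_subset_W_inf[OF assms(1,2)] in auto)
    fix \<alpha> :: "'a \<Rightarrow> nat" assume \<alpha>: "\<alpha> \<in> multi_indices"
    show "((\<lambda>x. pd_seminorm p \<alpha> (x - l)) \<longlongrightarrow> 0) ?F"
    proof (rule Lim_null_comparison[OF _ tendsto_mult_left_zero[OF lim(2)]])
      show "\<forall>\<^sub>F x in ?F. norm (pd_seminorm p \<alpha> (x - l)) \<le> W_seminorm M p \<rho> (x - l) * weight M \<rho>
          (mi_order \<alpha>)"
        using lim(1)
      proof eventually_elim
        case (elim x)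
        then have "x - l \<in> topspace (W_step M p \<rho>)"
            using l subspace_diff[OF subspace_W_step[OF assms]] by auto
        then show ?case using pd_seminorm_le_W_seminorm[OF assms(1,2) _ \<alpha>]
            by (simp add: pd_seminorm_def)
      qed
    qed
  qed
qed

lemma W_step_mono:
  assumes "weight_sequence M" "0 < \<rho>" "\<rho> \<le> \<sigma>"
  shows "topspace (W_step M p \<rho>) \<subseteq> topspace (W_step M p \<sigma>)"
    "f \<in> topspace (W_step M p \<rho>) \<Longrightarrow> W_seminorm M p \<sigma> f \<le> W_seminorm M p \<rho> f"
proof -
  have *: "pd_norm p \<alpha> f \<le> ennreal (W_seminorm M p \<rho> f * weight M \<sigma> (mi_order \<alpha>))"
    if "f \<in> topspace (W_step M p \<rho>)" "\<alpha> \<in> multi_indices" for f \<alpha>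
    using pd_norm_le_W_seminorm[OF assms(1,2) that] weight_mono[OF assms(1) _ assms(3), of
        "mi_order \<alpha>"] assms(2) W_seminorm_nonneg[of M p \<rho> f]
    by (auto intro!: order_trans[of _ "ennreal (W_seminorm M p \<rho> f * weight M \<rho> (mi_order \<alpha>))"]
        ennreal_leI mult_left_mono)
  have "f \<in> topspace (W_step M p \<sigma>)" if "f \<in> topspace (W_step M p \<rho>)" for f
    using *[OF that] topspace_W_step_D(1)[OF that] assms W_seminorm_nonneg
    by (subst topspace_W_step) (auto intro!: exI[of _ "W_seminorm M p \<rho> f"])
  then show 1: "topspace (W_step M p \<rho>) \<subseteq> topspace (W_step M p \<sigma>)" by auto
  show "W_seminorm M p \<sigma> f \<le> W_seminorm M p \<rho> f" if "f \<in> topspace (W_step M p \<rho>)"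
    using *[OF that] 1 that assms W_seminorm_nonneg by (subst W_seminorm_le_iff) auto
qed

section \<open>The projective limit of the steps\<close>

lemma topspace_W_Beurling: "topspace (W_Beurling M p) = (\<Inter>n. topspace (W_step M p (1 / real (Suc
    n))))"
  unfolding W_Beurling_def topspace_projective_limit ..

lemma limitin_W_Beurling:
  "limitin (W_Beurling M p) f l F \<longleftrightarrow> (\<forall>\<^sub>F x in F. f x \<in> topspace (W_Beurling M p)) \<and>
    (\<forall>n. limitin (W_step M p (1 / real (Suc n))) f l F)"
  unfolding W_Beurling_def by (rule limitin_projective_limit)

lemma subspace_W_Beurling: "weight_sequence M \<Longrightarrow> 1 \<le> p \<Longrightarrow> subspace (topspace (W_Beurling M p))"
  unfolding topspace_W_Beurling by (intro subspace_Inter) (auto intro!: subspace_W_step)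

lemma topspace_W_Beurling_step:
  assumes M: "weight_sequence M" and f: "f \<in> topspace (W_Beurling M p)" and \<rho>: "0 < \<rho>"
  shows "f \<in> topspace (W_step M p \<rho>)"
proof -
  obtain n where n: "1 / real (Suc n) < \<rho>" using nat_approx_posE[OF \<rho>] by auto
  then show ?thesis
    using f W_step_mono(1)[OF M, of "1 / real (Suc n)" \<rho> p] by (auto simp: topspace_W_Beurling)
qed

lemma continuous_map_W_Beurling_W_inf:
  assumes "weight_sequence M" "1 \<le> p"
  shows "continuous_map (W_Beurling M p) (W_inf p) (\<lambda>x. x)"
proof (rule continuous_map_atinI)
  fix l assume "l \<in> topspace (W_Beurling M p)"
  then have "limitin (W_Beurling M p) (\<lambda>x. x) l (atin (W_Beurling M p) l)" by (rule limitin_id)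
  then have "limitin (W_step M p (1 / real (Suc 0))) (\<lambda>x. x) l (atin (W_Beurling M p) l)"
    unfolding limitin_W_Beurling by blast
  then show "limitin (W_inf p) (\<lambda>x. x) l (atin (W_Beurling M p) l)"
    using continuous_map_limitinD[OF continuous_map_W_step_W_inf[of M 1 p]] assms by simp
qed

section \<open>The inductive limit of the steps\<close>

lemma subspace_W_Roumieu_union:
  assumes M: "weight_sequence M" "1 \<le> p"
  shows "subspace (\<Union>n. topspace (W_step M p (real (Suc n)) :: ('a::euclidean_space \<Rightarrow> real)
      topology))"
proof (rule subspaceI)
  have "(0 :: 'a \<Rightarrow> real) \<in> topspace (W_step M p (real (Suc 0)))" by (intro zero_in_W_step M) simp
  then show "0 \<in> (\<Union>n. topspace (W_step M p (real (Suc n)) :: ('a \<Rightarrow> real) topology))" by blast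
  fix f g :: "'a \<Rightarrow> real" assume "f \<in> (\<Union>n. topspace (W_step M p (real (Suc n))))"
      "g \<in> (\<Union>n. topspace (W_step M p (real (Suc n))))"
  then obtain m n where mn: "f \<in> topspace (W_step M p (real (Suc m)))"
      "g \<in> topspace (W_step M p (real (Suc n)))" by auto
  have "f \<in> topspace (W_step M p (real (Suc (max m n))))"
      "g \<in> topspace (W_step M p (real (Suc (max m n))))"
    using mn W_step_mono(1)[OF M(1), of "real (Suc m)" "real (Suc (max m n))" p]
      W_step_mono(1)[OF M(1), of "real (Suc n)" "real (Suc (max m n))" p] by auto
  then have "f + g \<in> topspace (W_step M p (real (Suc (max m n))))"
    using M by (intro W_step_add_scale(1)) auto
  then show "f + g \<in> (\<Union>n. topspace (W_step M p (real (Suc n))))" by blast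
next
  fix c and f :: "'a \<Rightarrow> real" assume "f \<in> (\<Union>n. topspace (W_step M p (real (Suc n))))"
  then obtain n where "f \<in> topspace (W_step M p (real (Suc n)))" by auto
  then have "c *\<^sub>R f \<in> topspace (W_step M p (real (Suc n)))"
    using W_step_add_scale(2)[OF M(1) _ M(2), of "real (Suc n)" f f c] by auto
  then show "c *\<^sub>R f \<in> (\<Union>n. topspace (W_step M p (real (Suc n))))" by blast
qed

lemma topspace_W_Roumieu:
  assumes "weight_sequence M" "1 \<le> p"
  shows "topspace (W_Roumieu M p) = (\<Union>n. topspace (W_step M p (real (Suc n))))"
  unfolding W_Roumieu_def by (rule topspace_inductive_limit[OF subspace_W_Roumieu_union[OF assms]])

lemma topspace_W_Roumieu_iff:
  assumes M: "weight_sequence M" "1 \<le> p"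
  shows "f \<in> topspace (W_Roumieu M p) \<longleftrightarrow> (\<exists>\<rho>>0. f \<in> topspace (W_step M p \<rho>))"
proof
  assume "f \<in> topspace (W_Roumieu M p)"
  then show "\<exists>\<rho>>0. f \<in> topspace (W_step M p \<rho>)"
    unfolding topspace_W_Roumieu[OF M] by (metis UN_E of_nat_0_less_iff zero_less_Suc)
next
  assume "\<exists>\<rho>>0. f \<in> topspace (W_step M p \<rho>)"
  then obtain \<rho> where \<rho>: "0 < \<rho>" "f \<in> topspace (W_step M p \<rho>)" by auto
  obtain n where "\<rho> \<le> real n" using real_arch_simple by blast
  then have "f \<in> topspace (W_step M p (real (Suc n)))"
    using W_step_mono(1)[OF M(1) \<rho>(1), of "real (Suc n)" p] \<rho>(2) by auto
  then show "f \<in> topspace (W_Roumieu M p)" unfolding topspace_W_Roumieu[OF M] by blast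
qed

lemma continuous_map_W_step_W_Roumieu:
  assumes "weight_sequence M" "1 \<le> p"
  shows "continuous_map (W_step M p (real (Suc n))) (W_Roumieu M p) (\<lambda>x. x)"
  unfolding W_Roumieu_def
  by (rule continuous_map_into_inductive_limit[OF subspace_W_Roumieu_union[OF assms]])

text \<open>The working criterion for continuity on the Roumieu space. The constant may depend on
  the step; it is applied to the seminorms of single derivatives and to the supremum seminorm in
  \<open>W_Roumieu_curry_backward\<close>.\<close>

lemma limitin_W_Roumieu_seminorm:
  fixes s :: "('a::euclidean_space \<Rightarrow> real) \<Rightarrow> real"
  assumes M: "weight_sequence M" "1 \<le> p"
    and s: "seminorm_on (topspace (W_Roumieu M p)) s"
    and bd: "\<And>n. \<exists>C\<ge>0. \<forall>f\<in>topspace (W_step M p (real (Suc n))). s f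
        \<le> C * W_seminorm M p (real (Suc n)) f"
    and u: "limitin (W_Roumieu M p) u l F"
  shows "((\<lambda>x. s (u x - l)) \<longlongrightarrow> 0) F"
proof (rule limitin_inductive_limit_seminorm[OF subspace_W_Roumieu_union[OF M]])
  show "seminorm_on (\<Union>n. topspace (W_step M p (real (Suc n)))) s" using s
      unfolding topspace_W_Roumieu[OF M] .
  show "limitin (inductive_limit (\<lambda>n. W_step M p (real (Suc n)))) u l F" using u
      unfolding W_Roumieu_def .
  fix n and x :: "'a \<Rightarrow> real" assume x: "x \<in> topspace (W_step M p (real (Suc n)))"
  let ?T = "W_step M p (real (Suc n))"
  have n: "0 < real (Suc n)" by simp
  obtain C where C: "0 \<le> C" "\<And>f. f\<in>topspace ?T \<Longrightarrow> s f \<le> C * W_seminorm M p (real (Suc n)) f"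
    using bd[of n] by auto
  have lim: "\<forall>\<^sub>F y in atin ?T x. y \<in> topspace ?T"
      "((\<lambda>y. W_seminorm M p (real (Suc n)) (y - x)) \<longlongrightarrow> 0) (atin ?T x)"
    using limitin_id[OF x] unfolding limitin_W_step[OF M(1) n M(2)] by auto
  show "((\<lambda>y. s (y - x)) \<longlongrightarrow> 0) (atin ?T x)"
  proof (rule Lim_null_comparison[OF _ tendsto_mult_right_zero[OF lim(2), of C]])
    show "\<forall>\<^sub>F y in atin ?T x. norm (s (y - x)) \<le> C * W_seminorm M p (real (Suc n)) (y - x)"
      using lim(1)
    proof eventually_elim
      case (elim y)
      then have d: "y - x \<in> topspace ?T" using x subspace_diff[OF subspace_W_step[OF M(1) n M(2)]]
          by auto
      then have "y - x \<in> topspace (W_Roumieu M p)" unfolding topspace_W_Roumieu[OF M] by blast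
      then have "0 \<le> s (y - x)" using s by (auto simp: seminorm_on_def)
      then show ?case using C(2)[OF d] by simp
    qed
  qed
qed

lemma W_Roumieu_subset_W_inf:
  assumes "weight_sequence M" "1 \<le> p"
  shows "topspace (W_Roumieu M p) \<subseteq> topspace (W_inf p)"
  unfolding topspace_W_Roumieu[OF assms] by (intro UN_least W_step_subset_W_inf[OF assms(1)]) simp

lemma subspace_W_Roumieu: "weight_sequence M \<Longrightarrow> 1 \<le> p \<Longrightarrow> subspace (topspace (W_Roumieu M p))"
  by (simp add: topspace_W_Roumieu subspace_W_Roumieu_union del: of_nat_Suc)

lemma continuous_map_W_Roumieu_W_inf:
  assumes M: "weight_sequence M" "1 \<le> p"
  shows "continuous_map (W_Roumieu M p :: ('a::euclidean_space \<Rightarrow> real) topology) (W_inf p) (\<lambda>x. x)"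
proof (rule continuous_map_atinI)
  fix l :: "'a \<Rightarrow> real" assume l: "l \<in> topspace (W_Roumieu M p)"
  show "limitin (W_inf p) (\<lambda>x. x) l (atin (W_Roumieu M p) l)"
    unfolding limitin_W_inf[OF M(2)]
  proof (intro conjI ballI)
    show "l \<in> topspace (W_inf p)" using l W_Roumieu_subset_W_inf[OF M] by auto
    show "\<forall>\<^sub>F x in atin (W_Roumieu M p) l. x \<in> topspace (W_inf p)"
      using limitin_eventually_topspace[OF limitin_id[OF l]]
      by eventually_elim (use W_Roumieu_subset_W_inf[OF M] in auto)
    fix \<alpha> :: "'a \<Rightarrow> nat" assume \<alpha>: "\<alpha> \<in> multi_indices"
    show "((\<lambda>x. pd_seminorm p \<alpha> (x - l)) \<longlongrightarrow> 0) (atin (W_Roumieu M p) l)"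
    proof (rule limitin_W_Roumieu_seminorm[OF M pd_seminorm_seminorm[OF M(2) \<alpha>
        W_Roumieu_subset_W_inf[OF M]] _ limitin_id[OF l]])
      fix n
      show "\<exists>C\<ge>0. \<forall>f\<in>topspace (W_step M p (real (Suc n))). pd_seminorm p \<alpha> f
          \<le> C * W_seminorm M p (real (Suc n)) f"
        using pd_seminorm_le_W_seminorm[OF M(1) _ _ \<alpha>, of "real (Suc n)"]
            weight_pos[OF M(1), of "real (Suc n)" "mi_order \<alpha>"]
        by (intro exI[of _ "weight M (real (Suc n)) (mi_order \<alpha>)"])
            (auto simp: mult.commute simp del: of_nat_Suc)
    qed
  qed
qed

section \<open>Slices of functions on a product\<close>

text \<open>The basis vectors of a product are \<open>(u, 0)\<close> and \<open>(0, v)\<close>. The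
  guards make the joined index vanish at pairs with two nonzero entries; at \<open>(0, 0)\<close>
  both summands are present, but they are 0 for multi-indices because 0 is not a basis
  vector.\<close>

definition join_index :: "('a::euclidean_space \<Rightarrow> nat) \<Rightarrow> ('b::euclidean_space \<Rightarrow> nat) \<Rightarrow> 'a \<times> 'b \<Rightarrow>
    nat" where
  "join_index \<alpha> \<beta> = (\<lambda>(u, v). (if v = 0 then \<alpha> u else 0) + (if u = 0 then \<beta> v else 0))"

lemma multi_indices_at_zero: "\<alpha> \<in> multi_indices \<Longrightarrow> \<alpha> 0 = 0"
  by (auto simp: multi_indices_def nonzero_Basis)

lemma join_index_multi_indices: "\<alpha> \<in> multi_indices \<Longrightarrow> \<beta> \<in> multi_indices \<Longrightarrow>
    join_index \<alpha> \<beta> \<in> multi_indices"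
  by (auto simp: multi_indices_def join_index_def Basis_prod_def nonzero_Basis)

lemma join_index_zero: "join_index (\<lambda>_. 0) (\<lambda>_. 0) = (\<lambda>_. 0)"
  by (auto simp: join_index_def)

lemma join_index_fst: "\<beta> \<in> multi_indices \<Longrightarrow> join_index \<alpha> \<beta> (u, 0) = \<alpha> u"
  and join_index_snd: "\<alpha> \<in> multi_indices \<Longrightarrow> join_index \<alpha> \<beta> (0, v) = \<beta> v"
  by (auto simp: join_index_def multi_indices_at_zero)

lemma join_index_upd_fst:
  "u \<in> Basis \<Longrightarrow> \<beta> \<in> multi_indices \<Longrightarrow> (join_index \<alpha> \<beta>)((u, 0) := Suc (join_index \<alpha> \<beta> (u, 0)))
    = join_index (\<alpha>(u := Suc (\<alpha> u))) \<beta>"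
  by (auto simp: join_index_def fun_eq_iff multi_indices_at_zero nonzero_Basis)

lemma join_index_upd_snd:
  "v \<in> Basis \<Longrightarrow> \<alpha> \<in> multi_indices \<Longrightarrow> (join_index \<alpha> \<beta>)((0, v) := Suc (join_index \<alpha> \<beta> (0, v)))
    = join_index \<alpha> (\<beta>(v := Suc (\<beta> v)))"
  by (auto simp: join_index_def fun_eq_iff multi_indices_at_zero nonzero_Basis)

lemma mi_order_join_index:
  assumes "\<alpha> \<in> multi_indices" "\<beta> \<in> multi_indices"
  shows "mi_order (join_index \<alpha> \<beta>) = mi_order \<alpha> + mi_order \<beta>"
proof -
  have "sum (join_index \<alpha> \<beta>) Basis = sum (join_index \<alpha> \<beta>) ((\<lambda>u. (u, 0)) ` Basis) + sum (join_index
      \<alpha> \<beta>) ((\<lambda>v. (0, v)) ` Basis)"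
    unfolding Basis_prod_def by (rule sum.union_disjoint) (auto simp: nonzero_Basis)
  then show ?thesis
    unfolding mi_order_def using assms
    by (simp add: sum.reindex inj_on_def join_index_fst join_index_snd)
qed

lemma multi_indices_prodE:
  assumes "\<gamma> \<in> multi_indices"
  obtains \<alpha> \<beta> where "\<alpha> \<in> multi_indices" "\<beta> \<in> multi_indices" "\<gamma> = join_index \<alpha> \<beta>"
    "\<alpha> = (\<lambda>u. \<gamma> (u, 0))" "\<beta> = (\<lambda>v. \<gamma> (0, v))"
proof
  show "(\<lambda>u. \<gamma> (u, 0)) \<in> multi_indices" "(\<lambda>v. \<gamma> (0, v)) \<in> multi_indices"
    using assms nonzero_Basis by (auto simp: multi_indices_def Basis_prod_def image_iff)
  have z0: "\<gamma> (0, 0) = 0" using multi_indices_at_zero[OF assms] by (simp add: zero_prod_def)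
  show "\<gamma> = join_index (\<lambda>u. \<gamma> (u, 0)) (\<lambda>v. \<gamma> (0, v))"
  proof
    fix z :: "'a \<times> 'b"
    obtain u v where z: "z = (u, v)" by (cases z)
    show "\<gamma> z = join_index (\<lambda>u. \<gamma> (u, 0)) (\<lambda>v. \<gamma> (0, v)) z"
      using assms z0 unfolding z by (auto simp: join_index_def multi_indices_def Basis_prod_def)
  qed
qed (rule refl)+

lemma slice_family:
  assumes D: "scalar_family f D" and \<alpha>: "\<alpha> \<in> multi_indices"
  shows "scalar_family (\<lambda>y. D (join_index \<alpha> (\<lambda>_. 0)) (x, y)) (\<lambda>\<beta> y. D (join_index \<alpha> \<beta>) (x, y))"
  unfolding scalar_family_iff
proof (intro conjI ballI allI refl)
  fix \<beta> :: "'b \<Rightarrow> nat" assume \<beta>: "\<beta> \<in> multi_indices"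
  note c = join_index_multi_indices[OF \<alpha> \<beta>]
  show "continuous_on UNIV (\<lambda>y. D (join_index \<alpha> \<beta>) (x, y))"
    by (rule continuous_on_compose2[OF scalar_family_D(1)[OF D c]]) (auto intro!: continuous_intros)
  fix b y :: 'b and t assume b: "b \<in> Basis"
  then have "(0, b) \<in> (Basis :: ('a \<times> 'b) set)" by (auto simp: Basis_prod_def)
  from scalar_family_D(3)[OF D c this, of "(x, y)" t]
  show "((\<lambda>t. D (join_index \<alpha> \<beta>) (x, y + t *\<^sub>R b)) has_real_derivative D (join_index \<alpha> (\<beta>(b := Suc
      (\<beta> b)))) (x, y + t *\<^sub>R b)) (at t)"
    unfolding join_index_upd_snd[OF b \<alpha>] by simp
qed

text \<open>Freezing \<open>y\<close> is what allows the Sobolev inequality to be applied in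
  \<open>x\<close> alone.\<close>

lemma slice_family_fst:
  assumes D: "scalar_family f D" and \<beta>: "\<beta> \<in> multi_indices"
  shows "scalar_family (\<lambda>x. D (join_index (\<lambda>_. 0) \<beta>) (x, y)) (\<lambda>\<alpha> x. D (join_index \<alpha> \<beta>) (x, y))"
  unfolding scalar_family_iff
proof (intro conjI ballI allI refl)
  fix \<alpha> :: "'a \<Rightarrow> nat" assume \<alpha>: "\<alpha> \<in> multi_indices"
  note c = join_index_multi_indices[OF \<alpha> \<beta>]
  show "continuous_on UNIV (\<lambda>x. D (join_index \<alpha> \<beta>) (x, y))"
    by (rule continuous_on_compose2[OF scalar_family_D(1)[OF D c]]) (auto intro!: continuous_intros)
  fix b x :: 'a and t assume b: "b \<in> Basis"
  then have "(b, 0) \<in> (Basis :: ('a \<times> 'b) set)" by (auto simp: Basis_prod_def)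
  from scalar_family_D(3)[OF D c this, of "(x, y)" t]
  show "((\<lambda>t. D (join_index \<alpha> \<beta>) (x + t *\<^sub>R b, y)) has_real_derivative D (join_index (\<alpha>(b := Suc
      (\<alpha> b))) \<beta>) (x + t *\<^sub>R b, y)) (at t)"
    unfolding join_index_upd_fst[OF b \<beta>] by simp
qed

lemma slice_smooth:
  assumes "scalar_family f D" "\<alpha> \<in> multi_indices"
  shows "smooth (\<lambda>y. D (join_index \<alpha> (\<lambda>_. 0)) (x, y))"
    "\<beta> \<in> multi_indices \<Longrightarrow> pd (\<lambda>y. D (join_index \<alpha> (\<lambda>_. 0)) (x, y)) \<beta> =
      (\<lambda>y. D (join_index \<alpha> \<beta>) (x, y))"
  using slice_family[OF assms] scalar_family_smooth scalar_family_pd by blast+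

lemma Lp_integral_prod:
  assumes "u \<in> borel_measurable borel"
  shows "Lp_integral p u = (\<integral>\<^sup>+x. Lp_integral p (\<lambda>y. u (x, y)) \<partial>lborel)"
    and "Lp_integral p u = (\<integral>\<^sup>+y. Lp_integral p (\<lambda>x. u (x, y)) \<partial>lborel)"
proof -
  have [measurable]: "u \<in> borel_measurable (borel \<Otimes>\<^sub>M borel)" using assms by (simp add: borel_prod)
  show "Lp_integral p u = (\<integral>\<^sup>+x. Lp_integral p (\<lambda>y. u (x, y)) \<partial>lborel)"
    unfolding Lp_integral_def lborel_prod[symmetric]
        by (subst lborel.nn_integral_fst[symmetric]) auto
  show "Lp_integral p u = (\<integral>\<^sup>+y. Lp_integral p (\<lambda>x. u (x, y)) \<partial>lborel)"
    unfolding Lp_integral_def lborel_prod[symmetric]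
        by (subst lborel_pair.nn_integral_snd[symmetric]) auto
qed

lemma Lp_integral_slice_measurable:
  assumes "u \<in> borel_measurable borel"
  shows "(\<lambda>x. Lp_integral p (\<lambda>y. u (x, y))) \<in> borel_measurable borel"
      "(\<lambda>y. Lp_integral p (\<lambda>x. u (x, y))) \<in> borel_measurable borel"
proof -
  have [measurable]: "u \<in> borel_measurable (borel \<Otimes>\<^sub>M borel)" using assms by (simp add: borel_prod)
  show "(\<lambda>x. Lp_integral p (\<lambda>y. u (x, y))) \<in> borel_measurable borel"
      "(\<lambda>y. Lp_integral p (\<lambda>x. u (x, y))) \<in> borel_measurable borel"
    unfolding Lp_integral_def by measurable
qed

lemma Lp_integral_zero: "0 < p \<Longrightarrow> Lp_integral p (\<lambda>_. 0) = 0"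
  by (simp add: Lp_integral_def)

lemma Lp_integral_scale: "Lp_integral p (\<lambda>x. c * u x) = ennreal (\<bar>c\<bar> powr p) * Lp_integral p u"
    if "u \<in> borel_measurable borel"
proof -
  have "Lp_integral p (\<lambda>x. c * u x) = (\<integral>\<^sup>+x. ennreal (\<bar>c\<bar> powr p) * ennreal (\<bar>u x\<bar> powr p) \<partial>lborel)"
    unfolding Lp_integral_def by (simp add: abs_mult powr_mult ennreal_mult')
  also have "\<dots> = ennreal (\<bar>c\<bar> powr p) * Lp_integral p u"
    unfolding Lp_integral_def using that by (intro nn_integral_cmult) auto
  finally show ?thesis .
qed

text \<open>For each \<open>y\<close> the increment is bounded by Jensen's inequality in
  \<open>t\<close>; integrating over \<open>y\<close> and exchanging the integrals brings in the
  bound on the norms of \<open>h' s\<close>. The powers of |t| add up, from \<open>p - 1\<close> by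
  Jensen and 1 by the length of the interval.\<close>

lemma Lp_integral_increment_le:
  fixes h h' :: "real \<Rightarrow> 'b::euclidean_space \<Rightarrow> real"
  assumes p: "1 \<le> p"
    and der: "\<And>y t. ((\<lambda>t. h t y) has_real_derivative h' t y) (at t)"
    and cont: "continuous_on UNIV (\<lambda>z. h' (fst z) (snd z))"
    and k: "0 \<le> k" and bd: "\<And>s. \<bar>s\<bar> \<le> \<bar>t\<bar> \<Longrightarrow> Lp_integral p (h' s) \<le> ennreal (k powr p)"
  shows "Lp_integral p (\<lambda>y. h t y - h 0 y) \<le> ennreal ((\<bar>t\<bar> * k) powr p)"
proof (cases "t = 0")
  case True
  then show ?thesis using p by (simp add: Lp_integral_zero)
next
  case False
  \<comment> \<open>The sign of \<open>t\<close> is arbitrary; minimum and maximum orient the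
    interval between 0 and \<open>t\<close>.\<close>
  define a where "a = min 0 t"
  define b where "b = max 0 t"
  have ab: "a < b" "b - a = \<bar>t\<bar>" using False by (auto simp: a_def b_def)
  have "(\<lambda>z. h' (fst z) (snd z)) \<in> borel_measurable borel"
    by (rule borel_measurable_continuous_onI[OF cont])
  then have [measurable]: "(\<lambda>(s, y). h' s y) \<in> borel_measurable (borel \<Otimes>\<^sub>M borel)"
    by (simp add: borel_prod case_prod_unfold)
  have "Lp_integral p (\<lambda>y. h t y - h 0 y) \<le> (\<integral>\<^sup>+y. ennreal (\<bar>t\<bar> powr (p - 1)) *
      (\<integral>\<^sup>+s. ennreal (\<bar>h' s y\<bar> powr p) * indicator {a..b} s \<partial>lborel) \<partial>lborel)"
    unfolding Lp_integral_def
  proof (rule nn_integral_mono)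
    fix y
    have c: "continuous_on UNIV (\<lambda>t. h' t y)"
      using continuous_on_compose2[OF cont, of UNIV "\<lambda>t. (t, y)"]
      by (simp add: continuous_on_Pair continuous_on_id continuous_on_const)
    have "\<bar>h t y - h 0 y\<bar> = \<bar>h b y - h a y\<bar>" by (auto simp: a_def b_def min_def max_def)
    then show "ennreal (\<bar>h t y - h 0 y\<bar> powr p) \<le> ennreal (\<bar>t\<bar> powr (p - 1)) *
      (\<integral>\<^sup>+s. ennreal (\<bar>h' s y\<bar> powr p) * indicator {a..b} s \<partial>lborel)"
      using increment_powr_le[OF p ab(1) der c] ab(2) by simp
  qed
  also have "\<dots> = ennreal (\<bar>t\<bar> powr (p - 1)) *
      (\<integral>\<^sup>+y. (\<integral>\<^sup>+s. ennreal (\<bar>h' s y\<bar> powr p) * indicator {a..b} s \<partial>lborel) \<partial>lborel)"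
    by (rule nn_integral_cmult) measurable
  also have "(\<integral>\<^sup>+y. (\<integral>\<^sup>+s. ennreal (\<bar>h' s y\<bar> powr p) * indicator {a..b} s \<partial>lborel) \<partial>lborel)
    = (\<integral>\<^sup>+s. (\<integral>\<^sup>+y. ennreal (\<bar>h' s y\<bar> powr p) * indicator {a..b} s \<partial>lborel) \<partial>lborel)"
    by (rule lborel_pair.Fubini') measurable
  also have "\<dots> \<le> (\<integral>\<^sup>+s. ennreal (k powr p) * indicator {a..b} s \<partial>lborel)"
  proof (rule nn_integral_mono)
    fix s :: real
    show "(\<integral>\<^sup>+y. ennreal (\<bar>h' s y\<bar> powr p) * indicator {a..b} s \<partial>lborel)
        \<le> ennreal (k powr p) * indicator {a..b} s"
    proof (cases "s \<in> {a..b}")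
      case True
      then have "\<bar>s\<bar> \<le> \<bar>t\<bar>" by (auto simp: a_def b_def min_def max_def split: if_splits)
      from bd[OF this] show ?thesis using True by (simp add: Lp_integral_def)
    qed simp
  qed
  also have "\<dots> = ennreal (k powr p) * ennreal \<bar>t\<bar>"
    using ab by (subst nn_integral_cmult_indicator) auto
  also have "ennreal (\<bar>t\<bar> powr (p - 1)) * (ennreal (k powr p) * ennreal \<bar>t\<bar>)
    = ennreal (\<bar>t\<bar> powr (p - 1) * (k powr p * \<bar>t\<bar>))"
    by (simp add: ennreal_mult')
  also have "\<bar>t\<bar> powr (p - 1) * (k powr p * \<bar>t\<bar>) = (\<bar>t\<bar> * k) powr p"
    using False k by (simp add: powr_mult powr_diff)
  finally show ?thesis by (simp add: mult_left_mono)
qed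

text \<open>Sobolev's inequality in \<open>x\<close> at fixed \<open>y\<close>, integrated over
  \<open>y\<close>, bounds each slice by finitely many joint norms. Only the orders in
  \<open>x\<close> are raised, by indices from a set not depending on \<open>\<beta>\<close>, so
  \<open>\<kappa> \<beta>\<close> factors out and one \<open>B\<close> serves all
  \<open>\<beta>\<close> in \<open>S\<close>.\<close>

lemma slice_bound:
  fixes D :: "('a::euclidean_space \<times> 'b::euclidean_space \<Rightarrow> nat) \<Rightarrow> 'a \<times> 'b \<Rightarrow> real"
  assumes p: "1 \<le> p" and D: "scalar_family f D" and S: "S \<subseteq> multi_indices"
    and \<kappa>: "\<And>\<beta>. \<beta> \<in> S \<Longrightarrow> 0 \<le> \<kappa> \<beta>"
    and H: "\<And>\<alpha>. \<alpha> \<in> multi_indices \<Longrightarrow> \<exists>B\<ge>0. \<forall>\<beta>\<in>S. Lp_integral p (D (join_index \<alpha> \<beta>))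
        \<le> ennreal ((B * \<kappa> \<beta>) powr p)"
    and \<alpha>: "\<alpha> \<in> multi_indices"
  shows "\<exists>B\<ge>0. \<forall>\<beta>\<in>S. \<forall>x. Lp_integral p (\<lambda>y. D (join_index \<alpha> \<beta>) (x, y)) \<le> ennreal ((B * \<kappa> \<beta>) powr p)"
proof -
  obtain \<Delta> :: "('a \<Rightarrow> nat) set" and C where \<Delta>: "finite \<Delta>" "\<Delta> \<subseteq> multi_indices" and C: "0 \<le> C"
    and sob: "\<And>f D \<alpha> x. scalar_family f D \<Longrightarrow> \<alpha> \<in> multi_indices \<Longrightarrow>
      ennreal (\<bar>D \<alpha> x\<bar> powr p) \<le> ennreal C * (\<Sum>\<delta>\<in>\<Delta>. Lp_integral p (D (\<alpha> + \<delta>)))"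
    by (rule sobolev[OF p, where 'a = 'a]) (rule that)
  have "\<forall>\<delta>\<in>\<Delta>. \<exists>B\<ge>0. \<forall>\<beta>\<in>S. Lp_integral p (D (join_index (\<alpha> + \<delta>) \<beta>)) \<le> ennreal ((B * \<kappa> \<beta>) powr p)"
    using H multi_indices_add[OF \<alpha>] \<Delta> by auto
  then obtain B where B: "\<And>\<delta>. \<delta> \<in> \<Delta> \<Longrightarrow> 0 \<le> B \<delta>"
    "\<And>\<delta> \<beta>. \<delta> \<in> \<Delta> \<Longrightarrow> \<beta> \<in> S \<Longrightarrow> Lp_integral p (D (join_index (\<alpha> + \<delta>) \<beta>)) \<le> ennreal ((B \<delta> * \<kappa> \<beta>) powr p)"
    by metis
  \<comment> \<open>Chosen so that \<open>C\<close> times the sum of the powers of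
    \<open>B \<delta> * \<kappa> \<beta>\<close> equals the p-th power of
    \<open>E powr (1 / p) * \<kappa> \<beta>\<close>.\<close>
  define E where "E = C * (\<Sum>\<delta>\<in>\<Delta>. B \<delta> powr p)"
  have E: "0 \<le> E" unfolding E_def using C by (intro mult_nonneg_nonneg sum_nonneg) auto
  have "Lp_integral p (\<lambda>y. D (join_index \<alpha> \<beta>) (x, y)) \<le> ennreal ((E powr (1 / p) * \<kappa> \<beta>) powr p)"
      if \<beta>: "\<beta> \<in> S" for \<beta> x
  proof -
    have \<beta>': "\<beta> \<in> multi_indices" using \<beta> S by auto
    have meas: "D (join_index (\<alpha> + \<delta>) \<beta>) \<in> borel_measurable borel" if "\<delta> \<in> \<Delta>" for \<delta>
      by (rule scalar_family_D(2)[OF D]) (use that \<Delta> \<alpha> \<beta>'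
          in \<open>auto intro!: join_index_multi_indices multi_indices_add\<close>)
    have "Lp_integral p (\<lambda>y. D (join_index \<alpha> \<beta>) (x, y))
      \<le> (\<integral>\<^sup>+y. ennreal C * (\<Sum>\<delta>\<in>\<Delta>. Lp_integral p (\<lambda>x'. D (join_index (\<alpha> + \<delta>) \<beta>) (x', y))) \<partial>lborel)"
      unfolding Lp_integral_def[of p "\<lambda>y. D (join_index \<alpha> \<beta>) (x, y)"]
      using sob[OF slice_family_fst[OF D \<beta>'] \<alpha>] by (intro nn_integral_mono) auto
    also have "\<dots> = ennreal C * (\<Sum>\<delta>\<in>\<Delta>. Lp_integral p (D (join_index (\<alpha> + \<delta>) \<beta>)))"
      using Lp_integral_slice_measurable(2)[OF meas]
      by (subst nn_integral_cmult) (auto simp: nn_integral_sum Lp_integral_prod(2)[OF meas])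
    also have "\<dots> \<le> ennreal C * (\<Sum>\<delta>\<in>\<Delta>. ennreal ((B \<delta> * \<kappa> \<beta>) powr p))"
      by (intro mult_left_mono sum_mono B \<beta>) auto
    also have "\<dots> = ennreal (C * (\<Sum>\<delta>\<in>\<Delta>. (B \<delta> * \<kappa> \<beta>) powr p))"
      using C by (simp add: ennreal_mult' sum_nonneg)
    also have "(\<Sum>\<delta>\<in>\<Delta>. (B \<delta> * \<kappa> \<beta>) powr p) = (\<Sum>\<delta>\<in>\<Delta>. B \<delta> powr p) * \<kappa> \<beta> powr p"
      by (simp add: powr_mult sum_distrib_right)
    also have "C * ((\<Sum>\<delta>\<in>\<Delta>. B \<delta> powr p) * \<kappa> \<beta> powr p) = (E powr (1 / p) * \<kappa> \<beta>) powr p"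
      using E p by (simp add: powr_mult powr_powr) (simp add: E_def mult.assoc)
    finally show ?thesis .
  qed
  then show ?thesis by (intro exI[of _ "E powr (1 / p)"]) auto
qed

lemma limitin_seminorm_topology_bound:
  assumes V: "subspace V" and P: "\<And>s. s \<in> P \<Longrightarrow> seminorm_on V s"
    and mem: "l \<in> V" "\<And>t. f t \<in> V"
    and bd: "\<And>s. s \<in> P \<Longrightarrow> \<exists>e. (\<forall>\<^sub>F t in F. s (f t - l) \<le> e t) \<and> (e \<longlongrightarrow> 0) F"
  shows "limitin (seminorm_topology V P) f l F"
proof (subst limitin_seminorm_topology[OF V P]; (intro conjI ballI)?)
  fix s assume s: "s \<in> P"
  obtain e where e: "\<forall>\<^sub>F t in F. s (f t - l) \<le> e t" "(e \<longlongrightarrow> 0) F" using bd[OF s] by auto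
  have nn: "0 \<le> s (f t - l)" for t
    using seminorm_onD(1)[OF P[OF s] V] subspace_diff[OF V] mem by auto
  show "((\<lambda>x. s (f x - l)) \<longlongrightarrow> 0) F"
    by (rule Lim_null_comparison[OF _ e(2)]) (use e(1) nn in \<open>auto elim: eventually_mono\<close>)
qed (use mem in auto)

lemma atin_euclidean: "atin euclidean x = at x"
  by (rule filter_eqI) (auto simp: eventually_atin eventually_at_topological)

text \<open>One argument for all function spaces. Each seminorm \<open>s i\<close> is only required
  to be controlled by bounds \<open>c * \<kappa> i \<beta>\<close> on the derivatives with
  \<open>\<beta>\<close> in \<open>S i\<close>. For \<open>W_inf\<close> the sets are singletons
  with unit weight; for \<open>W_step\<close> there is one seminorm, all indices, and the weight of
  the space.\<close>

lemma forward_family: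
  fixes f :: "'a::euclidean_space \<times> 'b::euclidean_space \<Rightarrow> real"
    and s :: "'i \<Rightarrow> ('b \<Rightarrow> real) \<Rightarrow> real" and S :: "'i \<Rightarrow> ('b \<Rightarrow> nat) set"
        and \<kappa> :: "'i \<Rightarrow> ('b \<Rightarrow> nat) \<Rightarrow> real"
  assumes p: "1 \<le> p" and D: "scalar_family f D" and V: "subspace V"
    and sn: "\<And>i. i \<in> I \<Longrightarrow> seminorm_on V (s i)"
    and V_mem: "\<And>h. smooth h \<Longrightarrow> (\<And>i. i \<in> I \<Longrightarrow> \<exists>c\<ge>0. \<forall>\<beta>\<in>S i. pd_norm p \<beta> h \<le> ennreal (c * \<kappa> i \<beta>)) \<Longrightarrow>
        h \<in> V"
    and s_le: "\<And>i h c. i \<in> I \<Longrightarrow> h \<in> V \<Longrightarrow> 0 \<le> c \<Longrightarrow> (\<And>\<beta>. \<beta> \<in> S i \<Longrightarrow>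
        pd_norm p \<beta> h \<le> ennreal (c * \<kappa> i \<beta>)) \<Longrightarrow> s i h \<le> c"
    and S: "\<And>i. i \<in> I \<Longrightarrow> S i \<subseteq> multi_indices" and \<kappa>: "\<And>i \<beta>. i \<in> I \<Longrightarrow> \<beta> \<in> S i \<Longrightarrow> 0 \<le> \<kappa> i \<beta>"
    and H: "\<And>i \<alpha>. i \<in> I \<Longrightarrow> \<alpha> \<in> multi_indices \<Longrightarrow>
      \<exists>B\<ge>0. \<forall>\<beta>\<in>S i. Lp_integral p (D (join_index \<alpha> \<beta>)) \<le> ennreal ((B * \<kappa> i \<beta>) powr p)"
  shows "derivative_family (seminorm_topology V (s ` I)) (\<lambda>x y. f (x, y)) (\<lambda>\<alpha> x y. D (join_index \<alpha>
      (\<lambda>_. 0)) (x, y))"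
proof -
  define G where "G \<alpha> x = (\<lambda>y. D (join_index \<alpha> (\<lambda>_. 0)) (x, y))" for \<alpha> x
  have G_smooth: "smooth (G \<alpha> x)" if "\<alpha> \<in> multi_indices" for \<alpha> x
    unfolding G_def by (rule slice_smooth(1)[OF D that])
  have pd_G: "pd (G \<alpha> x) \<beta> = (\<lambda>y. D (join_index \<alpha> \<beta>) (x, y))" if "\<alpha> \<in> multi_indices"
      "\<beta> \<in> multi_indices" for \<alpha> \<beta> x
    unfolding G_def by (rule slice_smooth(2)[OF D that])
  have meas: "(\<lambda>y. D (join_index \<alpha> \<beta>) (x, y)) \<in> borel_measurable borel"
    if "\<alpha> \<in> multi_indices" "\<beta> \<in> multi_indices" for \<alpha> \<beta> x
    unfolding pd_G[OF that, symmetric] by (rule pd_measurable[OF G_smooth that(2)]) (rule that)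
  have Bex: "\<exists>B\<ge>0. \<forall>\<beta>\<in>S i. \<forall>x. Lp_integral p (\<lambda>y. D (join_index \<alpha> \<beta>) (x, y))
      \<le> ennreal ((B * \<kappa> i \<beta>) powr p)"
    if "i \<in> I" "\<alpha> \<in> multi_indices" for i \<alpha>
    by (rule slice_bound[OF p D S \<kappa> H \<open>\<alpha> \<in> multi_indices\<close>]) (use that in auto)
  \<comment> \<open>One constant for all \<open>\<beta>\<close> and all \<open>x\<close>: uniformity
    in \<open>\<beta>\<close> turns the estimates into bounds on \<open>s i\<close>, uniformity in
    \<open>x\<close> makes them usable along segments.\<close>
  define B where "B i \<alpha> = (SOME B. 0 \<le> B \<and> (\<forall>\<beta>\<in>S i. \<forall>x. Lp_integral p
      (\<lambda>y. D (join_index \<alpha> \<beta>) (x, y)) \<le> ennreal ((B * \<kappa> i \<beta>) powr p)))" for i \<alpha>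
  have B: "0 \<le> B i \<alpha>" "\<And>\<beta> x. \<beta> \<in> S i \<Longrightarrow> Lp_integral p (\<lambda>y. D (join_index \<alpha> \<beta>) (x, y))
      \<le> ennreal ((B i \<alpha> * \<kappa> i \<beta>) powr p)"
    if "i \<in> I" "\<alpha> \<in> multi_indices" for i \<alpha>
    using someI_ex[OF Bex[OF that]] unfolding B_def[symmetric] by auto
  have G_mem: "G \<alpha> x \<in> V" if \<alpha>: "\<alpha> \<in> multi_indices" for \<alpha> x
  proof (rule V_mem[OF G_smooth[OF \<alpha>]])
    fix i assume i: "i \<in> I"
    have "pd_norm p \<beta> (G \<alpha> x) \<le> ennreal (B i \<alpha> * \<kappa> i \<beta>)" if \<beta>: "\<beta> \<in> S i" for \<beta>
    proof -
      have \<beta>': "\<beta> \<in> multi_indices" using S[OF i] \<beta> by auto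
      show ?thesis
        unfolding pd_norm_def pd_G[OF \<alpha> \<beta>']
        using B[OF i \<alpha>] \<beta> \<kappa>[OF i \<beta>] by (subst Lp_norm_le_iff[OF p meas[OF \<alpha> \<beta>']]) auto
    qed
    then show "\<exists>c\<ge>0. \<forall>\<beta>\<in>S i. pd_norm p \<beta> (G \<alpha> x) \<le> ennreal (c * \<kappa> i \<beta>)"
      using B(1)[OF i \<alpha>] by auto
  qed
  let ?u = "\<lambda>\<alpha> b. \<alpha>(b := Suc (\<alpha> b)) :: 'a \<Rightarrow> nat"
  have der: "((\<lambda>t. D (join_index \<alpha> \<beta>) (x + t *\<^sub>R b, y)) has_real_derivative D (join_index (?u \<alpha> b)
      \<beta>) (x + t *\<^sub>R b, y)) (at t)"
    if "\<alpha> \<in> multi_indices" "\<beta> \<in> multi_indices" "b \<in> Basis" for \<alpha> \<beta> b x y t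
    using scalar_family_D(3)[OF slice_family_fst[OF D that(2)] that(1,3)] .
  have cont: "continuous_on UNIV (\<lambda>z. D (join_index \<alpha> \<beta>) (x + fst z *\<^sub>R b, snd z))"
    if "\<alpha> \<in> multi_indices" "\<beta> \<in> multi_indices" for \<alpha> \<beta> b x
    by (rule continuous_on_compose2[OF scalar_family_D(1)[OF D join_index_multi_indices[OF that]]])
      (auto intro!: continuous_intros)
  \<comment> \<open>The bound for the raised index holds at every point, hence along the whole
    segment from \<open>x\<close> to \<open>x + t *\<^sub>R b\<close>, and yields a Lipschitz
    estimate in the mean.\<close>
  have lip0: "Lp_integral p (\<lambda>y. D (join_index \<alpha> \<beta>) (x + t *\<^sub>R b, y) - D (join_index \<alpha> \<beta>) (x, y))
      \<le> ennreal ((\<bar>t\<bar> * (B i (?u \<alpha> b) * \<kappa> i \<beta>)) powr p)"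
    if i: "i \<in> I" and \<alpha>: "\<alpha> \<in> multi_indices" and b: "b \<in> Basis" and \<beta>: "\<beta> \<in> S i" for i \<alpha> b \<beta> x t
  proof -
    have \<beta>': "\<beta> \<in> multi_indices" using S[OF i] \<beta> by auto
    note u = multi_indices_upd[OF \<alpha> b, of "Suc (\<alpha> b)"]
    have "Lp_integral p (\<lambda>y. D (join_index \<alpha> \<beta>) (x + t *\<^sub>R b, y) - D (join_index \<alpha> \<beta>) (x + 0 *\<^sub>R
        b, y)) \<le> ennreal ((\<bar>t\<bar> * (B i (?u \<alpha> b) * \<kappa> i \<beta>)) powr p)"
    proof (rule Lp_integral_increment_le[OF p der[OF \<alpha> \<beta>' b] cont[OF u \<beta>']])
      show "0 \<le> B i (?u \<alpha> b) * \<kappa> i \<beta>" using B(1)[OF i u] \<kappa>[OF i \<beta>] by simp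
    qed (rule B(2)[OF i u \<beta>])
    then show ?thesis by simp
  qed
  have lip: "s i (G \<alpha> (x + t *\<^sub>R b) - G \<alpha> x) \<le> \<bar>t\<bar> * B i (?u \<alpha> b)"
    if i: "i \<in> I" and \<alpha>: "\<alpha> \<in> multi_indices" and b: "b \<in> Basis" for i \<alpha> b x t
  proof (rule s_le[OF i subspace_diff[OF V G_mem[OF \<alpha>] G_mem[OF \<alpha>]]])
    show "0 \<le> \<bar>t\<bar> * B i (?u \<alpha> b)" using B(1)[OF i multi_indices_upd[OF \<alpha> b]] by simp
    fix \<beta> assume \<beta>: "\<beta> \<in> S i"
    have \<beta>': "\<beta> \<in> multi_indices" using S[OF i] \<beta> by auto
    have eq: "pd (G \<alpha> (x + t *\<^sub>R b) - G \<alpha> x) \<beta> = (\<lambda>y. D (join_index \<alpha> \<beta>) (x + t *\<^sub>R b, y) - D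
        (join_index \<alpha> \<beta>) (x, y))"
      unfolding pd_diff[OF G_smooth[OF \<alpha>] G_smooth[OF \<alpha>] \<beta>'] pd_G[OF \<alpha> \<beta>']
          by (simp add: fun_diff_def)
    show "pd_norm p \<beta> (G \<alpha> (x + t *\<^sub>R b) - G \<alpha> x) \<le> ennreal (\<bar>t\<bar> * B i (?u \<alpha> b) * \<kappa> i \<beta>)"
      unfolding pd_norm_def eq
      using lip0[OF i \<alpha> b \<beta>] B(1)[OF i multi_indices_upd[OF \<alpha> b]] \<kappa>[OF i \<beta>] meas[OF \<alpha> \<beta>']
      by (subst Lp_norm_le_iff[OF p]) (auto simp: mult.assoc)
  qed
  have quot: "s i ((1 / t) *\<^sub>R (G \<alpha> (x + t *\<^sub>R b) - G \<alpha> x) - G (?u \<alpha> b) x)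
      \<le> \<bar>t\<bar> * B i (?u (?u \<alpha> b) b)"
    if i: "i \<in> I" and \<alpha>: "\<alpha> \<in> multi_indices" and b: "b \<in> Basis" and t: "t \<noteq> 0" for i \<alpha> b x t
  proof (rule s_le[OF i subspace_diff[OF V subspace_scale[OF V subspace_diff[OF V G_mem[OF \<alpha>]
      G_mem[OF \<alpha>]]] G_mem[OF multi_indices_upd[OF \<alpha> b]]]])
    note u = multi_indices_upd[OF \<alpha> b, of "Suc (\<alpha> b)"]
    note uu = multi_indices_upd[OF u b, of "Suc ((?u \<alpha> b) b)"]
    show "0 \<le> \<bar>t\<bar> * B i (?u (?u \<alpha> b) b)" using B(1)[OF i uu] by simp
    fix \<beta> assume \<beta>: "\<beta> \<in> S i"
    have \<beta>': "\<beta> \<in> multi_indices" using S[OF i] \<beta> by auto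
    let ?k = "B i (?u (?u \<alpha> b) b) * \<kappa> i \<beta>"
    have k: "0 \<le> ?k" using B(1)[OF i uu] \<kappa>[OF i \<beta>] by simp
    \<comment> \<open>With the linear part subtracted, the derivative of \<open>h\<close> in
      \<open>r\<close> is an increment of the next derivative and thus of size |t| by
      \<open>lip0\<close>. The increment of \<open>h\<close> is then quadratic in \<open>t\<close>,
      and division by \<open>t\<close> leaves a linear error.\<close>
    define h where "h r y = D (join_index \<alpha> \<beta>) (x + r *\<^sub>R b, y) - r * D (join_index (?u \<alpha> b) \<beta>)
        (x, y)" for r y
    have "Lp_integral p (\<lambda>y. h t y - h 0 y) \<le> ennreal ((\<bar>t\<bar> * (\<bar>t\<bar> * ?k)) powr p)"
    proof (rule Lp_integral_increment_le[OF p])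
      show "((\<lambda>r. h r y) has_real_derivative D (join_index (?u \<alpha> b) \<beta>) (x + r *\<^sub>R b, y) - D
          (join_index (?u \<alpha> b) \<beta>) (x, y)) (at r)" for r y
        unfolding h_def by (rule derivative_eq_intros der[OF \<alpha> \<beta>' b] refl)+ simp
      show "continuous_on UNIV (\<lambda>z. D (join_index (?u \<alpha> b) \<beta>) (x + fst z *\<^sub>R b, snd z) - D
          (join_index (?u \<alpha> b) \<beta>) (x, snd z))"
        using cont[OF u \<beta>', of x b] cont[OF u \<beta>', of x 0] by (auto intro: continuous_on_diff)
      show "0 \<le> \<bar>t\<bar> * ?k" using k by simp
      fix r :: real assume r: "\<bar>r\<bar> \<le> \<bar>t\<bar>"
      have "Lp_integral p (\<lambda>y. D (join_index (?u \<alpha> b) \<beta>) (x + r *\<^sub>R b, y) - D (join_index (?u \<alpha> b)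
          \<beta>) (x, y)) \<le> ennreal ((\<bar>r\<bar> * ?k) powr p)"
        by (rule lip0[OF i u b \<beta>])
      also have "\<dots> \<le> ennreal ((\<bar>t\<bar> * ?k) powr p)"
        using r k p by (intro ennreal_leI powr_mono2 mult_right_mono) auto
      finally show "Lp_integral p (\<lambda>y. D (join_index (?u \<alpha> b) \<beta>) (x + r *\<^sub>R b, y) - D (join_index
          (?u \<alpha> b) \<beta>) (x, y)) \<le> ennreal ((\<bar>t\<bar> * ?k) powr p)" .
    qed
    moreover have hm: "(\<lambda>y. h t y - h 0 y) \<in> borel_measurable borel"
      unfolding h_def using meas[OF \<alpha> \<beta>'] meas[OF u \<beta>'] by simp
    ultimately have hle: "Lp_norm p (\<lambda>y. h t y - h 0 y) \<le> ennreal (\<bar>t\<bar> * (\<bar>t\<bar> * ?k))"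
      using k by (subst Lp_norm_le_iff[OF p]) auto
    have eq: "pd ((1 / t) *\<^sub>R (G \<alpha> (x + t *\<^sub>R b) - G \<alpha> x) - G (?u \<alpha> b) x) \<beta> =
        (\<lambda>y. (1 / t) * (h t y - h 0 y))"
      unfolding pd_diff[OF smooth_scale[OF smooth_diff[OF G_smooth[OF \<alpha>] G_smooth[OF \<alpha>]]]
          G_smooth[OF u] \<beta>']
        pd_scale[OF smooth_diff[OF G_smooth[OF \<alpha>] G_smooth[OF \<alpha>]] \<beta>']
        pd_diff[OF G_smooth[OF \<alpha>] G_smooth[OF \<alpha>] \<beta>'] pd_G[OF \<alpha> \<beta>'] pd_G[OF u \<beta>']
      using t by (simp add: fun_diff_def scaleR_fun_def h_def field_simps)
    have "pd_norm p \<beta> ((1 / t) *\<^sub>R (G \<alpha> (x + t *\<^sub>R b) - G \<alpha> x) - G (?u \<alpha> b) x)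
        = ennreal \<bar>1 / t\<bar> * Lp_norm p (\<lambda>y. h t y - h 0 y)"
      unfolding pd_norm_def eq by (rule Lp_norm_scale[OF p])
    also have "\<dots> \<le> ennreal \<bar>1 / t\<bar> * ennreal (\<bar>t\<bar> * (\<bar>t\<bar> * ?k))"
      by (intro mult_left_mono hle) simp
    also have "\<dots> = ennreal (\<bar>1 / t\<bar> * (\<bar>t\<bar> * (\<bar>t\<bar> * ?k)))" by (rule ennreal_mult'[symmetric]) simp
    also have "\<bar>1 / t\<bar> * (\<bar>t\<bar> * (\<bar>t\<bar> * ?k)) = \<bar>t\<bar> * B i (?u (?u \<alpha> b) b) * \<kappa> i \<beta>" using t by simp
    finally show "pd_norm p \<beta> ((1 / t) *\<^sub>R (G \<alpha> (x + t *\<^sub>R b) - G \<alpha> x) - G (?u \<alpha> b) x)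
        \<le> ennreal (\<bar>t\<bar> * B i (?u (?u \<alpha> b) b) * \<kappa> i \<beta>)" .
  qed
  \<comment> \<open>The Lipschitz estimate is available along basis vectors only, so a general
    increment is split into coordinate moves.\<close>
  have tele: "s i (G \<alpha> (x + (\<Sum>b\<in>J. v b *\<^sub>R b)) - G \<alpha> x) \<le> (\<Sum>b\<in>J. \<bar>v b\<bar> * B i (?u \<alpha> b))"
    if i: "i \<in> I" and \<alpha>: "\<alpha> \<in> multi_indices" and J: "finite J" "J \<subseteq> Basis" for i \<alpha> J v x
    using J
  proof (induction J rule: finite_induct)
    case empty
    then show ?case using seminorm_onD(4)[OF sn[OF i] V] by (simp add: zero_fun_def)
  next
    case (insert b J)
    let ?x = "x + (\<Sum>b\<in>J. v b *\<^sub>R b)"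
    have eq: "x + (\<Sum>b\<in>insert b J. v b *\<^sub>R b) = ?x + v b *\<^sub>R b" using insert
        by (simp add: add.commute add.left_commute)
    have "s i (G \<alpha> (?x + v b *\<^sub>R b) - G \<alpha> x) \<le> s i (G \<alpha> (?x + v b *\<^sub>R b) - G \<alpha> ?x) + s i (G \<alpha> ?x -
        G \<alpha> x)"
      by (intro seminorm_onD(5)[OF sn[OF i] V] G_mem \<alpha>)
    also have "\<dots> \<le> \<bar>v b\<bar> * B i (?u \<alpha> b) + (\<Sum>b\<in>J. \<bar>v b\<bar> * B i (?u \<alpha> b))"
      using insert by (intro add_mono lip[OF i \<alpha>] insert.IH) auto
    also have "\<dots> = (\<Sum>b\<in>insert b J. \<bar>v b\<bar> * B i (?u \<alpha> b))"
      by (rule sum.insert[symmetric]) (use insert in auto)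
    finally show ?case unfolding eq .
  qed
  have "derivative_family (seminorm_topology V (s ` I)) (\<lambda>x y. f (x, y)) G"
    unfolding derivative_family_def
  proof (intro conjI ballI)
    show "G (\<lambda>_. 0) = (\<lambda>x y. f (x, y))"
      unfolding G_def join_index_zero using derivative_familyD(1)[OF D] by simp
    fix \<alpha> :: "'a \<Rightarrow> nat" assume \<alpha>: "\<alpha> \<in> multi_indices"
    show "continuous_map euclidean (seminorm_topology V (s ` I)) (G \<alpha>)"
    proof (rule continuous_map_atinI)
      fix x :: 'a assume "x \<in> topspace euclidean"
      show "limitin (seminorm_topology V (s ` I)) (G \<alpha>) (G \<alpha> x) (atin euclidean x)"
        unfolding atin_euclidean
      proof (rule limitin_seminorm_topology_bound[OF V])
        fix si assume "si \<in> s ` I"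
        then obtain i where i: "i \<in> I" "si = s i" by auto
        let ?e = "\<lambda>z. (\<Sum>b\<in>Basis. \<bar>(z - x) \<bullet> b\<bar> * B i (?u \<alpha> b))"
        have "si (G \<alpha> z - G \<alpha> x) \<le> ?e z" for z
          using tele[OF i(1) \<alpha> finite_Basis order_refl, of x "\<lambda>b. (z - x) \<bullet> b"] i(2)
          by (simp add: euclidean_representation)
        moreover have "(?e \<longlongrightarrow> (\<Sum>b\<in>Basis. \<bar>(x - x) \<bullet> b\<bar> * B i (?u \<alpha> b))) (at x)"
          by (intro tendsto_intros)
        then have "(?e \<longlongrightarrow> 0) (at x)" by simp
        ultimately show "\<exists>e. (\<forall>\<^sub>F z in at x. si (G \<alpha> z - G \<alpha> x) \<le> e z) \<and> (e \<longlongrightarrow> 0) (at x)"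
          by (intro exI[of _ ?e]) auto
      qed (use sn G_mem \<alpha> in auto)
    qed
    fix b :: 'a assume b: "b \<in> Basis"
    show "has_partial_derivative (seminorm_topology V (s ` I)) (G \<alpha>) b (G (?u \<alpha> b))"
      unfolding has_partial_derivative_def
    proof (intro allI limitin_seminorm_topology_bound[OF V])
      fix x si assume "si \<in> s ` I"
      then obtain i where i: "i \<in> I" "si = s i" by auto
      let ?e = "\<lambda>t. \<bar>t\<bar> * B i (?u (?u \<alpha> b) b)"
      have "\<forall>\<^sub>F t in at 0. si ((1 / t) *\<^sub>R (G \<alpha> (x + t *\<^sub>R b) - G \<alpha> x) - G (?u \<alpha> b) x) \<le> ?e t"
        unfolding i(2) eventually_at_filter using quot[OF i(1) \<alpha> b]
            by (intro always_eventually) auto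
      moreover have "(?e \<longlongrightarrow> \<bar>0\<bar> * B i (?u (?u \<alpha> b) b)) (at 0)" by (intro tendsto_intros)
      then have "(?e \<longlongrightarrow> 0) (at 0)" by simp
      ultimately show "\<exists>e. (\<forall>\<^sub>F t in at 0. si ((1 / t) *\<^sub>R (G \<alpha> (x + t *\<^sub>R b) - G \<alpha> x) - G (?u \<alpha>
          b) x) \<le> e t) \<and> (e \<longlongrightarrow> 0) (at 0)"
        by (intro exI[of _ ?e] conjI)
    qed (use sn G_mem \<alpha> multi_indices_upd[OF \<alpha> b] subspace_scale[OF V] subspace_diff[OF V] in auto)
  qed
  then show ?thesis unfolding G_def[abs_def] .
qed

section \<open>From curried to joint smoothness\<close>

lemma W_inf_D:
  assumes "h \<in> topspace (W_inf p)"
  shows "smooth h" "\<alpha> \<in> multi_indices \<Longrightarrow> pd_norm p \<alpha> h < \<infinity>"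
  using assms by (auto simp: topspace_W_inf)

lemma Lp_integral_pd_pd_seminorm:
  assumes "1 \<le> p" "h \<in> topspace (W_inf p)" "\<alpha> \<in> multi_indices"
  shows "Lp_integral p (pd h \<alpha>) = ennreal (pd_seminorm p \<alpha> h powr p)"
  unfolding pd_seminorm_def by (rule pd_norm_power) (use assms W_inf_D in auto)

lemma pd_seminorm_nonneg [simp]: "0 \<le> pd_seminorm p \<alpha> h"
  by (simp add: pd_seminorm_def)

text \<open>Sobolev's inequality in terms of seminorms, uniform in the point. Each of the
  \<open>card \<Delta>\<close> terms is at most the p-th power of the whole sum, which explains the
  constant \<open>(C * real (card \<Delta>)) powr (1 / p)\<close>.\<close>

lemma pd_pointwise_bound:
  assumes p: "1 \<le> p" and \<beta>: "\<beta> \<in> multi_indices"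
  obtains \<Delta> C where "finite \<Delta>" "\<Delta> \<subseteq> multi_indices" "0 \<le> C"
    "\<And>(h :: 'b::euclidean_space \<Rightarrow> real) y. h \<in> topspace (W_inf p) \<Longrightarrow>
      \<bar>pd h \<beta> y\<bar> \<le> C * (\<Sum>\<delta>\<in>\<Delta>. pd_seminorm p \<delta> h)"
proof -
  obtain \<Delta> :: "('b \<Rightarrow> nat) set" and C where \<Delta>: "finite \<Delta>" "\<Delta> \<subseteq> multi_indices" and C: "0 \<le> C"
    and sob: "\<And>f D \<alpha> x. scalar_family f D \<Longrightarrow> \<alpha> \<in> multi_indices \<Longrightarrow>
      ennreal (\<bar>D \<alpha> x\<bar> powr p) \<le> ennreal C * (\<Sum>\<delta>\<in>\<Delta>. Lp_integral p (D (\<alpha> + \<delta>)))"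
    by (rule sobolev[OF p, where 'a = 'b]) (rule that)
  let ?\<Delta> = "(\<lambda>\<delta>. \<beta> + \<delta>) ` \<Delta>"
  have sub: "?\<Delta> \<subseteq> multi_indices" using \<Delta> \<beta> by (auto intro!: multi_indices_add)
  have inj: "inj_on (\<lambda>\<delta>. \<beta> + \<delta>) \<Delta>" by (auto simp: inj_on_def fun_eq_iff)
  have "\<bar>pd h \<beta> y\<bar> \<le> (C * real (card \<Delta>)) powr (1 / p) * (\<Sum>\<delta>\<in>?\<Delta>. pd_seminorm p \<delta> h)"
      if h: "h \<in> topspace (W_inf p)" for h y
  proof -
    let ?s = "\<Sum>\<delta>\<in>?\<Delta>. pd_seminorm p \<delta> h"
    have s: "0 \<le> ?s" by (intro sum_nonneg) auto
    have "ennreal (\<bar>pd h \<beta> y\<bar> powr p) \<le> ennreal C * (\<Sum>\<delta>\<in>\<Delta>. Lp_integral p (pd h (\<beta> + \<delta>)))"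
      by (rule sob[OF pd_family[OF W_inf_D(1)[OF h]] \<beta>])
    also have "\<dots> \<le> ennreal C * (\<Sum>\<delta>\<in>\<Delta>. ennreal (?s powr p))"
    proof (intro mult_left_mono sum_mono)
      fix \<delta> assume \<delta>: "\<delta> \<in> \<Delta>"
      have "pd_seminorm p (\<beta> + \<delta>) h \<le> ?s" using \<delta> \<Delta>
        by (intro member_le_sum[of "\<beta> + \<delta>" ?\<Delta> "\<lambda>\<delta>. pd_seminorm p \<delta> h"]) auto
      moreover have "\<beta> + \<delta> \<in> multi_indices" using sub \<delta> by auto
      ultimately show "Lp_integral p (pd h (\<beta> + \<delta>)) \<le> ennreal (?s powr p)"
        using p
            by (simp add: Lp_integral_pd_pd_seminorm[OF p h]) (intro ennreal_leI powr_mono2, auto)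
    qed simp
    also have "\<dots> = ennreal (C * real (card \<Delta>) * ?s powr p)"
      using C by (simp add: ennreal_mult' ennreal_of_nat_eq_real_of_nat mult.assoc)
    finally have "\<bar>pd h \<beta> y\<bar> powr p \<le> C * real (card \<Delta>) * ?s powr p"
      using C s by (subst (asm) ennreal_le_iff) auto
    also have "\<dots> = ((C * real (card \<Delta>)) powr (1 / p) * ?s) powr p"
      using p C s by (simp add: powr_mult powr_powr)
    finally show ?thesis
      using p s powr_less_mono2[of p "(C * real (card \<Delta>)) powr (1 / p) * ?s" "\<bar>pd h \<beta> y\<bar>"]
      by (auto simp: not_le[symmetric])
  qed
  with finite_imageI[OF \<Delta>(1)] sub powr_ge_zero show ?thesis by (rule that)
qed

lemma tendsto_pd_seminorm_sum_zero:
  assumes "finite \<Delta>" "\<And>\<delta>. \<delta> \<in> \<Delta> \<Longrightarrow> ((\<lambda>t. pd_seminorm p \<delta> (u t)) \<longlongrightarrow> 0) F"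
  shows "((\<lambda>t. C * (\<Sum>\<delta>\<in>\<Delta>. pd_seminorm p \<delta> (u t))) \<longlongrightarrow> 0) F"
  by (rule tendsto_mult_right_zero[OF tendsto_null_sum]) (rule assms(2))

lemma limitin_W_inf_pointwise:
  assumes p: "1 \<le> p" and lim: "limitin (W_inf p) u l F" and \<beta>: "\<beta> \<in> multi_indices"
  shows "((\<lambda>t. pd (u t) \<beta> y) \<longlongrightarrow> pd l \<beta> y) F"
proof -
  obtain \<Delta> C where \<Delta>: "finite \<Delta>" "\<Delta> \<subseteq> multi_indices" and
    bd: "\<And>h y. h \<in> topspace (W_inf p) \<Longrightarrow> \<bar>pd h \<beta> y\<bar> \<le> C * (\<Sum>\<delta>\<in>\<Delta>. pd_seminorm p \<delta> h)"
    by (rule pd_pointwise_bound[OF p \<beta>]) (rule that)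
  note L = lim[unfolded limitin_W_inf[OF p]]
  have "((\<lambda>t. pd (u t) \<beta> y - pd l \<beta> y) \<longlongrightarrow> 0) F"
  proof (rule Lim_null_comparison[OF _ tendsto_pd_seminorm_sum_zero[OF \<Delta>(1), of p "\<lambda>t. u t - l"
      F C]])
    have "\<forall>\<^sub>F t in F. u t \<in> topspace (W_inf p)" using L by simp
    then show "\<forall>\<^sub>F t in F. norm (pd (u t) \<beta> y - pd l \<beta> y) \<le> C * (\<Sum>\<delta>\<in>\<Delta>. pd_seminorm p \<delta> (u t - l))"
    proof eventually_elim
      case (elim t)
      then have "u t - l \<in> topspace (W_inf p)" using L subspace_diff[OF subspace_W_inf[OF p]]
          by blast
      from bd[OF this, of y] show ?case
        using elim L W_inf_D(1) \<beta> by (subst (asm) pd_diff) (auto simp: fun_diff_def)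
    qed
  qed (use L \<Delta> in auto)
  then show ?thesis by (simp add: LIM_zero_iff)
qed

text \<open>Limits in \<open>W_inf\<close> are pointwise limits. This is the source of the
  uniqueness that identifies families of derivatives with \<open>partial_deriv\<close>.\<close>

lemma limitin_W_inf_unique:
  assumes "1 \<le> p" "F \<noteq> bot" "limitin (W_inf p) u l F" "limitin (W_inf p) u l' F"
  shows "l = l'"
proof
  fix y
  have "smooth l" "smooth l'" by (rule W_inf_D(1)[OF limitin_topspace[OF assms(3)]])
      (rule W_inf_D(1)[OF limitin_topspace[OF assms(4)]])
  then show "l y = l' y"
    using tendsto_unique[OF assms(2) limitin_W_inf_pointwise[OF assms(1,3) multi_indices_zero(2)]
        limitin_W_inf_pointwise[OF assms(1,4) multi_indices_zero(2)], of y]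
    by (simp add: pd_zero)
qed

text \<open>The only possible joint derivatives are the derivatives of the values of
  \<open>G\<close>. In the first variable, convergence of difference quotients in
  \<open>W_inf\<close> is evaluated at a point; in the second, smoothness of each value of
  \<open>G\<close> suffices; joint continuity rests on the bound uniform in
  \<open>y\<close>.\<close>

lemma backward_family:
  fixes f :: "'a::euclidean_space \<times> 'b::euclidean_space \<Rightarrow> real"
  assumes p: "1 \<le> p" and G: "derivative_family (W_inf p) (\<lambda>x y. f (x, y)) G"
  shows "scalar_family f (\<lambda>\<gamma> z. pd (G (\<lambda>u. \<gamma> (u, 0)) (fst z)) (\<lambda>v. \<gamma> (0, v)) (snd z))"
    (is "scalar_family f ?D")
proof -
  have mem: "G \<alpha> x \<in> topspace (W_inf p)" if "\<alpha> \<in> multi_indices" for \<alpha> x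
    by (rule derivative_familyD(4)[OF G that])
  have sm: "smooth (G \<alpha> x)" if "\<alpha> \<in> multi_indices" for \<alpha> x
    by (rule W_inf_D(1)[OF mem[OF that]])
  have "smooth (\<lambda>y. f (x, y))" for x
    using sm[OF multi_indices_zero(2), of x] derivative_familyD(1)[OF G] by simp
  then have D0: "?D (\<lambda>_. 0) = f"
    by (intro ext) (simp add: derivative_familyD(1)[OF G] pd_zero)
  have Dc: "?D (join_index \<alpha> \<beta>) = (\<lambda>z. pd (G \<alpha> (fst z)) \<beta> (snd z))" if "\<alpha> \<in> multi_indices"
      "\<beta> \<in> multi_indices" for \<alpha> \<beta>
    using that by (simp add: join_index_fst join_index_snd)
  have lim: "limitin (W_inf p) (G \<alpha>) (G \<alpha> x) (at x)" if "\<alpha> \<in> multi_indices" for \<alpha> x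
    using derivative_familyD(2)[OF G that] by (simp add: continuous_map_atin atin_euclidean)
  show ?thesis
    unfolding derivative_family_def
  proof (intro conjI ballI)
    fix \<gamma> :: "'a \<times> 'b \<Rightarrow> nat" assume "\<gamma> \<in> multi_indices"
    then obtain \<alpha> \<beta> where \<alpha>: "\<alpha> \<in> multi_indices" and \<beta>: "\<beta> \<in> multi_indices"
        and \<gamma>: "\<gamma> = join_index \<alpha> \<beta>"
      by (rule multi_indices_prodE)
    show "continuous_map euclidean euclideanreal (?D \<gamma>)"
      unfolding \<gamma> Dc[OF \<alpha> \<beta>] continuous_map_iff_continuous2 continuous_on_eq_continuous_at[OF
          open_UNIV]
    proof (intro ballI)
      fix z :: "'a \<times> 'b"
      obtain \<Delta> C where \<Delta>: "finite \<Delta>" "\<Delta> \<subseteq> multi_indices" and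
        bd: "\<And>h y. h \<in> topspace (W_inf p) \<Longrightarrow> \<bar>pd h \<beta> y\<bar> \<le> C * (\<Sum>\<delta>\<in>\<Delta>. pd_seminorm p \<delta> h)"
        by (rule pd_pointwise_bound[OF p \<beta>]) (rule that)
      let ?x = "fst z"
      have "((\<lambda>w. pd_seminorm p \<delta> (G \<alpha> (fst w) - G \<alpha> ?x)) \<longlongrightarrow> 0) (at z)" if \<delta>: "\<delta> \<in> \<Delta>" for \<delta>
      proof -
        \<comment> \<open>The limit at \<open>?x\<close> ignores the point itself, whereas
          \<open>fst w = ?x\<close> is possible for \<open>w\<close> near \<open>z\<close>. The
          value 0 at \<open>?x\<close> upgrades the limit to continuity, which can be composed with
          \<open>fst\<close>.\<close>
        have 0: "pd_seminorm p \<delta> (G \<alpha> ?x - G \<alpha> ?x) = 0"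
          using pd_norm_zero[OF p, of \<delta>] \<delta> \<Delta> by (auto simp: pd_seminorm_def zero_fun_def)
        have "((\<lambda>x. pd_seminorm p \<delta> (G \<alpha> x - G \<alpha> ?x)) \<longlongrightarrow> 0) (at ?x)"
          using lim[OF \<alpha>, of ?x] \<delta> \<Delta> unfolding limitin_W_inf[OF p] by auto
        then have c: "isCont (\<lambda>x. pd_seminorm p \<delta> (G \<alpha> x - G \<alpha> ?x)) ?x"
          unfolding isCont_def 0 .
        from isCont_tendsto_compose[OF c tendsto_fst[OF tendsto_ident_at]]
        show ?thesis unfolding 0 .
      qed
      then have t1: "((\<lambda>w. C * (\<Sum>\<delta>\<in>\<Delta>. pd_seminorm p \<delta> (G \<alpha> (fst w) - G \<alpha> ?x))) \<longlongrightarrow> 0) (at z)"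
        by (rule tendsto_pd_seminorm_sum_zero[OF \<Delta>(1)])
      \<comment> \<open>The bound does not depend on the second variable, so it is harmless that
        \<open>snd w\<close> moves together with \<open>fst w\<close>; what remains is continuity of
        one fixed function.\<close>
      have t2: "((\<lambda>w. pd (G \<alpha> (fst w)) \<beta> (snd w) - pd (G \<alpha> ?x) \<beta> (snd w)) \<longlongrightarrow> 0) (at z)"
      proof (rule Lim_null_comparison[OF _ t1], intro always_eventually allI)
        fix w :: "'a \<times> 'b"
        have "G \<alpha> (fst w) - G \<alpha> ?x \<in> topspace (W_inf p)"
          by (intro subspace_diff[OF subspace_W_inf[OF p]] mem \<alpha>)
        from bd[OF this, of "snd w"]
        show "norm (pd (G \<alpha> (fst w)) \<beta> (snd w) - pd (G \<alpha> ?x) \<beta> (snd w))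
            \<le> C * (\<Sum>\<delta>\<in>\<Delta>. pd_seminorm p \<delta> (G \<alpha> (fst w) - G \<alpha> ?x))"
          unfolding pd_diff[OF sm[OF \<alpha>] sm[OF \<alpha>] \<beta>] by (simp add: fun_diff_def)
      qed
      have "isCont (pd (G \<alpha> ?x) \<beta>) (snd z)"
        using pd_continuous[OF sm[OF \<alpha>] \<beta>] by (simp add: continuous_on_eq_continuous_at)
      then have "isCont (\<lambda>w. pd (G \<alpha> ?x) \<beta> (snd w)) z"
        by (rule isCont_o2[rotated]) (intro continuous_intros)
      then have "((\<lambda>w. (pd (G \<alpha> (fst w)) \<beta> (snd w) - pd (G \<alpha> ?x) \<beta> (snd w)) + pd (G \<alpha> ?x) \<beta> (snd
          w)) \<longlongrightarrow> 0 + pd (G \<alpha> ?x) \<beta> (snd z)) (at z)"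
        unfolding isCont_def by (intro tendsto_add t2)
      then show "isCont (\<lambda>z. pd (G \<alpha> (fst z)) \<beta> (snd z)) z" unfolding isCont_def by simp
    qed
    fix b :: "'a \<times> 'b" assume "b \<in> Basis"
    then consider u where "u \<in> Basis" "b = (u, 0)" | v where "v \<in> Basis" "b = (0, v)"
      by (auto simp: Basis_prod_def)
    then show "has_partial_derivative euclideanreal (?D \<gamma>) b (?D (\<gamma>(b := Suc (\<gamma> b))))"
    proof cases
      case 1
      note u = multi_indices_upd[OF \<alpha> 1(1), of "Suc (\<alpha> u)"]
      show ?thesis
        unfolding \<gamma> 1(2) join_index_upd_fst[OF 1(1) \<beta>] Dc[OF \<alpha> \<beta>] Dc[OF u \<beta>]
            has_partial_derivative_def limitin_canonical_iff
      proof
        fix z :: "'a \<times> 'b"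
        have "limitin (W_inf p) (\<lambda>t. (1 / t) *\<^sub>R (G \<alpha> (fst z + t *\<^sub>R u) - G \<alpha> (fst z))) (G (\<alpha>(u :=
            Suc (\<alpha> u))) (fst z)) (at 0)"
          using derivative_familyD(3)[OF G \<alpha> 1(1)] unfolding has_partial_derivative_def by blast
        from limitin_W_inf_pointwise[OF p this \<beta>, of "snd z"]
        show "((\<lambda>t. (1 / t) *\<^sub>R (pd (G \<alpha> (fst (z + t *\<^sub>R (u, 0)))) \<beta> (snd (z + t *\<^sub>R (u, 0))) - pd
            (G \<alpha> (fst z)) \<beta> (snd z)))
            \<longlongrightarrow> pd (G (\<alpha>(u := Suc (\<alpha> u))) (fst z)) \<beta> (snd z)) (at 0)"
          unfolding pd_scale[OF smooth_diff[OF sm[OF \<alpha>] sm[OF \<alpha>]] \<beta>] pd_diff[OF sm[OF \<alpha>] sm[OF \<alpha>] \<beta>]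
          by (simp add: scaleR_fun_def fun_diff_def)
      qed
    next
      case 2
      note v = multi_indices_upd[OF \<beta> 2(1), of "Suc (\<beta> v)"]
      show ?thesis
        unfolding \<gamma> 2(2) join_index_upd_snd[OF 2(1) \<alpha>] Dc[OF \<alpha> \<beta>] Dc[OF \<alpha> v]
            has_partial_derivative_def limitin_canonical_iff
      proof
        fix z :: "'a \<times> 'b"
        from derivative_familyD(3)[OF pd_family[OF sm[OF \<alpha>, of "fst z"]] \<beta> 2(1)]
        show "((\<lambda>t. (1 / t) *\<^sub>R (pd (G \<alpha> (fst (z + t *\<^sub>R (0, v)))) \<beta> (snd (z + t *\<^sub>R (0, v))) - pd
            (G \<alpha> (fst z)) \<beta> (snd z)))
            \<longlongrightarrow> pd (G \<alpha> (fst z)) (\<beta>(v := Suc (\<beta> v))) (snd z)) (at 0)"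
          unfolding has_partial_derivative_def limitin_canonical_iff by simp
      qed
    qed
  qed (rule D0)
qed

lemma Lp_norm_cong_Lp_integral:
  assumes "u \<in> borel_measurable borel" "v \<in> borel_measurable borel"
      "Lp_integral p u = Lp_integral p v"
  shows "Lp_norm p u = Lp_norm p v"
  by (rule Lp_norm_cases[OF assms(1), of p]; rule Lp_norm_cases[OF assms(2), of p])
    (use assms(3) in auto)

lemma continuous_seminorm_pd_seminorm_W_inf:
  assumes p: "1 \<le> p" and \<beta>: "\<beta> \<in> multi_indices"
  shows "continuous_seminorm (W_inf p :: ('a::euclidean_space \<Rightarrow> real) topology) (pd_seminorm p \<beta>)"
proof (rule continuous_seminormI[OF subspace_W_inf[OF p] pd_seminorm_seminorm[OF p \<beta> order_refl]])
  fix x :: "'a \<Rightarrow> real" assume "x \<in> topspace (W_inf p)"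
  from limitin_id[OF this] show "((\<lambda>y. pd_seminorm p \<beta> (y - x)) \<longlongrightarrow> 0) (atin (W_inf p) x)"
    unfolding limitin_W_inf[OF p] using \<beta> by blast
qed

lemma continuous_seminorm_comp_measurable:
  assumes "continuous_seminorm T s" "continuous_map euclidean T g"
  shows "(\<lambda>x. s (g x)) \<in> borel_measurable borel"
proof -
  have "continuous_map euclidean euclideanreal (s \<circ> g)"
    using assms(1) unfolding continuous_seminorm_def
    by (intro continuous_map_compose[OF assms(2)]) simp
  then have "continuous_on UNIV (\<lambda>x. s (g x))"
    unfolding continuous_map_iff_continuous2 o_def .
  then show ?thesis by (rule borel_measurable_continuous_onI)
qed

text \<open>The inner integral in Tonelli's formula is a power of
  \<open>pd_seminorm p \<beta>\<close>, so for a single \<open>\<beta>\<close> the joint and the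
  iterated norms agree without loss. Both directions of the exponential laws rest on this.\<close>

lemma pd_norm_curry:
  fixes f :: "'a::euclidean_space \<times> 'b::euclidean_space \<Rightarrow> real"
  assumes p: "1 \<le> p" and G: "derivative_family (W_inf p) (\<lambda>x y. f (x, y)) G"
    and \<alpha>: "\<alpha> \<in> multi_indices" and \<beta>: "\<beta> \<in> multi_indices"
  shows "smooth f" "\<And>x. Lp_integral p (pd (G \<alpha> x) \<beta>) = ennreal (pd_seminorm p \<beta> (G \<alpha> x) powr p)"
    "Lp_integral p (pd f (join_index \<alpha> \<beta>)) = Lp_integral p (\<lambda>x. pd_seminorm p \<beta> (G \<alpha> x))"
    "pd_norm p (join_index \<alpha> \<beta>) f = Lp_norm p (\<lambda>x. pd_seminorm p \<beta> (G \<alpha> x))"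
proof -
  note fam = backward_family[OF p G]
  show sm: "smooth f" by (rule scalar_family_smooth[OF fam])
  have pd: "pd f (join_index \<alpha> \<beta>) = (\<lambda>z. pd (G \<alpha> (fst z)) \<beta> (snd z))"
    unfolding scalar_family_pd[OF fam join_index_multi_indices[OF \<alpha> \<beta>]] using \<alpha> \<beta>
        by (simp add: join_index_fst join_index_snd)
  show I: "Lp_integral p (pd (G \<alpha> x) \<beta>) = ennreal (pd_seminorm p \<beta> (G \<alpha> x) powr p)" for x
    by (rule Lp_integral_pd_pd_seminorm[OF p derivative_familyD(4)[OF G \<alpha>] \<beta>])
  have m: "pd f (join_index \<alpha> \<beta>) \<in> borel_measurable borel"
    by (rule pd_measurable[OF sm join_index_multi_indices[OF \<alpha> \<beta>]])
  have "Lp_integral p (pd f (join_index \<alpha> \<beta>)) = (\<integral>\<^sup>+x. Lp_integral p (pd (G \<alpha> x) \<beta>) \<partial>lborel)"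
    unfolding Lp_integral_prod(1)[OF m] by (simp add: pd)
  also have "\<dots> = Lp_integral p (\<lambda>x. pd_seminorm p \<beta> (G \<alpha> x))" unfolding I
      by (simp add: Lp_integral_def)
  finally show eq: "Lp_integral p (pd f (join_index \<alpha> \<beta>)) = Lp_integral p
      (\<lambda>x. pd_seminorm p \<beta> (G \<alpha> x))" .
  have "(\<lambda>x. pd_seminorm p \<beta> (G \<alpha> x)) \<in> borel_measurable borel"
    by (rule continuous_seminorm_comp_measurable[OF continuous_seminorm_pd_seminorm_W_inf[OF p \<beta>]
        derivative_familyD(2)[OF G \<alpha>]])
  from Lp_norm_cong_Lp_integral[OF m this eq]
  show "pd_norm p (join_index \<alpha> \<beta>) f = Lp_norm p (\<lambda>x. pd_seminorm p \<beta> (G \<alpha> x))"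
    unfolding pd_norm_def .
qed

section \<open>Weights\<close>

text \<open>A sum over a box of indices factors into geometric series, one for each coordinate, each
  at most 2. A bound for all finite sets is what the later series needs.\<close>

lemma sum_half_multi_indices:
  assumes "finite F" "F \<subseteq> (multi_indices :: ('a::euclidean_space \<Rightarrow> nat) set)"
  shows "(\<Sum>\<beta>\<in>F. (1 / 2 :: real) ^ mi_order \<beta>) \<le> 2 ^ DIM('a)"
proof -
  define N where "N = (\<Sum>\<beta>\<in>F. mi_order \<beta>)"
  let ?R = "\<lambda>\<beta>. restrict \<beta> (Basis :: 'a set)"
  \<comment> \<open>Members of \<open>Pi\<^sub>E\<close> are \<open>undefined\<close> off
    \<open>Basis\<close>, multi-indices are 0 there; restriction translates between the two and
    forgets nothing.\<close>
  have inj: "inj_on ?R F"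
  proof (rule inj_onI)
    fix \<beta> \<beta>' assume b: "\<beta> \<in> F" "\<beta>' \<in> F" "?R \<beta> = ?R \<beta>'"
    have "\<beta> \<in> multi_indices" "\<beta>' \<in> multi_indices" using b assms(2) by auto
    note mi = this
    show "\<beta> = \<beta>'"
    proof
      fix v show "\<beta> v = \<beta>' v"
        using mi fun_cong[OF b(3), of v] by (cases "v \<in> Basis") (auto simp: multi_indices_def)
    qed
  qed
  have sub: "?R ` F \<subseteq> Pi\<^sub>E Basis (\<lambda>_. {..N})"
  proof (intro image_subsetI restrict_PiE_iff[THEN iffD2] ballI)
    fix \<beta> b assume b: "\<beta> \<in> F" "b \<in> (Basis :: 'a set)"
    have "\<beta> b \<le> mi_order \<beta>" using b by (intro le_mi_order)
    also have "\<dots> \<le> N" unfolding N_def using b assms by (intro member_le_sum) auto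
    finally show "\<beta> b \<in> {..N}" by simp
  qed
  have "(\<Sum>\<beta>\<in>F. (1 / 2 :: real) ^ mi_order \<beta>) = (\<Sum>\<beta>\<in>F. \<Prod>b\<in>Basis. (1 / 2) ^ (?R \<beta> b))"
    by (intro sum.cong refl) (simp add: mi_order_def power_sum)
  also have "\<dots> = (\<Sum>g\<in>?R ` F. \<Prod>b\<in>Basis. (1 / 2) ^ (g b))"
    by (simp add: sum.reindex[OF inj])
  also have "\<dots> \<le> (\<Sum>g\<in>Pi\<^sub>E (Basis :: 'a set) (\<lambda>_. {..N}). \<Prod>b\<in>Basis. (1 / 2) ^ (g b))"
    by (rule sum_mono2[OF _ sub]) (auto intro!: prod_nonneg finite_PiE)
  also have "\<dots> = (\<Prod>b\<in>(Basis :: 'a set). \<Sum>j\<in>{..N}. (1 / 2 :: real) ^ j)"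
    by (subst prod_sum_PiE) auto
  also have "\<dots> \<le> (\<Prod>b\<in>(Basis :: 'a set). 2)"
  proof (intro prod_mono conjI)
    have "(\<Sum>j\<in>{..N}. (1 / 2 :: real) ^ j) = 2 - (1 / 2) ^ N" by (induction N) auto
    then show "(\<Sum>j\<in>{..N}. (1 / 2 :: real) ^ j) \<le> 2" by simp
  qed (auto intro!: sum_nonneg)
  finally show ?thesis by simp
qed

text \<open>Together with countability this gives a bijective enumeration by naturals, so that sums
  over indices become series.\<close>

lemma infinite_multi_indices: "infinite (multi_indices :: ('a::euclidean_space \<Rightarrow> nat) set)"
proof -
  obtain b :: 'a where b: "b \<in> Basis" using nonempty_Basis by blast
  let ?g = "\<lambda>n. (\<lambda>_. 0)(b := n) :: 'a \<Rightarrow> nat"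
  have "inj ?g" by (rule injI) (metis fun_upd_same)
  then have "infinite (range ?g)" by (rule range_inj_infinite)
  moreover have "range ?g \<subseteq> multi_indices" using b
      by (auto intro: multi_indices_upd multi_indices_zero)
  ultimately show ?thesis using infinite_super by blast
qed

text \<open>\<open>H\<close> is \<open>max 1 K\<close> for an upper bound \<open>K\<close> of the
  roots. The set of roots omits \<open>j = 0\<close> and \<open>k = 0\<close>; these cases hold
  because \<open>M 0 = 1\<close> and \<open>H\<close> is at least 1.\<close>

lemma moderate_growth_bound:
  assumes M: "weight_sequence M" and mg: "moderate_growth M"
  obtains H where "1 \<le> H" "\<And>j k. M (j + k) \<le> H ^ (j + k) * (M j * M k)"
proof -
  have pos: "0 < M k" and M0: "M 0 = 1" for k using M by (auto simp: weight_sequence_def)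
  obtain K where K: "\<And>j k. 1 \<le> j \<Longrightarrow> 1 \<le> k \<Longrightarrow> (M (j + k) / (M j * M k)) powr (1 / real (j + k)) \<le> K"
    using mg unfolding moderate_growth_def bdd_above_def by blast
  have "M (j + k) \<le> max 1 K ^ (j + k) * (M j * M k)" for j k
  proof (cases "j = 0 \<or> k = 0")
    case True
    moreover have "M i \<le> max 1 K ^ i * M i" for i
      using pos[of i] by (simp add: mult_le_cancel_right1 one_le_power)
    ultimately show ?thesis using M0 by auto
  next
    case False
    define r where "r = M (j + k) / (M j * M k)"
    have r: "0 < r" unfolding r_def using pos by simp
    have "r = (r powr (1 / real (j + k))) powr real (j + k)" using r False by (simp add: powr_powr)
    also have "\<dots> = (r powr (1 / real (j + k))) ^ (j + k)" using r by (intro powr_realpow) simp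
    also have "\<dots> \<le> max 1 K ^ (j + k)"
      using K[of j k] False by (intro power_mono) (auto simp: r_def)
    finally show ?thesis unfolding r_def using pos[of j] pos[of k] by (simp add: field_simps)
  qed
  then show ?thesis by (rule that[OF max.cobounded1])
qed

text \<open>The factor 2 in the radius comes from the binomial coefficient hidden in the factorials,
  the factor \<open>H\<close> from moderate growth.\<close>

lemma weight_add_le:
  assumes M: "weight_sequence M" and H: "1 \<le> H" "\<And>j k. M (j + k) \<le> H ^ (j + k) * (M j * M k)"
      and \<rho>: "0 \<le> \<rho>"
  shows "weight M \<rho> (j + k) \<le> weight M (2 * H * \<rho>) j * weight M (2 * H * \<rho>) k"
proof -
  have pos: "0 < M k" for k using M by (auto simp: weight_sequence_def)
  have "fact (j + k) = fact j * fact k * real ((j + k) choose j)"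
    using binomial_fact_lemma[of j "j + k"]
        by (metis add_diff_cancel_left' le_add1 of_nat_fact of_nat_mult)
  also have "\<dots> \<le> fact j * fact k * 2 ^ (j + k)"
  proof (intro mult_left_mono)
    have "real ((j + k) choose j) \<le> real (2 ^ (j + k))"
      unfolding of_nat_le_iff by (rule binomial_le_pow2)
    then show "real ((j + k) choose j) \<le> 2 ^ (j + k)" by simp
  qed simp
  finally have f: "(fact (j + k) :: real) \<le> fact j * fact k * 2 ^ (j + k)" .
  have "weight M \<rho> (j + k) \<le> \<rho> ^ (j + k) * (fact j * fact k * 2 ^ (j + k)) * (H ^ (j + k) * (M j *
      M k))"
    unfolding weight_def using f H(2) \<rho> pos[of "j + k"]
        by (intro mult_mono) (auto simp: less_imp_le)
  also have "\<dots> = weight M (2 * H * \<rho>) j * weight M (2 * H * \<rho>) k"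
    by (simp add: weight_def power_add power_mult_distrib)
  finally show ?thesis .
qed

text \<open>Log-convexity says that the ratios \<open>r k\<close> of successive terms of
  \<open>N\<close> increase. As \<open>N 0 = 1\<close>, the induction on \<open>j\<close> replaces
  each factor \<open>r j\<close> by the larger \<open>r (j + k)\<close>. The radius stays the
  same.\<close>

lemma weight_mult_le:
  assumes M: "weight_sequence M" and lc: "weakly_log_convex M" and \<rho>: "0 \<le> \<rho>"
  shows "weight M \<rho> j * weight M \<rho> k \<le> weight M \<rho> (j + k)"
proof -
  define N :: "nat \<Rightarrow> real" where "N k = fact k * M k" for k
  have pos: "0 < N k" for k using M by (simp add: N_def weight_sequence_def)
  have N0: "N 0 = 1" using M by (simp add: N_def weight_sequence_def)
  define r where "r k = N (Suc k) / N k" for k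
  have "r k \<le> r (Suc k)" for k
  proof -
    have "(N (Suc k))\<^sup>2 \<le> N k * N (Suc (Suc k))"
      using lc unfolding weakly_log_convex_def N_def
          by (metis One_nat_def Suc_eq_plus1 diff_Suc_1 le_add2)
    then show ?thesis unfolding r_def using pos[of k] pos[of "Suc k"]
        by (simp add: field_simps power2_eq_square)
  qed
  then have r: "r j \<le> r (j + k)" for j k using incseq_SucI[of r] by (simp add: incseq_def)
  have N: "N j * N k \<le> N (j + k)"
  proof (induction j)
    case 0
    then show ?case using N0 by simp
  next
    case (Suc j)
    have "N (Suc j) * N k = r j * (N j * N k)" unfolding r_def using pos[of j] by simp
    also have "\<dots> \<le> r (j + k) * N (j + k)"
      using r Suc pos less_imp_le[OF pos] by (intro mult_mono) (auto simp: r_def)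
    also have "\<dots> = N (Suc j + k)" unfolding r_def using pos[of "j + k"] by simp
    finally show ?case .
  qed
  have "weight M \<rho> j * weight M \<rho> k = \<rho> ^ (j + k) * (N j * N k)"
      by (simp add: weight_def N_def power_add)
  also have "\<dots> \<le> \<rho> ^ (j + k) * N (j + k)" using N \<rho> by (intro mult_left_mono) auto
  finally show ?thesis by (simp add: weight_def N_def mult.assoc)
qed

lemma weight_half: "weight M (\<sigma> / 2) k = (1 / 2) ^ k * weight M \<sigma> k"
  by (simp add: weight_def power_divide)

text \<open>The supremum over \<open>\<beta>\<close> is dominated by an \<open>\<ell>\<^sup>p\<close>-sum, which commutes with the integral;
  the gap between \<open>2 H \<rho>\<close> and \<open>\<sigma>\<close> makes it a convergent geometric series.\<close>

lemma Lp_norm_W_seminorm_curry: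
  fixes f :: "'a::euclidean_space \<times> 'b::euclidean_space \<Rightarrow> real"
  assumes M: "weight_sequence M" and H: "1 \<le> H" "\<And>j k. M (j + k) \<le> H ^ (j + k) * (M j * M k)"
    and p: "1 \<le> p" and G: "derivative_family (W_step M p \<sigma>) (\<lambda>x y. f (x, y)) G"
    and A: "0 \<le> A" "\<And>\<gamma>. \<gamma> \<in> multi_indices \<Longrightarrow> pd_norm p \<gamma> f \<le> ennreal (A * weight M \<rho> (mi_order \<gamma>))"
    and \<rho>: "0 < \<rho>" "4 * H * \<rho> \<le> \<sigma>" and \<alpha>: "\<alpha> \<in> multi_indices"
    and Ginf: "derivative_family (W_inf p) (\<lambda>x y. f (x, y)) G"
    and meas: "(\<lambda>x. W_seminorm M p \<sigma> (G \<alpha> x)) \<in> borel_measurable borel"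
  shows "Lp_norm p (\<lambda>x. W_seminorm M p \<sigma> (G \<alpha> x)) \<le> ennreal ((2 ^ DIM('b)) powr (1 / p) * A *
      weight M (2 * H * \<rho>) (mi_order \<alpha>))"
proof -
  let ?w = "\<lambda>\<beta>. weight M \<sigma> (mi_order \<beta>)" and ?w1 = "weight M (2 * H * \<rho>) (mi_order \<alpha>)"
  have H\<rho>: "0 < 2 * H * \<rho>" using H(1) \<rho> by simp
  have \<sigma>: "0 < \<sigma>" using H\<rho> \<rho>(2) by linarith
  have w: "0 < ?w \<beta>" for \<beta> :: "'b \<Rightarrow> nat" by (rule weight_pos[OF M \<sigma>])
  have w1: "0 < ?w1" by (rule weight_pos[OF M H\<rho>])
  define e :: "nat \<Rightarrow> 'b \<Rightarrow> nat" where "e = from_nat_into multi_indices"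
  have e: "bij_betw e UNIV multi_indices"
    unfolding e_def
        by (rule bij_betw_from_nat_into[OF countable_multi_indices infinite_multi_indices])
  have e_mem: "e n \<in> multi_indices" for n using e by (auto simp: bij_betw_def)
  define t where "t n x = (pd_seminorm p (e n) (G \<alpha> x) / ?w (e n)) powr p" for n x
  have mn: "(\<lambda>x. pd_seminorm p (e n) (G \<alpha> x)) \<in> borel_measurable borel" for n
    by (rule continuous_seminorm_comp_measurable[OF continuous_seminorm_pd_seminorm_W_inf[OF p
        e_mem] derivative_familyD(2)[OF Ginf \<alpha>]])
  then have [measurable]: "t n \<in> borel_measurable borel" for n unfolding t_def by simp
  \<comment> \<open>If the sum is infinite there is nothing to prove; a finite sum \<open>r\<close>
    dominates each term, so \<open>r powr (1 / p)\<close> is an admissible constant for all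
    \<open>\<beta>\<close> at once.\<close>
  have pt: "ennreal (\<bar>W_seminorm M p \<sigma> (G \<alpha> x)\<bar> powr p) \<le> (\<Sum>n. ennreal (t n x))" for x
  proof (cases "\<Sum>n. ennreal (t n x)")
    case (real r)
    have le: "t n x \<le> r" for n
    proof -
      have "ennreal (t n x) \<le> (\<Sum>n. ennreal (t n x))"
        using sum_le_suminf[of "\<lambda>n. ennreal (t n x)" "{n}"] by simp
      then show ?thesis using real by simp
    qed
    have "W_seminorm M p \<sigma> (G \<alpha> x) \<le> r powr (1 / p)"
    proof (subst W_seminorm_le_iff[OF M \<sigma> powr_ge_zero derivative_familyD(4)[OF G \<alpha>]], intro ballI)
      fix \<beta> :: "'b \<Rightarrow> nat" assume \<beta>: "\<beta> \<in> multi_indices"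
      then obtain n where n: "\<beta> = e n" using e by (metis bij_betw_imp_surj_on imageE)
      have "(pd_seminorm p \<beta> (G \<alpha> x) / ?w \<beta>) powr p \<le> r" using le[of n] by (simp add: t_def n)
      then have "((pd_seminorm p \<beta> (G \<alpha> x) / ?w \<beta>) powr p) powr (1 / p) \<le> r powr (1 / p)"
        using p by (intro powr_mono2) auto
      then have "pd_seminorm p \<beta> (G \<alpha> x) / ?w \<beta> \<le> r powr (1 / p)"
        using p w[of \<beta>] by (simp add: powr_powr)
      then have "pd_seminorm p \<beta> (G \<alpha> x) \<le> r powr (1 / p) * ?w \<beta>"
        using w[of \<beta>] by (simp add: field_simps)
      then show "pd_norm p \<beta> (G \<alpha> x) \<le> ennreal (r powr (1 / p) * ?w \<beta>)"
        using pd_norm_eq_pd_seminorm[OF W_inf_D(2)[OF derivative_familyD(4)[OF Ginf \<alpha>] \<beta>], of x]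
            by (simp add: ennreal_leI)
    qed
    then have "W_seminorm M p \<sigma> (G \<alpha> x) powr p \<le> (r powr (1 / p)) powr p" using p
        by (intro powr_mono2) auto
    then show ?thesis using real p by (simp add: powr_powr ennreal_leI)
  qed simp
  have int: "(\<integral>\<^sup>+x. ennreal (t n x) \<partial>lborel) \<le> ennreal ((A * ?w1) powr p * (1 / 2) ^ mi_order (e
      n))" for n
  proof -
    let ?k = "mi_order (e n)"
    have "(\<integral>\<^sup>+x. ennreal (t n x) \<partial>lborel) = Lp_integral p (\<lambda>x. (1 / ?w (e n)) * pd_seminorm p (e
        n) (G \<alpha> x))"
      unfolding Lp_integral_def t_def using w[of "e n"] by (intro nn_integral_cong) simp
    also have "\<dots> = ennreal (\<bar>1 / ?w (e n)\<bar> powr p) * Lp_integral p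
        (\<lambda>x. pd_seminorm p (e n) (G \<alpha> x))"
      by (rule Lp_integral_scale[OF mn])
    also have "Lp_integral p (\<lambda>x. pd_seminorm p (e n) (G \<alpha> x))
        \<le> ennreal ((A * weight M \<rho> (mi_order \<alpha> + ?k)) powr p)"
    proof -
      have "Lp_norm p (\<lambda>x. pd_seminorm p (e n) (G \<alpha> x)) \<le> ennreal (A * weight M \<rho> (mi_order \<alpha> +
          ?k))"
        using A(2)[OF join_index_multi_indices[OF \<alpha> e_mem]] pd_norm_curry(4)[OF p Ginf \<alpha> e_mem]
        by (simp add: mi_order_join_index[OF \<alpha> e_mem])
      then show ?thesis using A(1) weight_nonneg[OF M less_imp_le[OF \<rho>(1)]] mn
          by (subst (asm) Lp_norm_le_iff[OF p]) auto
    qed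
    also have "ennreal (\<bar>1 / ?w (e n)\<bar> powr p) * ennreal ((A * weight M \<rho> (mi_order \<alpha> + ?k)) powr p)
      = ennreal ((A * (weight M \<rho> (mi_order \<alpha> + ?k) / ?w (e n))) powr p)"
      using w[of "e n"] by (simp add: ennreal_mult'[symmetric] powr_mult[symmetric])
    also have "\<dots> \<le> ennreal ((A * (?w1 * (1 / 2) ^ ?k)) powr p)"
    proof (intro ennreal_leI powr_mono2 mult_left_mono A(1))
      \<comment> \<open>The spare factor 2 in \<open>4 * H * \<rho> \<le> \<sigma>\<close> is spent
        here and produces the geometric factor.\<close>
      have "weight M (2 * H * \<rho>) ?k \<le> weight M (\<sigma> / 2) ?k" using H\<rho> \<rho>
          by (intro weight_mono[OF M]) auto
      then have "weight M (2 * H * \<rho>) ?k \<le> (1 / 2) ^ ?k * ?w (e n)" unfolding weight_half .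
      then have "?w1 * weight M (2 * H * \<rho>) ?k \<le> ?w1 * ((1 / 2) ^ ?k * ?w (e n))"
        using w1 by (intro mult_left_mono) auto
      then have "weight M \<rho> (mi_order \<alpha> + ?k) \<le> ?w1 * ((1 / 2) ^ ?k * ?w (e n))"
        using weight_add_le[OF M H, of \<rho> "mi_order \<alpha>" ?k] \<rho>(1) by linarith
      then show "weight M \<rho> (mi_order \<alpha> + ?k) / ?w (e n) \<le> ?w1 * (1 / 2) ^ ?k"
        using w[of "e n"] by (simp add: divide_le_eq mult.assoc)
    qed (use p A(1) w[of "e n"] weight_nonneg[OF M less_imp_le[OF \<rho>(1)]] in auto)
    also have "(A * (?w1 * (1 / 2) ^ ?k)) powr p = (A * ?w1) powr p * ((1 / 2) ^ ?k) powr p"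
      by (simp add: powr_mult mult.assoc[symmetric])
    also have "\<dots> \<le> (A * ?w1) powr p * (1 / 2) ^ ?k"
    proof (intro mult_left_mono)
      \<comment> \<open>The base is at most 1 and \<open>1 \<le> p\<close>, so the exponent
        \<open>p\<close> may be dropped and the series is the one summed in
        \<open>sum_half_multi_indices\<close>.\<close>
      have "((1 / 2 :: real) ^ ?k) powr p \<le> ((1 / 2) ^ ?k) powr 1"
        using p by (intro powr_mono') (auto simp: power_le_one)
      then show "((1 / 2 :: real) ^ ?k) powr p \<le> (1 / 2) ^ ?k" by simp
    qed simp
    finally show ?thesis by (simp add: mult_left_mono ennreal_leI)
  qed
  have "Lp_integral p (\<lambda>x. W_seminorm M p \<sigma> (G \<alpha> x)) \<le> (\<integral>\<^sup>+x. (\<Sum>n. ennreal (t n x)) \<partial>lborel)"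
    unfolding Lp_integral_def by (intro nn_integral_mono pt)
  also have "\<dots> = (\<Sum>n. \<integral>\<^sup>+x. ennreal (t n x) \<partial>lborel)" by (rule nn_integral_suminf) simp
  also have "\<dots> \<le> (\<Sum>n. ennreal ((A * ?w1) powr p * (1 / 2) ^ mi_order (e n)))"
    by (intro suminf_le int summableI)
  also have "\<dots> \<le> ennreal ((A * ?w1) powr p * 2 ^ DIM('b))"
  proof (rule suminf_le_const)
    fix n
    have inj: "inj_on e {..<n}" using e by (auto simp: bij_betw_def intro: inj_on_subset)
    have "(\<Sum>i<n. (1 / 2 :: real) ^ mi_order (e i)) = (\<Sum>\<beta>\<in>e ` {..<n}. (1 / 2) ^ mi_order \<beta>)"
      by (simp add: sum.reindex[OF inj])
    also have "\<dots> \<le> 2 ^ DIM('b)" using e_mem by (intro sum_half_multi_indices) auto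
    finally have "(A * ?w1) powr p * (\<Sum>i<n. (1 / 2 :: real) ^ mi_order (e i))
        \<le> (A * ?w1) powr p * 2 ^ DIM('b)"
      by (intro mult_left_mono) auto
    then show "(\<Sum>i<n. ennreal ((A * ?w1) powr p * (1 / 2) ^ mi_order (e i)))
        \<le> ennreal ((A * ?w1) powr p * 2 ^ DIM('b))"
      by (subst sum_ennreal) (auto simp: sum_distrib_left ennreal_leI)
  qed simp
  also have "(A * ?w1) powr p * 2 ^ DIM('b) = ((2 ^ DIM('b)) powr (1 / p) * A * ?w1) powr p"
    using p by (simp add: powr_mult powr_powr)
  finally show ?thesis
    using A(1) w1 by (subst Lp_norm_le_iff[OF p meas]) auto
qed

section \<open>The scalar exponential laws\<close>

lemma derivative_family_continuous_map:
  fixes f :: "'a::euclidean_space \<Rightarrow> 'b::real_vector"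
  assumes c: "continuous_map T T' (\<lambda>x. x)" and D: "derivative_family T f D"
  shows "derivative_family T' f D"
  unfolding derivative_family_def
proof (intro conjI ballI)
  show "D (\<lambda>_. 0) = f" by (rule derivative_familyD(1)[OF D])
  fix \<alpha> :: "'a \<Rightarrow> nat" assume \<alpha>: "\<alpha> \<in> multi_indices"
  show "continuous_map euclidean T' (D \<alpha>)"
    using continuous_map_compose[OF derivative_familyD(2)[OF D \<alpha>] c] by (simp add: o_def)
  fix b :: 'a assume b: "b \<in> Basis"
  show "has_partial_derivative T' (D \<alpha>) b (D (\<alpha>(b := Suc (\<alpha> b))))"
    using derivative_familyD(3)[OF D \<alpha> b] continuous_map_limitinD[OF c]
    unfolding has_partial_derivative_def by blast
qed

text \<open>The three vector-valued spaces with the growth condition abstracted to \<open>Q\<close>,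
  and with some family of derivatives in place of the one selected by \<open>SOME\<close>.
  \<open>VW_iff_partial_deriv\<close> returns to the original form.\<close>

definition VW :: "((('a::euclidean_space \<Rightarrow> nat) \<Rightarrow> 'a \<Rightarrow> real) \<Rightarrow> bool) \<Rightarrow> 'b::real_vector topology \<Rightarrow>
    ('a \<Rightarrow> 'b) set" where
  "VW Q T = {g. \<exists>D. derivative_family T g D \<and> (\<forall>s. continuous_seminorm T s \<longrightarrow> Q (\<lambda>\<alpha> x. s (D \<alpha> x)))}"

definition Q_inf :: "real \<Rightarrow> (('a::euclidean_space \<Rightarrow> nat) \<Rightarrow> 'a \<Rightarrow> real) \<Rightarrow> bool" where
  "Q_inf p G \<longleftrightarrow> (\<forall>\<alpha>\<in>multi_indices. Lp_norm p (G \<alpha>) < \<infinity>)"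

definition Q_Beurling :: "(nat \<Rightarrow> real) \<Rightarrow> real \<Rightarrow> (('a::euclidean_space \<Rightarrow> nat) \<Rightarrow> 'a \<Rightarrow> real) \<Rightarrow> bool"
    where
  "Q_Beurling M p G \<longleftrightarrow> (\<forall>\<sigma>>0. weighted_sup M p \<sigma> G < \<infinity>)"

definition Q_Roumieu :: "(nat \<Rightarrow> real) \<Rightarrow> real \<Rightarrow> (('a::euclidean_space \<Rightarrow> nat) \<Rightarrow> 'a \<Rightarrow> real) \<Rightarrow> bool"
    where
  "Q_Roumieu M p G \<longleftrightarrow> (\<exists>\<sigma>>0. weighted_sup M p \<sigma> G < \<infinity>)"

lemma Lp_norm_scale_le:
  assumes "1 \<le> p" "u \<in> borel_measurable borel" "v \<in> borel_measurable borel" "0 \<le> C"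
      "\<And>x. \<bar>u x\<bar> \<le> C * \<bar>v x\<bar>"
  shows "Lp_norm p u \<le> ennreal C * Lp_norm p v"
proof -
  have "Lp_norm p u \<le> Lp_norm p (\<lambda>x. C * v x)"
    using assms by (intro Lp_norm_mono) (auto simp: abs_mult)
  also have "\<dots> = ennreal C * Lp_norm p v" using Lp_norm_scale[OF assms(1), of C v] assms(4) by simp
  finally show ?thesis .
qed

text \<open>Sums of the first derivative seminorms along an enumeration of the indices form the
  increasing sequence required by \<open>continuous_seminorm_bound\<close>.\<close>

lemma continuous_seminorm_W_inf_bound:
  assumes p: "1 \<le> p"
      and s: "continuous_seminorm (W_inf p :: ('b::euclidean_space \<Rightarrow> real) topology) s"
  obtains \<Delta> C where "finite \<Delta>" "\<Delta> \<subseteq> multi_indices" "0 \<le> C"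
    "\<And>h :: 'b \<Rightarrow> real. h \<in> topspace (W_inf p) \<Longrightarrow> s h \<le> C * (\<Sum>\<delta>\<in>\<Delta>. pd_seminorm p \<delta> h)"
proof -
  define e :: "nat \<Rightarrow> 'b \<Rightarrow> nat" where "e = from_nat_into multi_indices"
  have e: "bij_betw e UNIV multi_indices"
    unfolding e_def
        by (rule bij_betw_from_nat_into[OF countable_multi_indices infinite_multi_indices])
  have e_mem: "e n \<in> multi_indices" for n using e by (auto simp: bij_betw_def)
  let ?q = "\<lambda>n h. \<Sum>\<delta>\<in>e ` {..n}. pd_seminorm p \<delta> h"
  obtain n C where C: "0 \<le> C" "\<And>h. h \<in> topspace (W_inf p) \<Longrightarrow> s h \<le> C * ?q n h"
  proof (rule continuous_seminorm_bound[OF subspace_W_inf[OF p] s, of ?q])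
    fix n
    have sn: "seminorm_on (topspace (W_inf p)) (pd_seminorm p (e i))" for i
        by (rule pd_seminorm_seminorm[OF p e_mem order_refl])
    show "seminorm_on (topspace (W_inf p)) (?q n)"
      unfolding seminorm_on_def
    proof (intro conjI ballI allI)
      fix f g :: "'b \<Rightarrow> real" assume fg: "f \<in> topspace (W_inf p)" "g \<in> topspace (W_inf p)"
      have "?q n (f + g) \<le> (\<Sum>\<delta>\<in>e ` {..n}. pd_seminorm p \<delta> f + pd_seminorm p \<delta> g)"
        by (intro sum_mono) (use seminorm_onD(2)[OF sn subspace_W_inf[OF p] fg] in auto)
      then show "?q n (f + g) \<le> ?q n f + ?q n g" by (simp add: sum.distrib)
    next
      fix c and f :: "'b \<Rightarrow> real" assume f: "f \<in> topspace (W_inf p)"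
      show "?q n (c *\<^sub>R f) = \<bar>c\<bar> * ?q n f"
        unfolding sum_distrib_left
        by (intro sum.cong refl) (use seminorm_onD(3)[OF sn subspace_W_inf[OF p] f] in auto)
    qed (intro sum_nonneg, simp)
  next
    fix m n :: nat and x :: "'b \<Rightarrow> real" assume "m \<le> n"
    then show "?q m x \<le> ?q n x" by (intro sum_mono2) auto
  next
    fix u :: "nat \<Rightarrow> 'b \<Rightarrow> real"
    assume u: "\<And>k. u k \<in> topspace (W_inf p)" "\<And>n. (\<lambda>k. ?q n (u k)) \<longlonglongrightarrow> 0"
    show "limitin (W_inf p) u 0 sequentially"
      unfolding limitin_W_inf[OF p]
    proof (intro conjI ballI)
      show "0 \<in> topspace (W_inf p :: ('b \<Rightarrow> real) topology)"
          by (rule subspace_0[OF subspace_W_inf[OF p]])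
      fix \<alpha> :: "'b \<Rightarrow> nat" assume "\<alpha> \<in> multi_indices"
      then obtain n where n: "\<alpha> = e n" using e by (metis bij_betw_imp_surj_on imageE)
      have "norm (pd_seminorm p \<alpha> (u k - 0)) \<le> ?q n (u k)" for k
        unfolding n using member_le_sum[of "e n" "e ` {..n}" "\<lambda>\<delta>. pd_seminorm p \<delta> (u k)"] by simp
      then show "(\<lambda>k. pd_seminorm p \<alpha> (u k - 0)) \<longlonglongrightarrow> 0"
        by (intro Lim_null_comparison[OF _ u(2)[of n]] always_eventually) auto
    qed (use u in auto)
  qed (rule that)
  show ?thesis
    by (rule that[of "e ` {..n}" C]) (use e_mem C in auto)
qed

text \<open>Here a single \<open>\<beta>\<close> can be handled at a time. Forward, a continuous
  seminorm is dominated by finitely many \<open>pd_seminorm p \<delta>\<close>; backward, these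
  seminorms themselves are the test seminorms. In both cases \<open>pd_norm_curry\<close> translates
  the norms.\<close>

lemma W_inf_curry:
  fixes f :: "'a::euclidean_space \<times> 'b::euclidean_space \<Rightarrow> real"
  assumes p: "1 \<le> p"
  shows "f \<in> topspace (W_inf p) \<longleftrightarrow> (\<lambda>x y. f (x, y)) \<in> VW (Q_inf p) (W_inf p)"
proof
  assume f: "f \<in> topspace (W_inf p)"
  note sm = W_inf_D(1)[OF f]
  let ?G = "\<lambda>\<alpha> x y. pd f (join_index \<alpha> (\<lambda>_. 0)) (x, y)"
  have G: "derivative_family (W_inf p) (\<lambda>x y. f (x, y)) ?G"
  proof (subst W_inf_eq, rule forward_family[where S = "\<lambda>\<beta>. {\<beta>}" and \<kappa> = "\<lambda>_ _. 1"])
    fix h :: "'b \<Rightarrow> real"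
    assume "smooth h" "\<And>i. i \<in> multi_indices \<Longrightarrow> \<exists>c\<ge>0. \<forall>\<beta>\<in>{i}. pd_norm p \<beta> h \<le> ennreal (c * 1)"
    then show "h \<in> topspace (W_inf p)"
      unfolding topspace_W_inf using le_less_trans[OF _ ennreal_less_top] by fastforce
  next
    fix i and h :: "'b \<Rightarrow> real" and c :: real
    assume "i \<in> multi_indices" "h \<in> topspace (W_inf p)" "0 \<le> c" "\<And>\<beta>. \<beta> \<in> {i} \<Longrightarrow>
        pd_norm p \<beta> h \<le> ennreal (c * 1)"
    then show "pd_seminorm p i h \<le> c" using W_inf_D by (subst pd_seminorm_le_iff) auto
  next
    fix \<beta> :: "'b \<Rightarrow> nat" and \<alpha> :: "'a \<Rightarrow> nat" assume ab: "\<beta> \<in> multi_indices" "\<alpha> \<in> multi_indices"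
    have "Lp_integral p (pd f (join_index \<alpha> \<beta>)) = ennreal (pd_seminorm p (join_index \<alpha> \<beta>) f powr p)"
      by (rule Lp_integral_pd_pd_seminorm[OF p f join_index_multi_indices[OF ab(2,1)]])
    then show "\<exists>B\<ge>0. \<forall>\<beta>\<in>{\<beta>}. Lp_integral p (pd f (join_index \<alpha> \<beta>)) \<le> ennreal ((B * 1) powr p)"
      by (intro exI[of _ "pd_seminorm p (join_index \<alpha> \<beta>) f"]) simp
  qed (use p pd_family[OF sm] subspace_W_inf[OF p] pd_seminorm_seminorm[OF p _ order_refl] in auto)
  have "Q_inf p (\<lambda>\<alpha> x. s (?G \<alpha> x))" if s: "continuous_seminorm (W_inf p) s" for s
    unfolding Q_inf_def
  proof
    fix \<alpha> :: "'a \<Rightarrow> nat" assume \<alpha>: "\<alpha> \<in> multi_indices"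
    obtain \<Delta> C where \<Delta>: "finite \<Delta>" "\<Delta> \<subseteq> multi_indices" and C: "0 \<le> C"
      and sb: "\<And>h. h \<in> topspace (W_inf p) \<Longrightarrow> s h \<le> C * (\<Sum>\<delta>\<in>\<Delta>. pd_seminorm p \<delta> h)"
      by (rule continuous_seminorm_W_inf_bound[OF p s]) (rule that)
    have mem: "?G \<alpha> x \<in> topspace (W_inf p)" for x by (rule derivative_familyD(4)[OF G \<alpha>])
    have meas: "(\<lambda>x. pd_seminorm p \<delta> (?G \<alpha> x)) \<in> borel_measurable borel" if "\<delta> \<in> \<Delta>" for \<delta>
      by (rule continuous_seminorm_comp_measurable[OF continuous_seminorm_pd_seminorm_W_inf[OF p]
          derivative_familyD(2)[OF G \<alpha>]])
        (use that \<Delta> in auto)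
    have s0: "0 \<le> s (?G \<alpha> x)" for x
      using s mem by (auto simp: continuous_seminorm_def seminorm_on_def)
    have "Lp_norm p (\<lambda>x. s (?G \<alpha> x)) \<le> ennreal C * Lp_norm p (\<lambda>x. \<Sum>\<delta>\<in>\<Delta>. pd_seminorm p \<delta> (?G \<alpha> x))"
    proof (rule Lp_norm_scale_le[OF p continuous_seminorm_comp_measurable[OF s
        derivative_familyD(2)[OF G \<alpha>]] _ C])
      show "(\<lambda>x. \<Sum>\<delta>\<in>\<Delta>. pd_seminorm p \<delta> (?G \<alpha> x)) \<in> borel_measurable borel" using meas
          by (intro borel_measurable_sum)
      fix x
      have "0 \<le> (\<Sum>\<delta>\<in>\<Delta>. pd_seminorm p \<delta> (?G \<alpha> x))" by (intro sum_nonneg) simp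
      then show "\<bar>s (?G \<alpha> x)\<bar> \<le> C * \<bar>\<Sum>\<delta>\<in>\<Delta>. pd_seminorm p \<delta> (?G \<alpha> x)\<bar>"
        using sb[OF mem] s0[of x] by simp
    qed
    also have "\<dots> \<le> ennreal C * (\<Sum>\<delta>\<in>\<Delta>. Lp_norm p (\<lambda>x. pd_seminorm p \<delta> (?G \<alpha> x)))"
      using meas by (intro mult_left_mono Lp_norm_sum[OF p \<Delta>(1)]) auto
    also have "(\<Sum>\<delta>\<in>\<Delta>. Lp_norm p (\<lambda>x. pd_seminorm p \<delta> (?G \<alpha> x)))
        = (\<Sum>\<delta>\<in>\<Delta>. pd_norm p (join_index \<alpha> \<delta>) f)"
      using \<Delta> by (intro sum.cong refl pd_norm_curry(4)[OF p G \<alpha>, symmetric]) auto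
    also have "ennreal C * \<dots> < \<infinity>"
      using W_inf_D(2)[OF f join_index_multi_indices[OF \<alpha>]] \<Delta> by (auto simp: ennreal_mult_less_top)
    finally show "Lp_norm p (\<lambda>x. s (?G \<alpha> x)) < \<infinity>" .
  qed
  with G show "(\<lambda>x y. f (x, y)) \<in> VW (Q_inf p) (W_inf p)" unfolding VW_def by blast
next
  assume "(\<lambda>x y. f (x, y)) \<in> VW (Q_inf p) (W_inf p)"
  then obtain G where G: "derivative_family (W_inf p) (\<lambda>x y. f (x, y)) G"
    and Q: "\<And>s. continuous_seminorm (W_inf p) s \<Longrightarrow> Q_inf p (\<lambda>\<alpha> x. s (G \<alpha> x))" unfolding VW_def
        by blast
  have "pd_norm p \<gamma> f < \<infinity>" if "\<gamma> \<in> multi_indices" for \<gamma>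
  proof -
    obtain \<alpha> \<beta> where ab: "\<alpha> \<in> multi_indices" "\<beta> \<in> multi_indices" and \<gamma>: "\<gamma> = join_index \<alpha> \<beta>"
      using \<open>\<gamma> \<in> multi_indices\<close> by (rule multi_indices_prodE)
    show ?thesis
      unfolding \<gamma> pd_norm_curry(4)[OF p G ab]
      using Q[OF continuous_seminorm_pd_seminorm_W_inf[OF p ab(2)]] ab unfolding Q_inf_def by blast
  qed
  then show "f \<in> topspace (W_inf p)"
    unfolding topspace_W_inf
        using pd_norm_curry(1)[OF p G multi_indices_zero(1) multi_indices_zero(1)] by blast
qed

section \<open>Exponential laws for the weighted spaces\<close>

lemma continuous_seminorm_W_seminorm_step:
  assumes M: "weight_sequence M" "0 < \<rho>" "1 \<le> p"
  shows "continuous_seminorm (W_step M p \<rho> :: ('b::euclidean_space \<Rightarrow> real) topology) (W_seminorm M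
      p \<rho>)"
proof (rule continuous_seminormI[OF subspace_W_step[OF M] W_seminorm_seminorm[OF M]])
  fix x :: "'b \<Rightarrow> real" assume "x \<in> topspace (W_step M p \<rho>)"
  from limitin_id[OF this] show "((\<lambda>y. W_seminorm M p \<rho> (y - x)) \<longlongrightarrow> 0) (atin (W_step M p \<rho>) x)"
    unfolding limitin_W_step[OF M] by blast
qed

text \<open>The quantitative core of the forward direction, with both radii explicit:
  \<open>\<sigma>\<close> in the inner variable, \<open>2 * H * \<rho>\<close> in the outer one. The
  Beurling case chooses \<open>\<rho>\<close> small for given radii, the Roumieu case chooses
  \<open>\<sigma>\<close> large for a given \<open>\<rho>\<close>.\<close>

lemma forward_step:
  fixes f :: "'a::euclidean_space \<times> 'b::euclidean_space \<Rightarrow> real"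
  assumes M: "weight_sequence M" and H: "1 \<le> H" "\<And>j k. M (j + k) \<le> H ^ (j + k) * (M j * M k)"
    and p: "1 \<le> p" and \<rho>: "0 < \<rho>" "4 * H * \<rho> \<le> \<sigma>" and f: "f \<in> topspace (W_step M p \<rho>)"
  defines "G \<equiv> \<lambda>\<alpha> x y. pd f (join_index \<alpha> (\<lambda>_. 0)) (x, y)"
  shows "derivative_family (W_step M p \<sigma>) (\<lambda>x y. f (x, y)) G"
    and "\<exists>c\<ge>0. \<forall>\<alpha>\<in>multi_indices. Lp_norm p (\<lambda>x. W_seminorm M p \<sigma> (G \<alpha> x))
        \<le> ennreal (c * weight M (2 * H * \<rho>) (mi_order \<alpha>))"
proof -
  have H\<rho>: "0 < 2 * H * \<rho>" using H(1) \<rho> by simp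
  have \<sigma>: "0 < \<sigma>" "2 * H * \<rho> \<le> \<sigma>" using H\<rho> \<rho>(2) by linarith+
  note sm = topspace_W_step_D(1)[OF f]
  let ?A = "W_seminorm M p \<rho> f"
  have A: "pd_norm p \<gamma> f \<le> ennreal (?A * weight M \<rho> (mi_order \<gamma>))" if "\<gamma> \<in> multi_indices" for \<gamma>
    by (rule pd_norm_le_W_seminorm[OF M \<rho>(1) f that])
  show G: "derivative_family (W_step M p \<sigma>) (\<lambda>x y. f (x, y)) G"
  proof -
    \<comment> \<open>The single norm is presented as a family over the one-element set
      \<open>{()}\<close> to fit \<open>forward_family\<close>.\<close>
    have "derivative_family (seminorm_topology (topspace (W_step M p \<sigma>)) ((\<lambda>_. W_seminorm M p \<sigma>) `
        {()})) (\<lambda>x y. f (x, y)) G"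
      unfolding G_def
    proof (rule forward_family[where S = "\<lambda>_. multi_indices"
        and \<kappa> = "\<lambda>_ \<beta>. weight M \<sigma> (mi_order \<beta>)"])
      fix h :: "'b \<Rightarrow> real"
      assume "smooth h" "\<And>i::unit. i \<in> {()} \<Longrightarrow> \<exists>c\<ge>0. \<forall>\<beta>\<in>multi_indices. pd_norm p \<beta> h
          \<le> ennreal (c * weight M \<sigma> (mi_order \<beta>))"
      then show "h \<in> topspace (W_step M p \<sigma>)" unfolding topspace_W_step[OF M \<sigma>(1)] by blast
    next
      fix h :: "'b \<Rightarrow> real" and c :: real
      assume "h \<in> topspace (W_step M p \<sigma>)" "0 \<le> c"
        "\<And>\<beta>. \<beta> \<in> multi_indices \<Longrightarrow> pd_norm p \<beta> h \<le> ennreal (c * weight M \<sigma> (mi_order \<beta>))"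
      then show "W_seminorm M p \<sigma> h \<le> c" by (subst W_seminorm_le_iff[OF M \<sigma>(1)]) auto
    next
      fix \<alpha> :: "'a \<Rightarrow> nat" assume \<alpha>: "\<alpha> \<in> multi_indices"
      \<comment> \<open>Splitting the weight of the joint index leaves its \<open>\<alpha>\<close>
        part in the constant; the \<open>\<beta>\<close> part is absorbed by radius
        \<open>\<sigma>\<close>.\<close>
      let ?B = "?A * weight M (2 * H * \<rho>) (mi_order \<alpha>)"
      have "Lp_integral p (pd f (join_index \<alpha> \<beta>)) \<le> ennreal ((?B * weight M \<sigma> (mi_order \<beta>)) powr
          p)" if \<beta>: "\<beta> \<in> multi_indices" for \<beta> :: "'b \<Rightarrow> nat"
      proof -
        have "weight M \<rho> (mi_order \<alpha> + mi_order \<beta>) \<le> weight M (2 * H * \<rho>) (mi_order \<alpha>) * weight M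
            (2 * H * \<rho>) (mi_order \<beta>)"
          using \<rho> by (intro weight_add_le[OF M H]) auto
        also have "\<dots> \<le> weight M (2 * H * \<rho>) (mi_order \<alpha>) * weight M \<sigma> (mi_order \<beta>)"
          using H(1) \<rho>(1) \<sigma> by (intro mult_left_mono weight_mono[OF M] weight_nonneg[OF M]) auto
        finally have "?A * weight M \<rho> (mi_order \<alpha> + mi_order \<beta>) \<le> ?B * weight M \<sigma> (mi_order \<beta>)"
          by (simp add: mult.assoc mult_left_mono)
        then have "pd_norm p (join_index \<alpha> \<beta>) f \<le> ennreal (?B * weight M \<sigma> (mi_order \<beta>))"
          using A[OF join_index_multi_indices[OF \<alpha> \<beta>]] unfolding mi_order_join_index[OF \<alpha> \<beta>]
          by (meson ennreal_leI order_trans)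
        then show ?thesis
          unfolding pd_norm_def using H(1) \<rho>(1) \<sigma>
          by (subst (asm) Lp_norm_le_iff[OF p pd_measurable[OF sm join_index_multi_indices[OF \<alpha>
              \<beta>]]])
            (auto intro!: mult_nonneg_nonneg weight_nonneg[OF M])
      qed
      moreover have "0 \<le> ?B" using H(1) \<rho>(1) by (intro mult_nonneg_nonneg weight_nonneg[OF M]) auto
      ultimately show "\<exists>B\<ge>0. \<forall>\<beta>\<in>multi_indices. Lp_integral p (pd f (join_index \<alpha> \<beta>))
          \<le> ennreal ((B * weight M \<sigma> (mi_order \<beta>)) powr p)"
        by blast
    qed (use p pd_family[OF sm] subspace_W_step[OF M \<sigma>(1) p] W_seminorm_seminorm[OF M \<sigma>(1) p]
        weight_nonneg[OF M less_imp_le[OF \<sigma>(1)]] in auto)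
    then show ?thesis by (subst W_step_eq) simp
  qed
  note Ginf = derivative_family_continuous_map[OF continuous_map_W_step_W_inf[OF M \<sigma>(1) p] G]
  have cs: "continuous_seminorm (W_step M p \<sigma>) (W_seminorm M p \<sigma> :: ('b \<Rightarrow> real) \<Rightarrow> real)"
    by (rule continuous_seminorm_W_seminorm_step[OF M \<sigma>(1) p])
  let ?c = "(2 ^ DIM('b)) powr (1 / p) * ?A"
  have "Lp_norm p (\<lambda>x. W_seminorm M p \<sigma> (G \<alpha> x)) \<le> ennreal (?c * weight M (2 * H * \<rho>) (mi_order \<alpha>))"
    if \<alpha>: "\<alpha> \<in> multi_indices" for \<alpha>
    by (rule Lp_norm_W_seminorm_curry[OF M H p G W_seminorm_nonneg A \<rho> \<alpha> Ginf
        continuous_seminorm_comp_measurable[OF cs derivative_familyD(2)[OF G \<alpha>]]])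
  moreover have "0 \<le> ?c" by simp
  ultimately show "\<exists>c\<ge>0. \<forall>\<alpha>\<in>multi_indices. Lp_norm p (\<lambda>x. W_seminorm M p \<sigma> (G \<alpha> x))
      \<le> ennreal (c * weight M (2 * H * \<rho>) (mi_order \<alpha>))"
    by blast
qed

text \<open>Limits in the projective limit are tested step by step, but one family has to serve
  every step. In the application it does, since the joint derivatives of \<open>f\<close> do not
  depend on the radius.\<close>

lemma derivative_family_W_Beurling:
  fixes g :: "'a::euclidean_space \<Rightarrow> 'b::euclidean_space \<Rightarrow> real"
  assumes M: "weight_sequence M" and p: "1 \<le> p"
    and D: "\<And>n. derivative_family (W_step M p (1 / real (Suc n))) g D"
  shows "derivative_family (W_Beurling M p) g D"
proof -
  have mem: "D \<alpha> x \<in> topspace (W_Beurling M p)" if "\<alpha> \<in> multi_indices" for \<alpha> x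
    unfolding topspace_W_Beurling using derivative_familyD(4)[OF D that] by blast
  note V = subspace_W_Beurling[OF M p]
  show ?thesis
    unfolding derivative_family_def
  proof (intro conjI ballI)
    show "D (\<lambda>_. 0) = g" by (rule derivative_familyD(1)[OF D])
    fix \<alpha> :: "'a \<Rightarrow> nat" assume \<alpha>: "\<alpha> \<in> multi_indices"
    show "continuous_map euclidean (W_Beurling M p) (D \<alpha>)"
    proof (rule continuous_map_atinI)
      fix x :: 'a assume x: "x \<in> topspace euclidean"
      show "limitin (W_Beurling M p) (D \<alpha>) (D \<alpha> x) (atin euclidean x)"
        unfolding limitin_W_Beurling
        using mem[OF \<alpha>] derivative_familyD(2)[OF D \<alpha>] x by (simp add: continuous_map_atin)
    qed
    fix b :: 'a assume b: "b \<in> Basis"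
    show "has_partial_derivative (W_Beurling M p) (D \<alpha>) b (D (\<alpha>(b := Suc (\<alpha> b))))"
      unfolding has_partial_derivative_def limitin_W_Beurling
    proof (intro allI conjI always_eventually)
      fix x t n
      show "(1 / t) *\<^sub>R (D \<alpha> (x + t *\<^sub>R b) - D \<alpha> x) \<in> topspace (W_Beurling M p)"
        by (intro subspace_scale[OF V] subspace_diff[OF V] mem \<alpha>)
      show "limitin (W_step M p (1 / real (Suc n))) (\<lambda>t. (1 / t) *\<^sub>R (D \<alpha> (x + t *\<^sub>R b) - D \<alpha> x))
          (D (\<alpha>(b := Suc (\<alpha> b))) x) (at 0)"
        using derivative_familyD(3)[OF D \<alpha> b] unfolding has_partial_derivative_def by blast
    qed
  qed
qed

lemma seminorm_on_subset: "seminorm_on V s \<Longrightarrow> W \<subseteq> V \<Longrightarrow> seminorm_on W s"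
  unfolding seminorm_on_def by (meson subsetD)

lemma W_Beurling_subset_step:
  assumes "weight_sequence M" "0 < \<rho>"
  shows "topspace (W_Beurling M p) \<subseteq> topspace (W_step M p \<rho>)"
  using topspace_W_Beurling_step[OF assms(1) _ assms(2)] by blast

text \<open>The step norms increase as the radius shrinks, so
  \<open>continuous_seminorm_bound\<close> applies and one step already controls
  \<open>s\<close>.\<close>

lemma continuous_seminorm_W_Beurling_bound:
  assumes M: "weight_sequence M" and p: "1 \<le> p"
    and s: "continuous_seminorm (W_Beurling M p :: ('b::euclidean_space \<Rightarrow> real) topology) s"
  obtains n C where "0 \<le> C"
    "\<And>h :: 'b \<Rightarrow> real. h \<in> topspace (W_Beurling M p) \<Longrightarrow> s h \<le> C * W_seminorm M p (1 / real (Suc n)) h"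
proof (rule continuous_seminorm_bound[OF subspace_W_Beurling[OF M p] s, of "\<lambda>n. W_seminorm M p (1
    / real (Suc n))"])
  fix n
  have n: "0 < 1 / real (Suc n)" by simp
  show "seminorm_on (topspace (W_Beurling M p)) (W_seminorm M p (1 / real (Suc n)) :: ('b \<Rightarrow> real)
      \<Rightarrow> real)"
    by (rule seminorm_on_subset[OF W_seminorm_seminorm[OF M n p] W_Beurling_subset_step[OF M n]])
next
  fix m n :: nat and x :: "'b \<Rightarrow> real"
  assume mn: "m \<le> n" and x: "x \<in> topspace (W_Beurling M p)"
  have "1 / real (Suc n) \<le> 1 / real (Suc m)" using mn by (intro divide_left_mono) auto
  then show "W_seminorm M p (1 / real (Suc m)) x \<le> W_seminorm M p (1 / real (Suc n)) x"
    by (intro W_step_mono(2)[OF M] topspace_W_Beurling_step[OF M x]) auto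
next
  fix u :: "nat \<Rightarrow> 'b \<Rightarrow> real"
  assume u: "\<And>k. u k \<in> topspace (W_Beurling M p)"
    and q: "\<And>n. (\<lambda>k. W_seminorm M p (1 / real (Suc n)) (u k)) \<longlonglongrightarrow> 0"
  show "limitin (W_Beurling M p) u 0 sequentially"
    unfolding limitin_W_Beurling
  proof (intro conjI allI always_eventually u)
    fix n
    have n: "0 < 1 / real (Suc n)" by simp
    show "limitin (W_step M p (1 / real (Suc n))) u 0 sequentially"
      unfolding limitin_W_step[OF M n p]
      using zero_in_W_step[OF M n p, where 'a = 'b] topspace_W_Beurling_step[OF M u n] q[of n]
          by simp
  qed
qed (rule that)

lemma continuous_seminorm_W_step_bound:
  assumes M: "weight_sequence M" "0 < \<rho>" and p: "1 \<le> p"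
    and s: "continuous_seminorm (W_step M p \<rho> :: ('b::euclidean_space \<Rightarrow> real) topology) s"
  obtains C where "0 \<le> C"
    "\<And>h :: 'b \<Rightarrow> real. h \<in> topspace (W_step M p \<rho>) \<Longrightarrow> s h \<le> C * W_seminorm M p \<rho> h"
proof (rule continuous_seminorm_bound[OF subspace_W_step[OF M p] s, of "\<lambda>n. W_seminorm M p \<rho>"])
  fix u :: "nat \<Rightarrow> 'b \<Rightarrow> real"
  assume u: "\<And>k. u k \<in> topspace (W_step M p \<rho>)"
    and q: "\<And>n::nat. (\<lambda>k. W_seminorm M p \<rho> (u k)) \<longlonglongrightarrow> 0"
  show "limitin (W_step M p \<rho>) u 0 sequentially"
    unfolding limitin_W_step[OF M p] using zero_in_W_step[OF M p, where 'a = 'b] u q by simp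
qed (auto intro: that W_seminorm_seminorm[OF M p])

text \<open>The common end of both forward arguments: a seminorm dominated by one step norm inherits
  its weighted bound, and the outer radius may be enlarged.\<close>

lemma weighted_sup_bounded_by_W_seminorm:
  fixes G :: "('a::euclidean_space \<Rightarrow> nat) \<Rightarrow> 'a \<Rightarrow> 'b::euclidean_space \<Rightarrow> real"
  assumes M: "weight_sequence M" "0 < \<sigma>" and p: "1 \<le> p" and \<tau>: "0 < \<tau>" "\<tau> \<le> \<tau>'"
    and G: "derivative_family (W_step M p \<sigma>) g G"
    and c: "0 \<le> c" "\<And>\<alpha>. \<alpha> \<in> multi_indices \<Longrightarrow> Lp_norm p (\<lambda>x. W_seminorm M p \<sigma> (G \<alpha> x))
        \<le> ennreal (c * weight M \<tau> (mi_order \<alpha>))"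
    and s: "\<And>\<alpha>. \<alpha> \<in> multi_indices \<Longrightarrow> (\<lambda>x. s (G \<alpha> x)) \<in> borel_measurable borel"
      "\<And>\<alpha> x. \<alpha> \<in> multi_indices \<Longrightarrow> 0 \<le> s (G \<alpha> x)"
    and C: "0 \<le> C" "\<And>\<alpha> x. \<alpha> \<in> multi_indices \<Longrightarrow> s (G \<alpha> x) \<le> C * W_seminorm M p \<sigma> (G \<alpha> x)"
  shows "weighted_sup M p \<tau>' (\<lambda>\<alpha> x. s (G \<alpha> x)) < \<infinity>"
proof -
  have \<tau>': "0 < \<tau>'" using \<tau> by simp
  have "Lp_norm p (\<lambda>x. s (G \<alpha> x)) \<le> ennreal ((C * c) * weight M \<tau>' (mi_order \<alpha>))"
      if \<alpha>: "\<alpha> \<in> multi_indices" for \<alpha>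
  proof -
    have "Lp_norm p (\<lambda>x. s (G \<alpha> x)) \<le> ennreal C * Lp_norm p (\<lambda>x. W_seminorm M p \<sigma> (G \<alpha> x))"
      by (rule Lp_norm_scale_le[OF p s(1)[OF \<alpha>] continuous_seminorm_comp_measurable[OF
          continuous_seminorm_W_seminorm_step[OF M p] derivative_familyD(2)[OF G \<alpha>]] C(1)])
        (use s(2)[OF \<alpha>] C(2)[OF \<alpha>] in simp)
    also have "\<dots> \<le> ennreal C * ennreal (c * weight M \<tau>' (mi_order \<alpha>))"
    proof (rule mult_left_mono)
      show "Lp_norm p (\<lambda>x. W_seminorm M p \<sigma> (G \<alpha> x)) \<le> ennreal (c * weight M \<tau>' (mi_order \<alpha>))"
        using c(1) weight_mono[OF M(1) less_imp_le[OF \<tau>(1)] \<tau>(2)]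
        by (intro order_trans[OF c(2)[OF \<alpha>]] ennreal_leI mult_left_mono) auto
    qed simp
    also have "\<dots> = ennreal ((C * c) * weight M \<tau>' (mi_order \<alpha>))"
      using C(1) by (simp add: ennreal_mult'[symmetric] mult.assoc)
    finally show ?thesis .
  qed
  moreover have "0 \<le> C * c" using C(1) c(1) by simp
  ultimately show ?thesis unfolding weighted_sup_finite_iff[OF M(1) \<tau>'] by blast
qed

text \<open>Forward, a seminorm fixes the inner radius and the condition fixes the outer one;
  \<open>f\<close> lies in steps of every radius, so \<open>\<rho>\<close> can be taken small enough
  for both. Backward, each step norm is itself a continuous seminorm and can be tested
  directly.\<close>

lemma W_Beurling_curry:
  fixes f :: "'a::euclidean_space \<times> 'b::euclidean_space \<Rightarrow> real"
  assumes M: "weight_sequence M" "weakly_log_convex M" "moderate_growth M" and p: "1 \<le> p"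
  shows "f \<in> topspace (W_Beurling M p) \<longleftrightarrow> (\<lambda>x y. f (x, y)) \<in> VW (Q_Beurling M p) (W_Beurling M p)"
proof
  assume f: "f \<in> topspace (W_Beurling M p)"
  obtain H where H: "1 \<le> H" "\<And>j k. M (j + k) \<le> H ^ (j + k) * (M j * M k)"
    using moderate_growth_bound[OF M(1,3)] by blast
  let ?G = "\<lambda>\<alpha> x y. pd f (join_index \<alpha> (\<lambda>_. 0)) (x, y)"
  have step: "derivative_family (W_step M p \<sigma>) (\<lambda>x y. f (x, y)) ?G" if \<sigma>: "0 < \<sigma>" for \<sigma>
    by (rule forward_step(1)[OF M(1) H p _ _ topspace_W_Beurling_step[OF M(1) f, of "\<sigma> / (4 * H)"]])
      (use H(1) \<sigma> in auto)
  have G: "derivative_family (W_Beurling M p) (\<lambda>x y. f (x, y)) ?G"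
    by (rule derivative_family_W_Beurling[OF M(1) p step]) simp
  have "weighted_sup M p \<tau> (\<lambda>\<alpha> x. s (?G \<alpha> x)) < \<infinity>" if s: "continuous_seminorm (W_Beurling M p) s"
      and \<tau>: "0 < \<tau>" for s \<tau>
  proof -
    obtain n C where C: "0 \<le> C"
      "\<And>h. h \<in> topspace (W_Beurling M p) \<Longrightarrow> s h \<le> C * W_seminorm M p (1 / real (Suc n)) h"
      by (rule continuous_seminorm_W_Beurling_bound[OF M(1) p s]) (rule that)
    let ?\<sigma> = "1 / real (Suc n)"
    \<comment> \<open>The first entry gives the inner radius \<open>?\<sigma>\<close> after the loss
      of \<open>4 * H\<close>, the second the outer radius \<open>\<tau>\<close> after the loss of
      \<open>2 * H\<close>.\<close>
    define \<rho> where "\<rho> = min (?\<sigma> / (4 * H)) (\<tau> / (2 * H))"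
    have \<rho>: "0 < \<rho>" using H(1) \<tau> by (simp add: \<rho>_def)
    have \<rho>1: "4 * H * \<rho> \<le> ?\<sigma>"
    proof -
      have "4 * H * \<rho> \<le> 4 * H * (?\<sigma> / (4 * H))" using H(1)
          by (intro mult_left_mono) (auto simp: \<rho>_def)
      then show ?thesis using H(1) by simp
    qed
    have \<rho>2: "2 * H * \<rho> \<le> \<tau>"
    proof -
      have "2 * H * \<rho> \<le> 2 * H * (\<tau> / (2 * H))" using H(1)
          by (intro mult_left_mono) (auto simp: \<rho>_def)
      then show ?thesis using H(1) by simp
    qed
    note fs = forward_step[OF M(1) H p \<rho> \<rho>1 topspace_W_Beurling_step[OF M(1) f \<rho>]]
    obtain c where c: "0 \<le> c" "\<And>\<alpha>. \<alpha> \<in> multi_indices \<Longrightarrow>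
      Lp_norm p (\<lambda>x. W_seminorm M p ?\<sigma> (?G \<alpha> x)) \<le> ennreal (c * weight M (2 * H * \<rho>) (mi_order \<alpha>))"
      using fs(2) by blast
    have mem: "?G \<alpha> x \<in> topspace (W_Beurling M p)" if "\<alpha> \<in> multi_indices" for \<alpha> x
      by (rule derivative_familyD(4)[OF G that])
    show ?thesis
    proof (rule weighted_sup_bounded_by_W_seminorm[where s = s and C = C, OF M(1) _ p _ \<rho>2 fs(1) c])
      show "0 < ?\<sigma>" "0 < 2 * H * \<rho>" using H(1) \<rho> by auto
      show "0 \<le> C" by (rule C)
      fix \<alpha> :: "'a \<Rightarrow> nat" and x assume \<alpha>: "\<alpha> \<in> multi_indices"
      show "(\<lambda>x. s (?G \<alpha> x)) \<in> borel_measurable borel"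
        by (rule continuous_seminorm_comp_measurable[OF s derivative_familyD(2)[OF G \<alpha>]])
      show "0 \<le> s (?G \<alpha> x)" using s mem[OF \<alpha>]
          by (auto simp: continuous_seminorm_def seminorm_on_def)
      show "s (?G \<alpha> x) \<le> C * W_seminorm M p ?\<sigma> (?G \<alpha> x)" by (rule C(2)[OF mem[OF \<alpha>]])
    qed
  qed
  with G show "(\<lambda>x y. f (x, y)) \<in> VW (Q_Beurling M p) (W_Beurling M p)"
    unfolding VW_def Q_Beurling_def by blast
next
  assume "(\<lambda>x y. f (x, y)) \<in> VW (Q_Beurling M p) (W_Beurling M p)"
  then obtain G where G: "derivative_family (W_Beurling M p) (\<lambda>x y. f (x, y)) G"
    and Q: "\<And>s. continuous_seminorm (W_Beurling M p) s \<Longrightarrow> Q_Beurling M p (\<lambda>\<alpha> x. s (G \<alpha> x))"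
        unfolding VW_def by blast
  note Ginf = derivative_family_continuous_map[OF continuous_map_W_Beurling_W_inf[OF M(1) p] G]
  have sm: "smooth f"
      by (rule pd_norm_curry(1)[OF p Ginf multi_indices_zero(1) multi_indices_zero(1)])
  show "f \<in> topspace (W_Beurling M p)"
    unfolding topspace_W_Beurling
  proof (intro INT_I)
    fix n :: nat
    let ?\<sigma> = "1 / real (Suc n)"
    have \<sigma>: "0 < ?\<sigma>" by simp
    have cs: "continuous_seminorm (W_Beurling M p) (W_seminorm M p ?\<sigma> :: ('b \<Rightarrow> real) \<Rightarrow> real)"
    proof (rule continuous_seminormI[OF subspace_W_Beurling[OF M(1) p]
        seminorm_on_subset[OF W_seminorm_seminorm[OF M(1) \<sigma> p] W_Beurling_subset_step[OF M(1) \<sigma>]]])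
      fix x :: "'b \<Rightarrow> real" assume "x \<in> topspace (W_Beurling M p)"
      from limitin_id[OF this] have "limitin (W_step M p ?\<sigma>) (\<lambda>y. y) x (atin (W_Beurling M p) x)"
        unfolding limitin_W_Beurling by blast
      then show "((\<lambda>y. W_seminorm M p ?\<sigma> (y - x)) \<longlongrightarrow> 0) (atin (W_Beurling M p) x)"
        unfolding limitin_W_step[OF M(1) \<sigma> p] by blast
    qed
    \<comment> \<open>All outer radii are allowed, so the inner radius \<open>?\<sigma>\<close> is
      reused; with equal radii \<open>weight_mult_le\<close> merges the weights of
      \<open>\<alpha>\<close> and \<open>\<beta>\<close>.\<close>
    have "weighted_sup M p ?\<sigma> (\<lambda>\<alpha> x. W_seminorm M p ?\<sigma> (G \<alpha> x)) < \<infinity>"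
      using Q[OF cs] \<sigma> unfolding Q_Beurling_def by blast
    then obtain c where c: "0 \<le> c" "\<And>\<alpha>. \<alpha> \<in> multi_indices \<Longrightarrow>
      Lp_norm p (\<lambda>x. W_seminorm M p ?\<sigma> (G \<alpha> x)) \<le> ennreal (c * weight M ?\<sigma> (mi_order \<alpha>))"
      unfolding weighted_sup_finite_iff[OF M(1) \<sigma>] by blast
    have "pd_norm p \<gamma> f \<le> ennreal (c * weight M ?\<sigma> (mi_order \<gamma>))" if \<gamma>: "\<gamma> \<in> multi_indices" for \<gamma>
    proof -
      obtain \<alpha> \<beta> where ab: "\<alpha> \<in> multi_indices" "\<beta> \<in> multi_indices" and \<gamma>: "\<gamma> = join_index \<alpha> \<beta>"
        using \<gamma> by (rule multi_indices_prodE)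
      let ?w = "weight M ?\<sigma> (mi_order \<beta>)"
      have w: "0 \<le> ?w" by (rule weight_nonneg[OF M(1) less_imp_le[OF \<sigma>]])
      have "pd_norm p \<gamma> f = Lp_norm p (\<lambda>x. pd_seminorm p \<beta> (G \<alpha> x))"
        unfolding \<gamma> by (rule pd_norm_curry(4)[OF p Ginf ab])
      also have "\<dots> \<le> ennreal ?w * Lp_norm p (\<lambda>x. W_seminorm M p ?\<sigma> (G \<alpha> x))"
      proof (rule Lp_norm_scale_le[OF p continuous_seminorm_comp_measurable[OF
          continuous_seminorm_pd_seminorm_W_inf[OF p ab(2)] derivative_familyD(2)[OF Ginf ab(1)]]
            continuous_seminorm_comp_measurable[OF cs derivative_familyD(2)[OF G ab(1)]] w])
        fix x
        have "pd_seminorm p \<beta> (G \<alpha> x) \<le> W_seminorm M p ?\<sigma> (G \<alpha> x) * ?w"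
          by (rule pd_seminorm_le_W_seminorm[OF M(1) \<sigma> topspace_W_Beurling_step[OF M(1)
              derivative_familyD(4)[OF G ab(1)] \<sigma>] ab(2)])
        then show "\<bar>pd_seminorm p \<beta> (G \<alpha> x)\<bar> \<le> ?w * \<bar>W_seminorm M p ?\<sigma> (G \<alpha> x)\<bar>"
            by (simp add: mult.commute)
      qed
      also have "\<dots> \<le> ennreal ?w * ennreal (c * weight M ?\<sigma> (mi_order \<alpha>))"
        by (intro mult_left_mono c ab) simp
      also have "\<dots> = ennreal (c * (weight M ?\<sigma> (mi_order \<alpha>) * ?w))"
        using w by (simp add: ennreal_mult'[symmetric] mult.assoc mult.left_commute mult.commute)
      also have "\<dots> \<le> ennreal (c * weight M ?\<sigma> (mi_order \<gamma>))"
        unfolding \<gamma> mi_order_join_index[OF ab]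
            by (intro ennreal_leI mult_left_mono weight_mult_le[OF M(1,2)] c(1)) simp
      finally show ?thesis .
    qed
    then show "f \<in> topspace (W_step M p ?\<sigma>)"
      unfolding topspace_W_step[OF M(1) \<sigma>] using sm c(1) by blast
  qed
qed

text \<open>If \<open>f\<close> were not in the Roumieu space, its norms would violate the bound at some indices
  \<open>\<alpha>\<^sub>n, \<beta>\<^sub>n\<close> for every \<open>n\<close>. The supremum over \<open>n\<close> of the \<open>L\<^sup>p\<close> norms of the \<open>\<beta>\<^sub>n\<close>-th
  derivatives, divided by \<open>weight M (n + 1) \<bar>\<beta>\<^sub>n\<bar>\<close>, is a continuous seminorm on the inductive limit,
  and the bound for this single seminorm contradicts the choice of \<open>\<alpha>\<^sub>n, \<beta>\<^sub>n\<close>.\<close>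

lemma W_Roumieu_curry_backward:
  fixes f :: "'a::euclidean_space \<times> 'b::euclidean_space \<Rightarrow> real"
  assumes M: "weight_sequence M" "weakly_log_convex M" and p: "1 \<le> p"
    and G: "derivative_family (W_Roumieu M p) (\<lambda>x y. f (x, y)) G"
    and Q: "\<And>s. continuous_seminorm (W_Roumieu M p) s \<Longrightarrow> Q_Roumieu M p (\<lambda>\<alpha> x. s (G \<alpha> x))"
  shows "f \<in> topspace (W_Roumieu M p)"
proof (rule ccontr)
  assume nf: "f \<notin> topspace (W_Roumieu M p)"
  note Ginf = derivative_family_continuous_map[OF continuous_map_W_Roumieu_W_inf[OF M(1) p] G]
  have sm: "smooth f"
      by (rule pd_norm_curry(1)[OF p Ginf multi_indices_zero(1) multi_indices_zero(1)])
  \<comment> \<open>Constant and radius are both \<open>n + 1\<close>, so that these failures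
    eventually beat every fixed constant and radius.\<close>
  have "\<exists>\<alpha> \<beta>. \<alpha> \<in> multi_indices \<and> \<beta> \<in> multi_indices \<and>
    \<not> pd_norm p (join_index \<alpha> \<beta>) f \<le> ennreal (real (Suc n) * weight M (real (Suc n)) (mi_order \<alpha> +
        mi_order \<beta>))" for n
  proof -
    have "f \<notin> topspace (W_step M p (real (Suc n)))"
      using nf unfolding topspace_W_Roumieu[OF M(1) p] by blast
    then obtain \<gamma> where \<gamma>: "\<gamma> \<in> multi_indices"
      "\<not> pd_norm p \<gamma> f \<le> ennreal (real (Suc n) * weight M (real (Suc n)) (mi_order \<gamma>))"
      using sm topspace_W_step[OF M(1), of "real (Suc n)" f p]
      by (auto simp del: of_nat_Suc dest!: spec[of _ "real (Suc n)"])
    obtain \<alpha> \<beta> where "\<alpha> \<in> multi_indices" "\<beta> \<in> multi_indices" "\<gamma> = join_index \<alpha> \<beta>"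
      using \<gamma>(1) by (rule multi_indices_prodE)
    then show ?thesis using \<gamma>(2) by (auto simp: mi_order_join_index)
  qed
  then obtain a b where a: "\<And>n. a n \<in> multi_indices" and b: "\<And>n. b n \<in> multi_indices"
    and ab: "\<And>n. \<not> pd_norm p (join_index (a n) (b n)) f \<le> ennreal (real (Suc n) * weight M (real
        (Suc n)) (mi_order (a n) + mi_order (b n)))"
    by metis
  define w where "w n = weight M (real (Suc n)) (mi_order (b n))" for n
  have w: "0 < w n" for n unfolding w_def by (rule weight_pos[OF M(1)]) simp
  \<comment> \<open>A supremum of reals, meaningful only where the values are bounded;
    \<open>bdd\<close> shows this on the whole Roumieu space.\<close>
  define s where "s h = (SUP n. pd_seminorm p (b n) h / w n)" for h
  have step_bd: "\<exists>C\<ge>0. \<forall>h\<in>topspace (W_step M p (real (Suc m))). \<forall>n. pd_seminorm p (b n) h / w n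
      \<le> C * W_seminorm M p (real (Suc m)) h" for m
  proof -
    \<comment> \<open>\<open>r n\<close> is the quotient of the weights of radius
      \<open>m + 1\<close> and \<open>n + 1\<close> at the order of \<open>b n\<close>. It is at
      most 1 for \<open>n > m\<close>; the finitely many remaining values are absorbed into
      \<open>C\<close>. This is why the radius in \<open>w n\<close> has to grow with
      \<open>n\<close>.\<close>
    define r where "r n = (real (Suc m) / real (Suc n)) ^ mi_order (b n)" for n
    define C where "C = 1 + (\<Sum>n\<le>m. r n)"
    have r0: "0 \<le> r n" for n by (simp add: r_def)
    have rC: "r n \<le> C" for n
    proof (cases "n \<le> m")
      case True
      have "r n \<le> (\<Sum>n\<le>m. r n)" using True r0 by (intro member_le_sum) auto
      then show ?thesis by (simp add: C_def)
    next
      case False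
      then have "r n \<le> 1" unfolding r_def by (intro power_le_one) (auto simp: field_simps)
      then show ?thesis using sum_nonneg[of "{..m}" r] r0
          by (auto simp: C_def intro: add_increasing2)
    qed
    have "pd_seminorm p (b n) h / w n \<le> C * W_seminorm M p (real (Suc m)) h"
      if h: "h \<in> topspace (W_step M p (real (Suc m)))" for h n
    proof -
      have "pd_seminorm p (b n) h \<le> W_seminorm M p (real (Suc m)) h * weight M (real (Suc m))
          (mi_order (b n))"
        by (rule pd_seminorm_le_W_seminorm[OF M(1) _ h b]) simp
      also have "weight M (real (Suc m)) (mi_order (b n)) = r n * w n"
        unfolding r_def w_def weight_def by (simp add: power_divide)
      finally have "pd_seminorm p (b n) h / w n \<le> W_seminorm M p (real (Suc m)) h * r n"
        using w[of n] by (simp add: divide_le_eq mult.assoc)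
      also have "\<dots> \<le> W_seminorm M p (real (Suc m)) h * C" by (intro mult_left_mono rC) simp
      finally show ?thesis by (simp add: mult.commute)
    qed
    moreover have "0 \<le> C" using r0[of 0] rC[of 0] by linarith
    ultimately show ?thesis by blast
  qed
  have bdd: "bdd_above (range (\<lambda>n. pd_seminorm p (b n) h / w n))"
      if "h \<in> topspace (W_Roumieu M p)" for h
  proof -
    obtain m where m: "h \<in> topspace (W_step M p (real (Suc m)))"
      using \<open>h \<in> topspace (W_Roumieu M p)\<close> unfolding topspace_W_Roumieu[OF M(1) p] by blast
    then show ?thesis using step_bd[of m] unfolding bdd_above_def by blast
  qed
  have le_s: "pd_seminorm p (b n) h / w n \<le> s h" if "h \<in> topspace (W_Roumieu M p)" for h n
    unfolding s_def by (rule cSUP_upper[OF UNIV_I bdd[OF that]])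
  have s_le: "s h \<le> c" if "\<And>n. pd_seminorm p (b n) h / w n \<le> c" for h c
    unfolding s_def by (rule cSUP_least) (use that in auto)
  have s0: "0 \<le> s h" if "h \<in> topspace (W_Roumieu M p)" for h
    by (rule order_trans[OF divide_nonneg_pos[OF pd_seminorm_nonneg w] le_s[OF that]])
  have V: "subspace (topspace (W_Roumieu M p :: ('b \<Rightarrow> real) topology))"
      by (rule subspace_W_Roumieu[OF M(1) p])
  have sn: "seminorm_on (topspace (W_Roumieu M p)) (pd_seminorm p (b n))" for n
    by (rule pd_seminorm_seminorm[OF p b W_Roumieu_subset_W_inf[OF M(1) p]])
  have s_scale: "s (c *\<^sub>R h) \<le> \<bar>c\<bar> * s h" if h: "h \<in> topspace (W_Roumieu M p)" for c h
  proof (rule s_le)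
    fix n
    have "pd_seminorm p (b n) (c *\<^sub>R h) / w n = \<bar>c\<bar> * (pd_seminorm p (b n) h / w n)"
      by (simp add: seminorm_onD(3)[OF sn V h])
    also have "\<dots> \<le> \<bar>c\<bar> * s h" by (intro mult_left_mono le_s h) simp
    finally show "pd_seminorm p (b n) (c *\<^sub>R h) / w n \<le> \<bar>c\<bar> * s h" .
  qed
  have s_sn: "seminorm_on (topspace (W_Roumieu M p)) s"
    unfolding seminorm_on_def
  proof (intro conjI ballI allI s0)
    fix h k :: "'b \<Rightarrow> real" assume hk: "h \<in> topspace (W_Roumieu M p)" "k \<in> topspace (W_Roumieu M p)"
    show "s (h + k) \<le> s h + s k"
    proof (rule s_le)
      fix n
      have "pd_seminorm p (b n) (h + k) / w n \<le> (pd_seminorm p (b n) h + pd_seminorm p (b n) k) /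
          w n"
        using w[of n] by (intro divide_right_mono seminorm_onD(2)[OF sn V hk]) auto
      also have "\<dots> \<le> s h + s k"
        unfolding add_divide_distrib by (intro add_mono le_s hk)
      finally show "pd_seminorm p (b n) (h + k) / w n \<le> s h + s k" .
    qed
  next
    fix c and h :: "'b \<Rightarrow> real" assume h: "h \<in> topspace (W_Roumieu M p)"
    show "s (c *\<^sub>R h) = \<bar>c\<bar> * s h"
    proof (cases "c = 0")
      case True
      have "0 \<le> s (c *\<^sub>R h)" by (intro s0 subspace_scale[OF V] h)
      then show ?thesis using s_scale[OF h, of c] True by (intro antisym) auto
    next
      case False
      have "s ((1 / c) *\<^sub>R (c *\<^sub>R h)) \<le> \<bar>1 / c\<bar> * s (c *\<^sub>R h)"
        by (intro s_scale subspace_scale[OF V] h)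
      then have "\<bar>c\<bar> * s h \<le> s (c *\<^sub>R h)" using False by (simp add: field_simps)
      then show ?thesis using s_scale[OF h, of c] by simp
    qed
  qed
  have s_bd: "\<exists>C\<ge>0. \<forall>h\<in>topspace (W_step M p (real (Suc m))). s h
      \<le> C * W_seminorm M p (real (Suc m)) h" for m
    using step_bd[of m] s_le by meson
  have cs: "continuous_seminorm (W_Roumieu M p) s"
    by (rule continuous_seminormI[OF V s_sn limitin_W_Roumieu_seminorm[OF M(1) p s_sn s_bd
        limitin_id]])
  obtain \<sigma> where \<sigma>: "0 < \<sigma>" "weighted_sup M p \<sigma> (\<lambda>\<alpha> x. s (G \<alpha> x)) < \<infinity>"
    using Q[OF cs] unfolding Q_Roumieu_def by blast
  then obtain c where c: "0 \<le> c" "\<And>\<alpha>. \<alpha> \<in> multi_indices \<Longrightarrow>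
      Lp_norm p (\<lambda>x. s (G \<alpha> x)) \<le> ennreal (c * weight M \<sigma> (mi_order \<alpha>))"
    unfolding weighted_sup_finite_iff[OF M(1) \<sigma>(1)] by blast
  \<comment> \<open>For such an \<open>n\<close> the constant \<open>c\<close> and the weight of
    radius \<open>\<sigma>\<close> are dominated by the constant and radius refused at the pair
    \<open>a n\<close>, \<open>b n\<close>.\<close>
  obtain n where n: "max \<sigma> c \<le> real n" using real_arch_simple by blast
  have "pd_norm p (join_index (a n) (b n)) f = Lp_norm p (\<lambda>x. pd_seminorm p (b n) (G (a n) x))"
    by (rule pd_norm_curry(4)[OF p Ginf a b])
  also have "\<dots> \<le> ennreal (w n) * Lp_norm p (\<lambda>x. s (G (a n) x))"
  proof (rule Lp_norm_scale_le[OF p continuous_seminorm_comp_measurable[OF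
      continuous_seminorm_pd_seminorm_W_inf[OF p b] derivative_familyD(2)[OF Ginf a]]
        continuous_seminorm_comp_measurable[OF cs derivative_familyD(2)[OF G a]] less_imp_le[OF w]])
    fix x
    have m: "G (a n) x \<in> topspace (W_Roumieu M p)" by (rule derivative_familyD(4)[OF G a])
    show "\<bar>pd_seminorm p (b n) (G (a n) x)\<bar> \<le> w n * \<bar>s (G (a n) x)\<bar>"
      using le_s[OF m, of n] s0[OF m] w[of n] by (simp add: field_simps)
  qed
  also have "\<dots> \<le> ennreal (w n) * ennreal (c * weight M \<sigma> (mi_order (a n)))"
    by (intro mult_left_mono c a) simp
  also have "\<dots> = ennreal (c * (weight M \<sigma> (mi_order (a n)) * w n))"
    using w[of n] by (simp add: ennreal_mult'[symmetric] mult.assoc mult.left_commute mult.commute)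
  also have "\<dots> \<le> ennreal (real (Suc n) * weight M (real (Suc n)) (mi_order (a n) + mi_order (b n)))"
  proof (intro ennreal_leI mult_mono)
    have "weight M \<sigma> (mi_order (a n)) * w n \<le> weight M (real (Suc n)) (mi_order (a n)) * w n"
      using n \<sigma>(1) w[of n] by (intro mult_right_mono weight_mono[OF M(1)]) auto
    also have "\<dots> \<le> weight M (real (Suc n)) (mi_order (a n) + mi_order (b n))"
      unfolding w_def by (intro weight_mult_le[OF M]) simp
    finally show "weight M \<sigma> (mi_order (a n)) * w n \<le> weight M (real (Suc n)) (mi_order (a n) +
        mi_order (b n))" .
    show "0 \<le> weight M \<sigma> (mi_order (a n)) * w n"
      using w[of n] \<sigma>(1) by (intro mult_nonneg_nonneg weight_nonneg[OF M(1)]) auto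
  qed (use n in auto)
  finally show False using ab[of n] by simp
qed

text \<open>Forward, all slices and their derivatives lie in one step of radius at least
  \<open>4 * H * \<rho>\<close>. A continuous seminorm of the limit restricts to that step and is
  dominated by its norm, so one outer radius works for all seminorms.\<close>

lemma W_Roumieu_curry:
  fixes f :: "'a::euclidean_space \<times> 'b::euclidean_space \<Rightarrow> real"
  assumes M: "weight_sequence M" "weakly_log_convex M" "moderate_growth M" and p: "1 \<le> p"
  shows "f \<in> topspace (W_Roumieu M p) \<longleftrightarrow> (\<lambda>x y. f (x, y)) \<in> VW (Q_Roumieu M p) (W_Roumieu M p)"
proof
  assume f: "f \<in> topspace (W_Roumieu M p)"
  obtain H where H: "1 \<le> H" "\<And>j k. M (j + k) \<le> H ^ (j + k) * (M j * M k)"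
    using moderate_growth_bound[OF M(1,3)] by blast
  obtain \<rho> where \<rho>: "0 < \<rho>" and f\<rho>: "f \<in> topspace (W_step M p \<rho>)"
    using f unfolding topspace_W_Roumieu_iff[OF M(1) p] by blast
  obtain n where "4 * H * \<rho> \<le> real n" using real_arch_simple by blast
  then have n: "4 * H * \<rho> \<le> real (Suc n)" by simp
  have \<sigma>: "0 < real (Suc n)" by simp
  let ?G = "\<lambda>\<alpha> x y. pd f (join_index \<alpha> (\<lambda>_. 0)) (x, y)"
  note fs = forward_step[OF M(1) H p \<rho> n f\<rho>]
  note incl = continuous_map_W_step_W_Roumieu[OF M(1) p, where n = n and 'a = 'b]
  note G = derivative_family_continuous_map[OF incl fs(1)]
  have mem: "?G \<alpha> x \<in> topspace (W_Roumieu M p)" if "\<alpha> \<in> multi_indices" for \<alpha> x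
    by (rule derivative_familyD(4)[OF G that])
  have mem': "?G \<alpha> x \<in> topspace (W_step M p (real (Suc n)))" if "\<alpha> \<in> multi_indices" for \<alpha> x
    by (rule derivative_familyD(4)[OF fs(1) that])
  obtain c where c: "0 \<le> c" "\<And>\<alpha>. \<alpha> \<in> multi_indices \<Longrightarrow>
    Lp_norm p (\<lambda>x. W_seminorm M p (real (Suc n)) (?G \<alpha> x)) \<le> ennreal (c * weight M (2 * H * \<rho>)
        (mi_order \<alpha>))"
    using fs(2) by blast
  have \<tau>: "0 < 2 * H * \<rho>" using H(1) \<rho> by simp
  have "weighted_sup M p (2 * H * \<rho>) (\<lambda>\<alpha> x. s (?G \<alpha> x)) < \<infinity>"
      if s: "continuous_seminorm (W_Roumieu M p) s" for s
  proof -
    have sub: "topspace (W_step M p (real (Suc n)) :: ('b \<Rightarrow> real) topology) \<subseteq> topspace (W_Roumieu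
        M p)"
      unfolding topspace_W_Roumieu[OF M(1) p] by blast
    have "continuous_map (W_step M p (real (Suc n))) euclideanreal s"
      using continuous_map_compose[OF incl, of euclideanreal s] s
      unfolding continuous_seminorm_def o_def by blast
    then have s': "continuous_seminorm (W_step M p (real (Suc n))) s"
      using s sub unfolding continuous_seminorm_def by (auto intro: seminorm_on_subset)
    obtain C where C: "0 \<le> C" "\<And>h. h \<in> topspace (W_step M p (real (Suc n))) \<Longrightarrow>
        s h \<le> C * W_seminorm M p (real (Suc n)) h"
      by (rule continuous_seminorm_W_step_bound[OF M(1) \<sigma> p s']) (rule that)
    show ?thesis
    proof (rule weighted_sup_bounded_by_W_seminorm[where s = s
        and C = C, OF M(1) \<sigma> p \<tau> order_refl fs(1) c])
      show "0 \<le> C" by (rule C)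
      fix \<alpha> :: "'a \<Rightarrow> nat" and x assume \<alpha>: "\<alpha> \<in> multi_indices"
      show "(\<lambda>x. s (?G \<alpha> x)) \<in> borel_measurable borel"
        by (rule continuous_seminorm_comp_measurable[OF s derivative_familyD(2)[OF G \<alpha>]])
      show "0 \<le> s (?G \<alpha> x)" using s mem[OF \<alpha>]
          by (auto simp: continuous_seminorm_def seminorm_on_def)
      show "s (?G \<alpha> x) \<le> C * W_seminorm M p (real (Suc n)) (?G \<alpha> x)" by (rule C(2)[OF mem'[OF \<alpha>]])
    qed
  qed
  with G \<tau> show "(\<lambda>x y. f (x, y)) \<in> VW (Q_Roumieu M p) (W_Roumieu M p)"
    unfolding VW_def Q_Roumieu_def by blast
next
  assume "(\<lambda>x y. f (x, y)) \<in> VW (Q_Roumieu M p) (W_Roumieu M p)"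
  then obtain G where "derivative_family (W_Roumieu M p) (\<lambda>x y. f (x, y)) G"
    "\<And>s. continuous_seminorm (W_Roumieu M p) s \<Longrightarrow> Q_Roumieu M p (\<lambda>\<alpha> x. s (G \<alpha> x))" unfolding VW_def
      by blast
  then show "f \<in> topspace (W_Roumieu M p)" by (rule W_Roumieu_curry_backward[OF M(1,2) p])
qed

section \<open>Reduction to components\<close>

lemma derivative_family_power_space:
  fixes g :: "'a::euclidean_space \<Rightarrow> 'b \<Rightarrow> real ^ 'n"
  shows "derivative_family (power_space T) g D \<longleftrightarrow>
    (\<forall>i. derivative_family T (\<lambda>x y. g x y $ i) (\<lambda>\<alpha> x y. D \<alpha> x y $ i))"
proof -
  have cm: "continuous_map euclidean (power_space T) h \<longleftrightarrow> (\<forall>i. continuous_map euclidean T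
      (\<lambda>x y. h x y $ i))"
    for h :: "'a \<Rightarrow> 'b \<Rightarrow> real ^ 'n"
    by (auto simp: continuous_map_atin limitin_power_space)
  have pd: "has_partial_derivative (power_space T) h b h' \<longleftrightarrow>
      (\<forall>i. has_partial_derivative T (\<lambda>x y. h x y $ i) b (\<lambda>x y. h' x y $ i))"
    for h h' :: "'a \<Rightarrow> 'b \<Rightarrow> real ^ 'n" and b
    unfolding has_partial_derivative_def limitin_power_space
        by (auto simp: scaleR_fun_def fun_diff_def)
  have "D (\<lambda>_. 0) = g \<longleftrightarrow> (\<forall>i. (\<lambda>x y. D (\<lambda>_. 0) x y $ i) = (\<lambda>x y. g x y $ i))"
    by (auto simp: fun_eq_iff vec_eq_iff)
  then show ?thesis unfolding derivative_family_def cm pd by blast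
qed

text \<open>The index sets are sets of naturals because a definition cannot quantify over index types.\<close>

definition solid :: "real \<Rightarrow> ((('a::euclidean_space \<Rightarrow> nat) \<Rightarrow> 'a \<Rightarrow> real) \<Rightarrow> bool) \<Rightarrow> bool" where
  "solid p Q \<longleftrightarrow> (\<forall>G (I :: nat set) F. finite I \<longrightarrow> (\<forall>i\<in>I. Q (F i)) \<longrightarrow>
    (\<forall>\<alpha>\<in>multi_indices. G \<alpha> \<in> borel_measurable borel \<and> (\<forall>i\<in>I. F i \<alpha> \<in> borel_measurable borel) \<and>
      (\<forall>x. \<bar>G \<alpha> x\<bar> \<le> (\<Sum>i\<in>I. \<bar>F i \<alpha> x\<bar>))) \<longrightarrow> Q G)"

text \<open>Carries the condition from sets of naturals to a finite index type by enumerating the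
  type.\<close>

lemma solidD:
  fixes F :: "'i::finite \<Rightarrow> ('a::euclidean_space \<Rightarrow> nat) \<Rightarrow> 'a \<Rightarrow> real"
  assumes Q: "solid p Q" and F: "\<And>i. Q (F i)"
    and meas: "\<And>\<alpha>. \<alpha> \<in> multi_indices \<Longrightarrow> G \<alpha> \<in> borel_measurable borel"
      "\<And>\<alpha> i. \<alpha> \<in> multi_indices \<Longrightarrow> F i \<alpha> \<in> borel_measurable borel"
    and le: "\<And>\<alpha> x. \<alpha> \<in> multi_indices \<Longrightarrow> \<bar>G \<alpha> x\<bar> \<le> (\<Sum>i\<in>UNIV. \<bar>F i \<alpha> x\<bar>)"
  shows "Q G"
proof -
  obtain f :: "nat \<Rightarrow> 'i" and n where f: "bij_betw f {..<n} UNIV"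
    using ex_bij_betw_nat_finite[of "UNIV :: 'i set"] by (auto simp: atLeast0LessThan)
  have "(\<Sum>i\<in>UNIV. \<bar>F i \<alpha> x\<bar>) = (\<Sum>k<n. \<bar>F (f k) \<alpha> x\<bar>)" for \<alpha> x
    by (rule sum.reindex_bij_betw[OF f, symmetric])
  then show ?thesis
    using Q F meas le unfolding solid_def
        by (auto dest!: spec[of _ G] spec[of _ "{..<n}"] spec[of _ "\<lambda>k. F (f k)"])
qed

lemma Lp_norm_sum_finite:
  assumes "1 \<le> p" "finite I" "\<And>i. i \<in> I \<Longrightarrow> Lp_norm p (v i) < \<infinity>" "u \<in> borel_measurable borel"
    "\<And>i. i \<in> I \<Longrightarrow> v i \<in> borel_measurable borel" "\<And>x. \<bar>u x\<bar> \<le> (\<Sum>i\<in>I. \<bar>v i x\<bar>)"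
  shows "Lp_norm p u < \<infinity>"
proof -
  have "Lp_norm p u \<le> (\<Sum>i\<in>I. Lp_norm p (v i))" by (rule Lp_norm_le_sum) (use assms in auto)
  also have "\<dots> < \<infinity>" using assms(2,3) by simp
  finally show ?thesis .
qed

lemma weighted_sup_sum_finite:
  assumes M: "weight_sequence M" "0 < \<sigma>" and p: "1 \<le> p" and I: "finite I"
    and F: "\<And>i. i \<in> I \<Longrightarrow> weighted_sup M p \<sigma> (F i) < \<infinity>"
    and meas: "\<And>\<alpha>. \<alpha> \<in> multi_indices \<Longrightarrow> G \<alpha> \<in> borel_measurable borel"
      "\<And>\<alpha> i. \<alpha> \<in> multi_indices \<Longrightarrow> i \<in> I \<Longrightarrow> F i \<alpha> \<in> borel_measurable borel"
    and le: "\<And>\<alpha> x. \<alpha> \<in> multi_indices \<Longrightarrow> \<bar>G \<alpha> x\<bar> \<le> (\<Sum>i\<in>I. \<bar>F i \<alpha> x\<bar>)"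
  shows "weighted_sup M p \<sigma> G < \<infinity>"
proof -
  have "\<forall>i\<in>I. \<exists>c\<ge>0. \<forall>\<alpha>\<in>multi_indices. Lp_norm p (F i \<alpha>) \<le> ennreal (c * weight M \<sigma> (mi_order \<alpha>))"
    using F unfolding weighted_sup_finite_iff[OF M] by blast
  then obtain c where c: "\<And>i. i \<in> I \<Longrightarrow> 0 \<le> c i"
    "\<And>i \<alpha>. i \<in> I \<Longrightarrow> \<alpha> \<in> multi_indices \<Longrightarrow> Lp_norm p (F i \<alpha>) \<le> ennreal (c i * weight M \<sigma> (mi_order \<alpha>))"
    by metis
  have "Lp_norm p (G \<alpha>) \<le> ennreal ((\<Sum>i\<in>I. c i) * weight M \<sigma> (mi_order \<alpha>))"
      if \<alpha>: "\<alpha> \<in> multi_indices" for \<alpha>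
  proof -
    have "Lp_norm p (G \<alpha>) \<le> (\<Sum>i\<in>I. Lp_norm p (F i \<alpha>))"
      by (rule Lp_norm_le_sum[OF p I meas(1)[OF \<alpha>] meas(2)[OF \<alpha>] le[OF \<alpha>]])
    also have "\<dots> \<le> (\<Sum>i\<in>I. ennreal (c i * weight M \<sigma> (mi_order \<alpha>)))"
      by (intro sum_mono c \<alpha>)
    also have "\<dots> = ennreal ((\<Sum>i\<in>I. c i) * weight M \<sigma> (mi_order \<alpha>))"
      unfolding sum_distrib_right
      by (intro sum_ennreal mult_nonneg_nonneg c(1) weight_nonneg[OF M(1) less_imp_le[OF M(2)]])
    finally show ?thesis .
  qed
  moreover have "0 \<le> (\<Sum>i\<in>I. c i)" by (intro sum_nonneg c(1))
  ultimately show ?thesis unfolding weighted_sup_finite_iff[OF M] by blast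
qed

lemma solid_Q_inf:
  assumes "1 \<le> p" shows "solid p (Q_inf p :: (('a::euclidean_space \<Rightarrow> nat) \<Rightarrow> 'a \<Rightarrow> real) \<Rightarrow> bool)"
  unfolding solid_def Q_inf_def
proof (intro allI impI ballI)
  fix G :: "('a \<Rightarrow> nat) \<Rightarrow> 'a \<Rightarrow> real" and \<alpha> :: "'a \<Rightarrow> nat" and I :: "nat set"
      and F :: "nat \<Rightarrow> ('a \<Rightarrow> nat) \<Rightarrow> 'a \<Rightarrow> real"
  assume "finite I" and F: "\<forall>i\<in>I. \<forall>\<alpha>\<in>multi_indices. Lp_norm p (F i \<alpha>) < \<infinity>"
    and G: "\<forall>\<alpha>\<in>multi_indices. G \<alpha> \<in> borel_measurable borel \<and>
        (\<forall>i\<in>I. F i \<alpha> \<in> borel_measurable borel) \<and>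
      (\<forall>x. \<bar>G \<alpha> x\<bar> \<le> (\<Sum>i\<in>I. \<bar>F i \<alpha> x\<bar>))" and \<alpha>: "\<alpha> \<in> multi_indices"
  show "Lp_norm p (G \<alpha>) < \<infinity>"
    by (rule Lp_norm_sum_finite[OF assms \<open>finite I\<close>, of "\<lambda>i. F i \<alpha>"]) (use F G \<alpha> in auto)
qed

lemma solid_Q_Beurling:
  assumes "weight_sequence M" "1 \<le> p"
      shows "solid p (Q_Beurling M p :: (('a::euclidean_space \<Rightarrow> nat) \<Rightarrow> 'a \<Rightarrow> real) \<Rightarrow> bool)"
  unfolding solid_def Q_Beurling_def
proof (intro allI impI)
  fix G :: "('a \<Rightarrow> nat) \<Rightarrow> 'a \<Rightarrow> real" and \<sigma> and I :: "nat set" and F :: "nat \<Rightarrow> ('a \<Rightarrow> nat) \<Rightarrow> 'a \<Rightarrow> real"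
  assume "finite I" and F: "\<forall>i\<in>I. \<forall>\<sigma>>0. weighted_sup M p \<sigma> (F i) < \<infinity>"
    and G: "\<forall>\<alpha>\<in>multi_indices. G \<alpha> \<in> borel_measurable borel \<and>
        (\<forall>i\<in>I. F i \<alpha> \<in> borel_measurable borel) \<and>
      (\<forall>x. \<bar>G \<alpha> x\<bar> \<le> (\<Sum>i\<in>I. \<bar>F i \<alpha> x\<bar>))" and \<sigma>: "(0::real) < \<sigma>"
  show "weighted_sup M p \<sigma> G < \<infinity>"
    by (rule weighted_sup_sum_finite[OF assms(1) \<sigma> assms(2) \<open>finite I\<close>, of F]) (use F G \<sigma> in auto)
qed

lemma weighted_sup_mono_radius:
  assumes M: "weight_sequence M" and "0 < \<rho>" "\<rho> \<le> \<sigma>" "weighted_sup M p \<rho> G < \<infinity>"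
  shows "weighted_sup M p \<sigma> G < \<infinity>"
proof -
  have \<sigma>: "0 < \<sigma>" using assms by simp
  obtain c where c: "0 \<le> c" "\<And>\<alpha>. \<alpha> \<in> multi_indices \<Longrightarrow>
      Lp_norm p (G \<alpha>) \<le> ennreal (c * weight M \<rho> (mi_order \<alpha>))"
    using assms(4) unfolding weighted_sup_finite_iff[OF M assms(2)] by blast
  have "Lp_norm p (G \<alpha>) \<le> ennreal (c * weight M \<sigma> (mi_order \<alpha>))" if \<alpha>: "\<alpha> \<in> multi_indices" for \<alpha>
    by (rule order_trans[OF c(2)[OF \<alpha>]])
      (intro ennreal_leI mult_left_mono c(1) weight_mono[OF M less_imp_le[OF assms(2)] assms(3)])
  with c(1) show ?thesis unfolding weighted_sup_finite_iff[OF M \<sigma>] by blast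
qed

lemma solid_Q_Roumieu:
  assumes "weight_sequence M" "1 \<le> p"
      shows "solid p (Q_Roumieu M p :: (('a::euclidean_space \<Rightarrow> nat) \<Rightarrow> 'a \<Rightarrow> real) \<Rightarrow> bool)"
  unfolding solid_def Q_Roumieu_def
proof (intro allI impI)
  fix G :: "('a \<Rightarrow> nat) \<Rightarrow> 'a \<Rightarrow> real" and I :: "nat set" and F :: "nat \<Rightarrow> ('a \<Rightarrow> nat) \<Rightarrow> 'a \<Rightarrow> real"
  assume I: "finite I" and F: "\<forall>i\<in>I. \<exists>\<sigma>>0. weighted_sup M p \<sigma> (F i) < \<infinity>"
    and G: "\<forall>\<alpha>\<in>multi_indices. G \<alpha> \<in> borel_measurable borel \<and>
        (\<forall>i\<in>I. F i \<alpha> \<in> borel_measurable borel) \<and>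
      (\<forall>x. \<bar>G \<alpha> x\<bar> \<le> (\<Sum>i\<in>I. \<bar>F i \<alpha> x\<bar>))"
  obtain \<tau> where \<tau>: "\<And>i. i \<in> I \<Longrightarrow> 0 < \<tau> i" "\<And>i. i \<in> I \<Longrightarrow> weighted_sup M p (\<tau> i) (F i) < \<infinity>"
    using F by metis
  \<comment> \<open>Exceeds each of the finitely many radii; the summand 1 keeps it positive for an
    empty index set.\<close>
  let ?\<sigma> = "1 + (\<Sum>i\<in>I. \<tau> i)"
  have le: "\<tau> i \<le> ?\<sigma>" if "i \<in> I" for i
  proof -
    have "\<tau> i \<le> (\<Sum>i\<in>I. \<tau> i)" by (rule member_le_sum[OF that _ I]) (auto intro: less_imp_le \<tau>(1))
    then show ?thesis by simp
  qed
  have \<sigma>: "0 < ?\<sigma>" by (intro add_pos_nonneg sum_nonneg) (auto intro: less_imp_le \<tau>(1))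
  have "weighted_sup M p ?\<sigma> G < \<infinity>"
  proof (rule weighted_sup_sum_finite[OF assms(1) \<sigma> assms(2) I, of F])
    fix i assume i: "i \<in> I"
    show "weighted_sup M p ?\<sigma> (F i) < \<infinity>"
      by (rule weighted_sup_mono_radius[OF assms(1) \<tau>(1)[OF i] le[OF i] \<tau>(2)[OF i]])
  qed (use G in auto)
  with \<sigma> show "\<exists>\<sigma>>0. weighted_sup M p \<sigma> G < \<infinity>" by blast
qed

lemma subspace_power_space:
  fixes T :: "('b \<Rightarrow> real) topology"
  assumes V: "subspace (topspace T)"
  shows "subspace (topspace (power_space T :: ('b \<Rightarrow> real ^ 'n) topology))"
proof (rule subspaceI)
  show "0 \<in> topspace (power_space T :: ('b \<Rightarrow> real ^ 'n) topology)"
    using subspace_0[OF V] by (simp add: topspace_power_space zero_fun_def)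
  fix f g :: "'b \<Rightarrow> real ^ 'n" and c
  assume f: "f \<in> topspace (power_space T)"
  show "c *\<^sub>R f \<in> topspace (power_space T)"
    using f subspace_scale[OF V] unfolding topspace_power_space by (auto simp: scaleR_fun_def)
  assume g: "g \<in> topspace (power_space T)"
  show "f + g \<in> topspace (power_space T)"
    using f g subspace_add[OF V] unfolding topspace_power_space by (fastforce simp: plus_fun_def)
qed

text \<open>Projecting to a component and then applying a seminorm gives a continuous seminorm of
  the power. Conversely a seminorm of the power is at most the sum of its restrictions to the
  components, and solidity of \<open>Q\<close> lets the condition pass from the sum to it.\<close>

lemma VW_power_space:
  fixes T :: "('b \<Rightarrow> real) topology" and g :: "'a::euclidean_space \<Rightarrow> 'b \<Rightarrow> real ^ 'n"
  assumes V: "subspace (topspace T)" and Q: "solid p Q"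
  shows "g \<in> VW Q (power_space T) \<longleftrightarrow> (\<forall>i. (\<lambda>x y. g x y $ i) \<in> VW Q T)"
proof
  assume "g \<in> VW Q (power_space T)"
  then obtain D where D: "derivative_family (power_space T) g D"
    and QD: "\<And>s. continuous_seminorm (power_space T) s \<Longrightarrow> Q (\<lambda>\<alpha> x. s (D \<alpha> x))" unfolding VW_def
        by blast
  show "\<forall>i. (\<lambda>x y. g x y $ i) \<in> VW Q T"
  proof
    fix i :: 'n
    have cm: "continuous_map (power_space T) T (\<lambda>f x. (f x :: real ^ 'n) $ i)"
    proof (rule continuous_map_atinI)
      fix f :: "'b \<Rightarrow> real ^ 'n" assume "f \<in> topspace (power_space T)"
      from limitin_id[OF this] show "limitin T (\<lambda>f x. f x $ i) (\<lambda>x. f x $ i) (atin (power_space T)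
          f)"
        unfolding limitin_power_space by blast
    qed
    have "Q (\<lambda>\<alpha> x. s (\<lambda>y. D \<alpha> x y $ i))" if s: "continuous_seminorm T s" for s
    proof (rule QD[of "\<lambda>f. s (\<lambda>y. f y $ i)"])
      have "continuous_map (power_space T) euclideanreal (\<lambda>f. s (\<lambda>y. f y $ i))"
        using continuous_map_compose[OF cm, of euclideanreal s] s
            unfolding continuous_seminorm_def o_def by blast
      moreover have "seminorm_on (topspace (power_space T)) (\<lambda>f. s (\<lambda>y. f y $ i))"
      proof -
        have s': "seminorm_on (topspace T) s" using s by (simp add: continuous_seminorm_def)
        have eq: "(\<lambda>y. (f + h) y $ i) = (\<lambda>y. f y $ i) + (\<lambda>y. h y $ i)"
            "(\<lambda>y. (c *\<^sub>R f) y $ i) = c *\<^sub>R (\<lambda>y. f y $ i)"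
          for f h :: "'b \<Rightarrow> real ^ 'n" and c
          by (auto simp: plus_fun_def scaleR_fun_def)
        show ?thesis
          unfolding seminorm_on_def eq using seminorm_onD(1-3)[OF s' V]
              by (auto simp: topspace_power_space)
      qed
      ultimately show "continuous_seminorm (power_space T) (\<lambda>f. s (\<lambda>y. f y $ i))"
        unfolding continuous_seminorm_def by blast
    qed
    then show "(\<lambda>x y. g x y $ i) \<in> VW Q T"
      using D unfolding VW_def derivative_family_power_space by blast
  qed
next
  assume "\<forall>i. (\<lambda>x y. g x y $ i) \<in> VW Q T"
  then have "\<forall>i. \<exists>D. derivative_family T (\<lambda>x y. g x y $ i) D \<and> (\<forall>s. continuous_seminorm T s \<longrightarrow>
      Q (\<lambda>\<alpha> x. s (D \<alpha> x)))"
    unfolding VW_def by blast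
  then obtain E where E: "\<And>i. derivative_family T (\<lambda>x y. g x y $ i) (E i)"
    and QE: "\<And>i s. continuous_seminorm T s \<Longrightarrow> Q (\<lambda>\<alpha> x. s (E i \<alpha> x))"
    by metis
  define D where "D \<alpha> x y = (\<chi> i. E i \<alpha> x y)" for \<alpha> x y
  have D: "derivative_family (power_space T) g D"
    unfolding derivative_family_power_space D_def using E by simp
  \<comment> \<open>Inserts a scalar function as the \<open>i\<close>-th component, with zeros
    elsewhere; every element of the power is the sum of its components inserted this way.\<close>
  let ?e = "\<lambda>i h y. axis i (h y) :: real ^ 'n"
  have e_cm: "continuous_map T (power_space T) (?e i)" for i
  proof (rule continuous_map_atinI)
    fix h assume h: "h \<in> topspace T"
    have "limitin T (\<lambda>t x. ?e i t x $ j) (\<lambda>x. ?e i h x $ j) (atin T h)" for j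
      using limitin_id[OF h] subspace_0[OF V]
          by (cases "j = i") (simp_all add: axis_def zero_fun_def)
    then show "limitin (power_space T) (?e i) (?e i h) (atin T h)" unfolding limitin_power_space
        by blast
  qed
  have "Q (\<lambda>\<alpha> x. s (D \<alpha> x))" if s: "continuous_seminorm (power_space T) s" for s
  proof -
    note W = subspace_power_space[OF V, where 'n = 'n]
    have sn: "seminorm_on (topspace (power_space T)) s" using s
        by (simp add: continuous_seminorm_def)
    have mem: "?e i h \<in> topspace (power_space T)" if "h \<in> topspace T" for h i
      using e_cm[of i] that by (auto simp: continuous_map_def)
    have se: "continuous_seminorm T (\<lambda>h. s (?e i h))" for i
      unfolding continuous_seminorm_def
    proof
      show "continuous_map T euclideanreal (\<lambda>h. s (?e i h))"
        using continuous_map_compose[OF e_cm, of euclideanreal s i] s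
            unfolding continuous_seminorm_def o_def by blast
      have eq: "?e i (f + h) = ?e i f + ?e i h" "?e i (c *\<^sub>R f) = c *\<^sub>R ?e i f"
          for f h :: "'b \<Rightarrow> real" and c
        by (auto simp: plus_fun_def scaleR_fun_def axis_def vec_eq_iff fun_eq_iff)
      show "seminorm_on (topspace T) (\<lambda>h. s (?e i h))"
        unfolding seminorm_on_def eq using seminorm_onD(1-3)[OF sn W] mem by blast
    qed
    have sum_le: "s (\<Sum>i\<in>J. h i) \<le> (\<Sum>i\<in>J. s (h i))"
      if "finite J" "\<And>i. i \<in> J \<Longrightarrow> h i \<in> topspace (power_space T)" for J :: "'n set" and h
      using that
    proof (induction J rule: finite_induct)
      case empty
      then show ?case using seminorm_onD(4)[OF sn W] by (simp add: zero_fun_def)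
    next
      case (insert j J)
      have "s (h j + (\<Sum>i\<in>J. h i)) \<le> s (h j) + s (\<Sum>i\<in>J. h i)"
        using insert.prems by (intro seminorm_onD(2)[OF sn W] subspace_sum[OF W]) auto
      also have "\<dots> \<le> s (h j) + (\<Sum>i\<in>J. s (h i))" using insert by (intro add_left_mono) auto
      finally show ?case unfolding sum.insert[OF insert.hyps] .
    qed
    show ?thesis
    proof (rule solidD[OF Q, of "\<lambda>i \<alpha> x. s (?e i (E i \<alpha> x))"])
      fix i show "Q (\<lambda>\<alpha> x. s (?e i (E i \<alpha> x)))" by (rule QE[OF se])
    next
      fix \<alpha> :: "'a \<Rightarrow> nat" assume \<alpha>: "\<alpha> \<in> multi_indices"
      show "(\<lambda>x. s (D \<alpha> x)) \<in> borel_measurable borel"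
        by (rule continuous_seminorm_comp_measurable[OF s derivative_familyD(2)[OF D \<alpha>]])
      show "(\<lambda>x. s (?e i (E i \<alpha> x))) \<in> borel_measurable borel" for i
        by (rule continuous_seminorm_comp_measurable[OF se derivative_familyD(2)[OF E \<alpha>]])
      fix x
      have m: "?e i (E i \<alpha> x) \<in> topspace (power_space T)" for i
          by (rule mem[OF derivative_familyD(4)[OF E \<alpha>]])
      have "D \<alpha> x = (\<Sum>i\<in>UNIV. ?e i (E i \<alpha> x))"
      proof
        fix y
        have "(\<Sum>i\<in>UNIV. ?e i (E i \<alpha> x)) y = (\<Sum>i\<in>UNIV. ?e i (E i \<alpha> x) y)"
          by (induction rule: infinite_finite_induct[of _ "UNIV :: 'n set"])
              (auto simp: plus_fun_def zero_fun_def)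
        then show "D \<alpha> x y = (\<Sum>i\<in>UNIV. ?e i (E i \<alpha> x)) y"
          by (simp add: D_def vec_eq_iff axis_def sum_component)
      qed
      then have "s (D \<alpha> x) \<le> (\<Sum>i\<in>UNIV. s (?e i (E i \<alpha> x)))"
        using sum_le[of UNIV "\<lambda>i. ?e i (E i \<alpha> x)"] m by simp
      moreover have "0 \<le> s (D \<alpha> x)" by (rule seminorm_onD(1)[OF sn W derivative_familyD(4)[OF D \<alpha>]])
      moreover have "0 \<le> s (?e i (E i \<alpha> x))" for i by (rule seminorm_onD(1)[OF sn W m])
      ultimately show "\<bar>s (D \<alpha> x)\<bar> \<le> (\<Sum>i\<in>UNIV. \<bar>s (?e i (E i \<alpha> x))\<bar>)" by simp
    qed
  qed
  with D show "g \<in> VW Q (power_space T)" unfolding VW_def by blast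
qed

text \<open>Uniqueness is inherited from \<open>W_inf\<close> through the components.\<close>

lemma limitin_power_space_unique:
  fixes T :: "('b::euclidean_space \<Rightarrow> real) topology" and u :: "'c \<Rightarrow> 'b \<Rightarrow> real ^ 'n"
  assumes p: "1 \<le> p" and T: "continuous_map T (W_inf p) (\<lambda>x. x)" and F: "F \<noteq> bot"
    and l: "limitin (power_space T) u l F" and l': "limitin (power_space T) u l' F"
  shows "l = l'"
proof -
  have "(\<lambda>x. l x $ i) = (\<lambda>x. l' x $ i)" for i
    using limitin_W_inf_unique[OF p F] continuous_map_limitinD[OF T] l l'
        unfolding limitin_power_space by metis
  then show ?thesis by (simp add: fun_eq_iff vec_eq_iff)
qed

text \<open>Returns from an arbitrary family to the selected one. Families are determined only on
  \<open>multi_indices\<close>, so \<open>Q\<close> must not distinguish families that agree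
  there.\<close>

lemma VW_iff_partial_deriv:
  fixes T :: "('b::euclidean_space \<Rightarrow> real) topology"
  assumes p: "1 \<le> p" and T: "continuous_map T (W_inf p) (\<lambda>x. x)"
    and Q: "\<And>F G. (\<And>\<alpha>. \<alpha> \<in> multi_indices \<Longrightarrow> F \<alpha> = G \<alpha>) \<Longrightarrow> Q F \<Longrightarrow> Q G"
  shows "VW Q (power_space T) = {g :: 'a::euclidean_space \<Rightarrow> 'b \<Rightarrow> real ^ 'n. smooth_into
      (power_space T) g \<and>
    (\<forall>s. continuous_seminorm (power_space T) s \<longrightarrow> Q (\<lambda>\<alpha>. s \<circ> partial_deriv (power_space T) g \<alpha>))}"
proof (intro set_eqI iffI CollectI conjI allI impI)
  fix g :: "'a \<Rightarrow> 'b \<Rightarrow> real ^ 'n" assume "g \<in> VW Q (power_space T)"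
  then obtain D where D: "derivative_family (power_space T) g D"
    and QD: "\<And>s. continuous_seminorm (power_space T) s \<Longrightarrow> Q (\<lambda>\<alpha> x. s (D \<alpha> x))" unfolding VW_def
        by blast
  show sm: "smooth_into (power_space T) g" using D unfolding smooth_into_def by blast
  fix s :: "('b \<Rightarrow> real ^ 'n) \<Rightarrow> real" assume s: "continuous_seminorm (power_space T) s"
  show "Q (\<lambda>\<alpha>. s \<circ> partial_deriv (power_space T) g \<alpha>)"
  proof (rule Q[OF _ QD[OF s]])
    fix \<alpha> :: "'a \<Rightarrow> nat" assume \<alpha>: "\<alpha> \<in> multi_indices"
    have "D \<alpha> = partial_deriv (power_space T) g \<alpha>"
      by (rule derivative_family_unique[OF limitin_power_space_unique[OF p T]
          D derivative_family_partial_deriv[OF sm] \<alpha>])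
    then show "(\<lambda>x. s (D \<alpha> x)) = s \<circ> partial_deriv (power_space T) g \<alpha>" by (simp add: o_def)
  qed
next
  fix g :: "'a \<Rightarrow> 'b \<Rightarrow> real ^ 'n"
  assume "g \<in> {g. smooth_into (power_space T) g \<and>
    (\<forall>s. continuous_seminorm (power_space T) s \<longrightarrow> Q (\<lambda>\<alpha>. s \<circ> partial_deriv (power_space T) g \<alpha>))}"
  then show "g \<in> VW Q (power_space T)"
    unfolding VW_def o_def using derivative_family_partial_deriv[of "power_space T" g] by blast
qed

lemma exponential_law_power_space:
  fixes T :: "('b::euclidean_space \<Rightarrow> real) topology"
      and U :: "('a::euclidean_space \<times> 'b \<Rightarrow> real) topology"
  assumes V: "subspace (topspace T)" and Q: "solid p Q"
    and scalar: "\<And>f. f \<in> topspace U \<longleftrightarrow> (\<lambda>x y. f (x, y)) \<in> VW Q T"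
  shows "exponential_law (topspace (power_space U) :: ('a \<times> 'b \<Rightarrow> real ^ 'n) set) (VW Q
      (power_space T))"
proof -
  have *: "f \<in> topspace (power_space U) \<longleftrightarrow> curry f \<in> VW Q (power_space T)"
      for f :: "'a \<times> 'b \<Rightarrow> real ^ 'n"
    unfolding VW_power_space[OF V Q] topspace_power_space scalar by (simp add: curry_def)
  moreover have "\<exists>f\<in>topspace (power_space U). g = curry f" if "g \<in> VW Q (power_space T)"
      for g :: "'a \<Rightarrow> 'b \<Rightarrow> real ^ 'n"
    using that *[of "case_prod g"] by (intro bexI[of _ "case_prod g"]) simp_all
  ultimately show ?thesis unfolding exponential_law_def by blast
qed

theorem theorem6p8:
  fixes M :: "nat \<Rightarrow> real" and p :: real
  assumes "weight_sequence M" and "weakly_log_convex M" and "moderate_growth M"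
    and "1 \<le> p"
  shows
    "exponential_law
       (topspace (power_space (W_inf p)) :: ((real ^ 'l) \<times> (real ^ 'm) \<Rightarrow> real ^ 'n) set)
       (VW_inf p (power_space (W_inf p))) \<and>
     exponential_law
       (topspace (power_space (W_Beurling M p)) :: ((real ^ 'l) \<times> (real ^ 'm) \<Rightarrow> real ^ 'n) set)
       (VW_Beurling M p (power_space (W_Beurling M p))) \<and>
     exponential_law
       (topspace (power_space (W_Roumieu M p)) :: ((real ^ 'l) \<times> (real ^ 'm) \<Rightarrow> real ^ 'n) set)
       (VW_Roumieu M p (power_space (W_Roumieu M p)))"
proof (intro conjI)
  note M = assms(1) and p = assms(4)
  \<comment> \<open>The weighted conditions see a family only on \<open>multi_indices\<close>, as
    \<open>VW_iff_partial_deriv\<close> demands.\<close>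
  have weighted_sup_cong: "weighted_sup M p \<sigma> F = weighted_sup M p \<sigma> G"
    if "\<And>\<alpha>. \<alpha> \<in> multi_indices \<Longrightarrow> F \<alpha> = G \<alpha>" for \<sigma> and F G :: "(real ^ 'l \<Rightarrow> nat) \<Rightarrow> real ^ 'l \<Rightarrow> real"
    unfolding weighted_sup_def using that by (intro SUP_cong) auto
  have "VW_inf p (power_space (W_inf p)) =
      (VW (Q_inf p) (power_space (W_inf p)) :: (real ^ 'l \<Rightarrow> real ^ 'm \<Rightarrow> real ^ 'n) set)"
    by (subst VW_iff_partial_deriv[OF p]) (auto simp: VW_inf_def Q_inf_def)
  then show "exponential_law
       (topspace (power_space (W_inf p)) :: ((real ^ 'l) \<times> (real ^ 'm) \<Rightarrow> real ^ 'n) set)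
       (VW_inf p (power_space (W_inf p)))"
    using exponential_law_power_space[OF subspace_W_inf[OF p] solid_Q_inf[OF p] W_inf_curry[OF p]]
        by simp
  have "VW_Beurling M p (power_space (W_Beurling M p)) =
      (VW (Q_Beurling M p) (power_space (W_Beurling M p)) :: (real ^ 'l \<Rightarrow> real ^ 'm \<Rightarrow> real ^ 'n)
          set)"
    by (subst VW_iff_partial_deriv[OF p continuous_map_W_Beurling_W_inf[OF M p]])
      (auto simp: VW_Beurling_def Q_Beurling_def cong: weighted_sup_cong)
  then show "exponential_law
       (topspace (power_space (W_Beurling M p)) :: ((real ^ 'l) \<times> (real ^ 'm) \<Rightarrow> real ^ 'n) set)
       (VW_Beurling M p (power_space (W_Beurling M p)))"
    using exponential_law_power_space[OF subspace_W_Beurling[OF M p] solid_Q_Beurling[OF M p]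
        W_Beurling_curry[OF assms]] by simp
  have "VW_Roumieu M p (power_space (W_Roumieu M p)) =
      (VW (Q_Roumieu M p) (power_space (W_Roumieu M p)) :: (real ^ 'l \<Rightarrow> real ^ 'm \<Rightarrow> real ^ 'n) set)"
    by (subst VW_iff_partial_deriv[OF p continuous_map_W_Roumieu_W_inf[OF M p]])
      (auto simp: VW_Roumieu_def Q_Roumieu_def cong: weighted_sup_cong)
  then show "exponential_law
       (topspace (power_space (W_Roumieu M p)) :: ((real ^ 'l) \<times> (real ^ 'm) \<Rightarrow> real ^ 'n) set)
       (VW_Roumieu M p (power_space (W_Roumieu M p)))"
    using exponential_law_power_space[OF subspace_W_Roumieu[OF M p] solid_Q_Roumieu[OF M p]
        W_Roumieu_curry[OF assms]] by simp
qed

end
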